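(* Let $K\ge 1$, $\mathcal{K}=\{1,\dots,K\}$, $\alpha>2$, and for each $i\in\mathcal{K}$ let $\lambda_i>0$, $P_i>0$, $p_i\in[0,1]$ (with the $p_i$ not all zero) and $\beta_i>1$. Let $\mathtt{P_c}$ be the open access coverage probability of the $K$-tier network described in the context. Then for every integer $m>0$, $$- \sum_{n=1}^{2m}g(n)\;\leq\; \mathtt{P_c}- \frac{\pi}{C(\alpha)}\, \frac{\sum_{i=1}^K p_i \lambda_i P_i^{2/\alpha}\beta_i^{-2/\alpha}}{\sum_{i=1}^K p_i \lambda_i P_i^{2/\alpha} }\;\leq\; - \sum_{n=1}^{2m-1}g(n),$$ where $$C(\alpha)=\frac{2\pi^2\csc(2\pi/\alpha)}{\alpha},$$ $$g(n)=\left(-\frac{A}{\eta}\right)^n\left\{\frac{1}{\Gamma\left(1+\frac{2n}{\alpha}\right)}-\frac{B_n}{\eta}\,\frac{\pi\,\Gamma\left(1+\frac{2}{\alpha}\right)}{\Gamma\left(1+\frac{2(n+1)}{\alpha}\right)}\right\},$$ $$A=\pi\Gamma\left(1+\tfrac{2}{\alpha}\right)\sum_{l\in \mathcal{K}}(1-p_l)\lambda_l P_l^{2/\alpha}\beta_l^{-2/\alpha},\qquad \eta=C(\alpha)\sum_{l=1}^K p_l\lambda_lP_l^{2/\alpha},$$ $$B_n= \sum_{i\in\mathcal{K}}\frac{\lambda_ip_iP_i^{2/\alpha} \beta_i^{-2/\alpha}\;{}_2F_1\left(1,\frac{2n}{\alpha},1+\frac{2(n+1)}{\alpha},\frac{1}{1+\beta_i}\right)}{(1+\beta_i)^{2n/\alpha}},$$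 and ${}_2F_1(a,b,c,z)=\frac{\Gamma(c)}{\Gamma(b)\Gamma(c-b)}\int_0^1\frac{t^{b-1}(1-t)^{c-b-1}}{(1-tz)^a}\,dt$.
   Context: Network model. $\mathcal{K}=\{1,\dots,K\}$ indexes the tiers of base stations (BSs). Tier $i$ has BS density $\lambda_i$, transmit power $P_i$, target signal-to-interference ratio $\beta_i$ and activity factor $p_i$. The BSs of tier $i$ form a homogeneous Poisson point process (PPP) $\Phi_i$ on $\mathbb{R}^2$ of density $\lambda_i$, independent across tiers. Each $\Phi_i$ is independently partitioned into $\Psi_i$ (active BSs) and $\Delta_i$ (idle BSs), which are independent homogeneous PPPs of densities $p_i\lambda_i$ and $(1-p_i)\lambda_i$. All $2K$ processes $\Psi_i,\Delta_i$ are mutually independent. Each BS location $x$ carries a fading variable $h_x$; the $h_x$ are i.i.d. exponential with mean $1$ (Rayleigh fading), independent of the point processes. A BS at $x\in\Phi_i$ is received at the origin (the typical mobile) with power $P_ih_x\|x\|^{-\alpha}$. There is no thermal noise. Notation. $\Psi=\bigcup_{i\in\mathcal{K}}\Psi_i$; $M(\Psi_i)=\sup_{x\in\Psi_i}P_ih_x\|x\|^{-\alpha}$, $M(\Delta_i)=\sup_{x\in\Delta_i}P_ih_x\|x\|^{-\alpha}$, $M(\Psi)=\max_{i\in\mathcal{K}}M(\Psi_i)$, with $M(\emptyset)=0$; $I=\sum_{i=1}^K\sum_{x\in\Psi_i}P_ih_x\|x\|^{-\alpha}$. The open access coverage probability of the network is $$\mathtt{P_c} = 1-\mathbb{E}\left[\prod_{i\in\mathcal{K}}\mathbf{1}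 \left(\frac{M(\Psi_i)}{I-M(\Psi)}<\beta_i\right)\mathbf{1} \left(\frac{M(\Delta_i)}{I}<\beta_i\right)\right].$$ *)

theory Defs
  imports "HOL-Probability.Probability"
begin

text \<open>
  A point process is a random locally finite set of points, observed through its counts on
  bounded Borel sets. The point probabilities are spelled out because \<open>poisson_pmf\<close> excludes
  rate \<open>0\<close>, whereas here the density \<open>d = 0\<close> must be admissible.
\<close>

definition homogeneous_ppp ::
    "'w measure \<Rightarrow> real \<Rightarrow> ('w \<Rightarrow> 'a::euclidean_space set) \<Rightarrow> bool" where
  "homogeneous_ppp M d \<Phi> \<longleftrightarrow>
     (\<forall>\<omega>\<in>space M. \<forall>B. bounded B \<longrightarrow> finite (\<Phi> \<omega> \<inter> B)) \<and>
     (\<forall>B. B \<in> sets borel \<and> bounded B \<longrightarrow>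
        (\<lambda>\<omega>. card (\<Phi> \<omega> \<inter> B)) \<in> measurable M (count_space UNIV) \<and>
        (\<forall>k. measure M {\<omega> \<in> space M. card (\<Phi> \<omega> \<inter> B) = k} =
               exp (- (d * measure lborel B)) * (d * measure lborel B) ^ k / fact k)) \<and>
     (\<forall>(A :: nat \<Rightarrow> 'a set) n.
        disjoint_family_on A {..<n} \<and> (\<forall>i<n. A i \<in> sets borel \<and> bounded (A i)) \<longrightarrow>
        prob_space.indep_vars M (\<lambda>_. count_space UNIV) (\<lambda>i \<omega>. card (\<Phi> \<omega> \<inter> A i)) {..<n})"

definition indep_processes ::
    "'w measure \<Rightarrow> 'j set \<Rightarrow> ('j \<Rightarrow> 'w \<Rightarrow> 'a::euclidean_space set) \<Rightarrow> bool" where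
  "indep_processes M J \<Theta> \<longleftrightarrow>
     prob_space.indep_sets M
       (\<lambda>j. sigma_sets (space M)
          {{\<omega> \<in> space M. card (\<Theta> j \<omega> \<inter> B) = k} | B k. B \<in> sets borel \<and> bounded B}) J"

text \<open>
  I.i.d. unit-mean exponential marks, independent of the processes \<open>\<Theta> j\<close>. An
  uncountable i.i.d. family indexed by all of space would leave the sum of marks over a random
  set without a measurable meaning, so this is the usual definition of an independently marked
  process: the points of \<open>\<Theta> j\<close> are enumerated measurably and without repetition as
  \<open>X j 0, X j 1, ...\<close> (\<open>N j\<close> of them, possibly infinitely many), and the \<open>n\<close>-th point carries
  the mark \<open>H j n\<close>, where the \<open>H j n\<close> are i.i.d. and jointly independent of all \<open>N j\<close> and \<open>X j n\<close>.
  The value \<open>h j \<omega> x\<close> is only constrained at points \<open>x \<in> \<Theta> j \<omega>\<close>.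
\<close>

definition iid_exponential_marks ::
    "'w measure \<Rightarrow> 'j set \<Rightarrow> ('j \<Rightarrow> 'w \<Rightarrow> 'a::euclidean_space set) \<Rightarrow> ('j \<Rightarrow> 'w \<Rightarrow> 'a \<Rightarrow> real) \<Rightarrow> bool"
  where
  "iid_exponential_marks M J \<Theta> h \<longleftrightarrow>
     (\<exists>(N :: 'j \<Rightarrow> 'w \<Rightarrow> enat) (X :: 'j \<Rightarrow> nat \<Rightarrow> 'w \<Rightarrow> 'a) (H :: 'j \<Rightarrow> nat \<Rightarrow> 'w \<Rightarrow> real).
        (\<forall>j\<in>J. \<forall>\<omega>\<in>space M.
           bij_betw (\<lambda>n. X j n \<omega>) {n. enat n < N j \<omega>} (\<Theta> j \<omega>) \<and>
           (\<forall>n. enat n < N j \<omega> \<longrightarrow> h j \<omega> (X j n \<omega>) = H j n \<omega>)) \<and>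
        (\<forall>j\<in>J. \<forall>n. distributed M lborel (H j n) (exponential_density 1)) \<and>
        prob_space.indep_vars M (\<lambda>_. borel) (\<lambda>(j, n). H j n) (J \<times> UNIV) \<and>
        prob_space.indep_set M
          (sets (vimage_algebra (space M)
             (\<lambda>\<omega>. \<lambda>(j, n)\<in>J \<times> UNIV. H j n \<omega>)
             (PiM (J \<times> UNIV) (\<lambda>_. borel))))
          (sets (vimage_algebra (space M)
             (\<lambda>\<omega>. (\<lambda>j\<in>J. N j \<omega>, \<lambda>(j, n)\<in>J \<times> UNIV. X j n \<omega>))
             (PiM J (\<lambda>_. count_space UNIV) \<Otimes>\<^sub>M PiM (J \<times> UNIV) (\<lambda>_. borel)))))"

text \<open>
  Tier \<open>i\<close> has base stations \<open>Phi i\<close>, split into the active ones \<open>Psi i\<close> and the idle ones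
  \<open>Delta i\<close>; \<open>h i \<omega> x\<close> is the fading of the tier-\<open>i\<close> base station at \<open>x\<close>. The \<open>2K\<close> processes
  are indexed by pairs (tier, active?).
\<close>

locale k_tier_network = prob_space M
  for M :: "'w measure" +
  fixes K :: nat
    and lam p :: "nat \<Rightarrow> real"
    and Phi Psi Delta :: "nat \<Rightarrow> 'w \<Rightarrow> (real ^ 2) set"
    and h :: "nat \<Rightarrow> 'w \<Rightarrow> real ^ 2 \<Rightarrow> real"
  assumes Phi_ppp: "\<And>i. i \<in> {1..K} \<Longrightarrow> homogeneous_ppp M (lam i) (Phi i)"
    and Phi_indep: "indep_processes M {1..K} Phi"
    and partition: "\<And>i \<omega>. i \<in> {1..K} \<Longrightarrow> \<omega> \<in> space M \<Longrightarrow>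
          Phi i \<omega> = Psi i \<omega> \<union> Delta i \<omega> \<and> Psi i \<omega> \<inter> Delta i \<omega> = {}"
    and Psi_ppp: "\<And>i. i \<in> {1..K} \<Longrightarrow> homogeneous_ppp M (p i * lam i) (Psi i)"
    and Delta_ppp: "\<And>i. i \<in> {1..K} \<Longrightarrow> homogeneous_ppp M ((1 - p i) * lam i) (Delta i)"
    and Psi_Delta_indep:
      "indep_processes M ({1..K} \<times> UNIV) (\<lambda>(i, active). if active then Psi i else Delta i)"
    and fading:
      "iid_exponential_marks M ({1..K} \<times> UNIV)
         (\<lambda>(i, active). if active then Psi i else Delta i) (\<lambda>(i, active). h i)"

definition rx_power :: "real \<Rightarrow> real \<Rightarrow> (real ^ 2 \<Rightarrow> real) \<Rightarrow> real ^ 2 \<Rightarrow> real" where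
  "rx_power \<alpha> P h x = P * h x * norm x powr (- \<alpha>)"

definition max_power :: "real \<Rightarrow> real \<Rightarrow> (real ^ 2 \<Rightarrow> real) \<Rightarrow> (real ^ 2) set \<Rightarrow> real" where
  "max_power \<alpha> P h S = (if S = {} then 0 else SUP x\<in>S. rx_power \<alpha> P h x)"

definition max_power_all ::
    "nat \<Rightarrow> real \<Rightarrow> (nat \<Rightarrow> real) \<Rightarrow> (nat \<Rightarrow> real ^ 2 \<Rightarrow> real) \<Rightarrow> (nat \<Rightarrow> (real ^ 2) set) \<Rightarrow> real" where
  "max_power_all K \<alpha> P h S = Max ((\<lambda>i. max_power \<alpha> (P i) (h i) (S i)) ` {1..K})"

text \<open>
  The sum, the suprema and the quotients below are taken in the reals; for \<open>\<alpha> > 2\<close> and a positive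
  total density of active stations, the sums converge, the suprema are finite and the
  denominators are positive almost surely.
\<close>

definition total_power ::
    "nat \<Rightarrow> real \<Rightarrow> (nat \<Rightarrow> real) \<Rightarrow> (nat \<Rightarrow> real ^ 2 \<Rightarrow> real) \<Rightarrow> (nat \<Rightarrow> (real ^ 2) set) \<Rightarrow> real" where
  "total_power K \<alpha> P h S = (\<Sum>i=1..K. \<Sum>\<^sub>\<infinity>x\<in>S i. rx_power \<alpha> (P i) (h i) x)"

definition coverage_prob ::
    "'w measure \<Rightarrow> nat \<Rightarrow> real \<Rightarrow> (nat \<Rightarrow> real) \<Rightarrow> (nat \<Rightarrow> real) \<Rightarrow>
     (nat \<Rightarrow> 'w \<Rightarrow> (real ^ 2) set) \<Rightarrow> (nat \<Rightarrow> 'w \<Rightarrow> (real ^ 2) set) \<Rightarrow>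
     (nat \<Rightarrow> 'w \<Rightarrow> real ^ 2 \<Rightarrow> real) \<Rightarrow> real" where
  "coverage_prob M K \<alpha> P \<beta> Psi Delta h =
     1 - (\<integral>\<omega>.
       (let hw = (\<lambda>i. h i \<omega>);
            Psiw = (\<lambda>i. Psi i \<omega>);
            I = total_power K \<alpha> P hw Psiw
        in \<Prod>i\<in>{1..K}.
             of_bool (max_power \<alpha> (P i) (hw i) (Psiw i) / (I - max_power_all K \<alpha> P hw Psiw) < \<beta> i) *
             of_bool (max_power \<alpha> (P i) (hw i) (Delta i \<omega>) / I < \<beta> i)) \<partial>M)"

definition hyp2F1 :: "real \<Rightarrow> real \<Rightarrow> real \<Rightarrow> real \<Rightarrow> real" where
  "hyp2F1 a b c z =
     Gamma c / (Gamma b * Gamma (c - b)) *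
     integral {0..1} (\<lambda>t. t powr (b - 1) * (1 - t) powr (c - b - 1) / (1 - t * z) powr a)"

definition C_const :: "real \<Rightarrow> real" where
  "C_const \<alpha> = 2 * pi\<^sup>2 * inverse (sin (2 * pi / \<alpha>)) / \<alpha>"

definition A_const ::
    "nat \<Rightarrow> real \<Rightarrow> (nat \<Rightarrow> real) \<Rightarrow> (nat \<Rightarrow> real) \<Rightarrow> (nat \<Rightarrow> real) \<Rightarrow> (nat \<Rightarrow> real) \<Rightarrow> real" where
  "A_const K \<alpha> lam P p \<beta> =
     pi * Gamma (1 + 2 / \<alpha>) *
     (\<Sum>l=1..K. (1 - p l) * lam l * P l powr (2 / \<alpha>) * \<beta> l powr (- 2 / \<alpha>))"

definition eta_const ::
    "nat \<Rightarrow> real \<Rightarrow> (nat \<Rightarrow> real) \<Rightarrow> (nat \<Rightarrow> real) \<Rightarrow> (nat \<Rightarrow> real) \<Rightarrow> real" where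
  "eta_const K \<alpha> lam P p = C_const \<alpha> * (\<Sum>l=1..K. p l * lam l * P l powr (2 / \<alpha>))"

definition B_coeff ::
    "nat \<Rightarrow> real \<Rightarrow> (nat \<Rightarrow> real) \<Rightarrow> (nat \<Rightarrow> real) \<Rightarrow> (nat \<Rightarrow> real) \<Rightarrow> (nat \<Rightarrow> real) \<Rightarrow> nat \<Rightarrow> real" where
  "B_coeff K \<alpha> lam P p \<beta> n =
     (\<Sum>i=1..K. lam i * p i * P i powr (2 / \<alpha>) * \<beta> i powr (- 2 / \<alpha>) *
        hyp2F1 1 (2 * real n / \<alpha>) (1 + 2 * (real n + 1) / \<alpha>) (1 / (1 + \<beta> i)) /
        (1 + \<beta> i) powr (2 * real n / \<alpha>))"

definition g_term ::
    "nat \<Rightarrow> real \<Rightarrow> (nat \<Rightarrow> real) \<Rightarrow> (nat \<Rightarrow> real) \<Rightarrow> (nat \<Rightarrow> real) \<Rightarrow> (nat \<Rightarrow> real) \<Rightarrow> nat \<Rightarrow> real" where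
  "g_term K \<alpha> lam P p \<beta> n =
     (- (A_const K \<alpha> lam P p \<beta> / eta_const K \<alpha> lam P p)) ^ n *
     (1 / Gamma (1 + 2 * real n / \<alpha>) -
      B_coeff K \<alpha> lam P p \<beta> n / eta_const K \<alpha> lam P p *
      (pi * Gamma (1 + 2 / \<alpha>) / Gamma (1 + 2 * (real n + 1) / \<alpha>)))"

end

(*
  Everything in the outage event depends only on the received powers. By independent marking and
  the mapping theorem, the powers of the active (idle) stations of a tier form a Poisson process on
  the half-line whose intensity is a multiple of d * s powr (- d - 1), where d = 2 / alpha; this is
  encoded in a joint Laplace functional. Differentiating that functional gives
  E (sum_n a(U n) * exp (- k * I)), and uniqueness of Laplace transforms upgrades this to the Mecke
  formula: adding one station of power s to the independent interference I.

  As all thresholds exceed 1, at most one active station covers the origin, so the uncovered event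
  has indicator 1 - C with C the number of covering stations. Given the active stations, no idle
  station covers with probability exp (- A * I powr (- d)). The Bonferroni inequalities are the
  alternating Taylor bounds of this exponential, integrated against 1 - C. The moments of the stable
  variable I follow from its Laplace transform exp (- eta * k powr d), and the Mecke formula reduces
  the terms with C to an incomplete beta integral, which is the hypergeometric factor.
*)

theory Submission
  imports Defs "HOL-Real_Asymp.Real_Asymp"
begin

text \<open>The Laplace functional takes test functions with values in \<open>[0, \<top>]\<close>.
  The value \<open>\<top>\<close> lets the same identity express void events: an infinite penalty
  above a level turns the exponential into the indicator that no idle power exceeds that level. The
  intensity \<open>rho d\<close> has infinite mass at 0. Hence measures are identified on
  \<open>{t<..}\<close> first, and \<open>t\<close> tends to 0 afterwards. The event compares
  M(Psi_i) with the total minus the overall maximum, not with the total minus the station's own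
  power. With thresholds above 1, either condition can hold only for the overall maximum itself, so
  the two readings agree almost surely. The constants arise as follows. Powers above u come from a
  disc of area pi * (P * h / u) powr d, and Gamma (1 + d) is the mean of h powr d; this is all that
  remains of the fading. The Laplace exponent of \<open>rho d\<close> contributes Gamma (1 - d), and
  pi * Gamma (1 + d) * Gamma (1 - d) is C(alpha) by the reflection formula. The term n = 0 of the
  Taylor sum is one minus the main term of the statement, so the sums there start at n = 1.\<close>

section \<open>Exponentials of extended sums and the power-law measure\<close>

text \<open>The value 0 at \<open>\<top>\<close> keeps the function multiplicative and continuous on
  all of \<open>ennreal\<close>, so indicators are covered by the exponents 0 and
  \<open>\<top>\<close>.\<close>

definition nexp :: "ennreal \<Rightarrow> real" where
  "nexp x = (if x = \<top> then 0 else exp (- enn2real x))"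

lemma nexp_ennreal: "0 \<le> r \<Longrightarrow> nexp (ennreal r) = exp (- r)"
  by (simp add: nexp_def)

lemma nexp_top [simp]: "nexp \<top> = 0"
  by (simp add: nexp_def)

lemma nexp_0 [simp]: "nexp 0 = 1"
  by (simp add: nexp_def)

lemma nexp_nonneg [simp]: "0 \<le> nexp x"
  by (simp add: nexp_def)

lemma nexp_le_1 [simp]: "nexp x \<le> 1"
  by (simp add: nexp_def)

lemma nexp_add: "nexp (x + y) = nexp x * nexp y"
  by (cases x; cases y)
     (auto simp: nexp_ennreal exp_diff exp_minus field_simps simp flip: ennreal_plus)

lemma nexp_sum: "finite A \<Longrightarrow> nexp (\<Sum>i\<in>A. f i) = (\<Prod>i\<in>A. nexp (f i))"
  by (induction A rule: finite_induct) (auto simp: nexp_add)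

lemma nexp_antimono: "x \<le> y \<Longrightarrow> nexp y \<le> nexp x"
  by (cases x; cases y) (auto simp: nexp_ennreal top_unique)

lemma measurable_nexp [measurable]: "nexp \<in> borel_measurable borel"
  unfolding nexp_def by measurable

lemma tendsto_nexp:
  assumes "(f \<longlongrightarrow> x) F"
  shows "((\<lambda>i. nexp (f i)) \<longlongrightarrow> nexp x) F"
proof (cases "x = \<top>")
  case True
  have "((\<lambda>i. nexp (f i)) \<longlongrightarrow> 0) F"
  proof (rule order_tendstoI)
    fix a :: real assume "a < 0"
    then show "\<forall>\<^sub>F i in F. a < nexp (f i)"
      by (auto intro!: always_eventually less_le_trans[of a 0])
  next
    fix a :: real assume a: "0 < a"
    \<comment> \<open>Any \<open>r\<close> with \<open>exp (- r) < a\<close> serves; the maximum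
      with 0 keeps it nonnegative, as \<open>nexp_ennreal\<close> requires.\<close>
    define r where "r = max 0 (1 - ln a)"
    have r: "exp (- r) < a"
    proof -
      have "exp (- r) \<le> exp (ln a - 1)" by (simp add: r_def)
      also have "\<dots> < exp (ln a)" by simp
      finally show ?thesis using a by simp
    qed
    have "\<forall>\<^sub>F i in F. ennreal r < f i"
      using order_tendstoD(1)[OF assms, of "ennreal r"] True by simp
    then show "\<forall>\<^sub>F i in F. nexp (f i) < a"
    proof eventually_elim
      case (elim i)
      then have "nexp (f i) \<le> nexp (ennreal r)" by (intro nexp_antimono) auto
      also have "\<dots> = exp (- r)" by (intro nexp_ennreal) (simp add: r_def)
      finally show ?case using r by simp
    qed
  qed
  then show ?thesis using True by simp
next
  case False
  then obtain r where r: "x = ennreal r" "0 \<le> r" by (cases x) auto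
  have "\<forall>\<^sub>F i in F. f i < \<top>"
    using order_tendstoD(2)[OF assms, of \<top>] False by (simp add: top.not_eq_extremum)
  then have ev: "\<forall>\<^sub>F i in F. nexp (f i) = exp (- enn2real (f i))"
    by eventually_elim (auto simp: nexp_def)
  have "((\<lambda>i. exp (- enn2real (f i))) \<longlongrightarrow> exp (- r)) F"
    using tendsto_enn2real[of f r F] assms r by (intro tendsto_intros) auto
  then show ?thesis
    using ev r by (simp add: nexp_ennreal tendsto_cong)
qed

text \<open>With \<open>q\<close> the exponential at the half step, the one at the full step is
  \<open>q * q\<close>, and the inequality says that the square of \<open>1 - q\<close> is
  nonnegative. Halving is enough because only dyadic steps are used.\<close>

lemma nexp_slope_mono:
  assumes "0 < e"
  shows "(1 - nexp (ennreal e * z)) / e \<le> (1 - nexp (ennreal (e / 2) * z)) / (e / 2)"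
proof -
  let ?q = "nexp (ennreal (e / 2) * z)"
  have "ennreal e * z = ennreal (e / 2) * z + ennreal (e / 2) * z"
    using assms by (simp flip: distrib_right ennreal_plus)
  then have "nexp (ennreal e * z) = ?q * ?q" by (simp only: nexp_add)
  moreover have "0 \<le> (1 - ?q) * (1 - ?q)" by simp
  ultimately have "1 - nexp (ennreal e * z) \<le> 2 * (1 - ?q)"
    by (simp add: algebra_simps)
  then show ?thesis using assms by (simp add: divide_right_mono)
qed

text \<open>
  The slopes increase to \<open>z\<close>, so that Laplace functionals can be differentiated by monotone
  convergence.
\<close>

definition slope :: "nat \<Rightarrow> ennreal \<Rightarrow> ennreal" where
  "slope j z = ennreal (2 ^ j * (1 - nexp (ennreal (1 / 2 ^ j) * z)))"

lemma incseq_slope: "incseq (\<lambda>j. slope j z)"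
proof (rule incseq_SucI)
  fix j
  show "slope j z \<le> slope (Suc j) z"
    using nexp_slope_mono[of "1 / 2 ^ j" z]
    by (simp add: slope_def ennreal_leI mult.commute)
qed

lemma slope_le: "slope j z \<le> z"
proof (cases z)
  case (real r)
  have "1 - exp (- (r / 2 ^ j)) \<le> r / 2 ^ j"
    using exp_ge_add_one_self[of "- (r / 2 ^ j)"] by simp
  then have "2 ^ j * (1 - exp (- (r / 2 ^ j))) \<le> r"
    by (simp add: field_simps)
  moreover have "ennreal (1 / 2 ^ j) * ennreal r = ennreal (r / 2 ^ j)"
    using real by (simp flip: ennreal_mult)
  ultimately show ?thesis using real
    by (simp add: slope_def nexp_ennreal ennreal_leI)
qed simp

lemma slope_mono: "x \<le> y \<Longrightarrow> slope j x \<le> slope j y"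
  unfolding slope_def
  by (intro ennreal_leI mult_left_mono diff_left_mono nexp_antimono) auto

lemma slope_LIMSEQ: "(\<lambda>j. slope j z) \<longlonglongrightarrow> z"
proof (cases z)
  case (real r)
  have "ennreal (1 / 2 ^ j) * ennreal r = ennreal (r / 2 ^ j)" for j
    using real by (simp flip: ennreal_mult)
  then have eq: "slope j z = ennreal (2 ^ j * (1 - exp (- (r / 2 ^ j))))" for j
    using real by (simp add: slope_def nexp_ennreal)
  have "(\<lambda>j::nat. 2 ^ j * (1 - exp (- (r / 2 ^ j)))) \<longlonglongrightarrow> r"
    by (cases "r = 0") real_asymp+
  then show ?thesis unfolding eq using real by (simp add: tendsto_ennrealI)
next
  case top
  have "(\<lambda>j. ennreal (2 ^ j)) \<longlonglongrightarrow> \<top>"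
    unfolding ennreal_tendsto_top_eq_at_top by real_asymp
  moreover have "ennreal (1 / 2 ^ j) * \<top> = \<top>" for j :: nat
    by (simp add: ennreal_mult_top)
  ultimately show ?thesis using top by (simp add: slope_def)
qed

lemma slope_SUP: "(SUP j. slope j z) = z"
  using LIMSEQ_SUP[OF incseq_slope, of z] slope_LIMSEQ[of z] LIMSEQ_unique by blast

lemma measurable_slope [measurable]: "slope j \<in> borel_measurable borel"
  unfolding slope_def by measurable

section \<open>Power-law measure and integrals against it\<close>

text \<open>At the lower end only a one-sided limit of \<open>F\<close> is required, so
  \<open>f\<close> may be singular at \<open>a\<close>. This matters for \<open>a = 0\<close> and
  powers with a negative exponent.\<close>

lemma nn_integral_FTC_Ioi:
  fixes f F :: "real \<Rightarrow> real"
  assumes F: "\<And>x. a < x \<Longrightarrow> (F has_real_derivative f x) (at x)"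
    and f: "\<And>x. a < x \<Longrightarrow> isCont f x"
    and nonneg: "\<And>x. a < x \<Longrightarrow> 0 \<le> f x"
    and B: "(F \<longlongrightarrow> B) (at_right a)" and T: "(F \<longlongrightarrow> T) at_top"
  shows "(\<integral>\<^sup>+x. ennreal (f x) * indicator {a<..} x \<partial>lborel) = ennreal (T - B)"
proof -
  have B': "((F \<circ> real_of_ereal) \<longlongrightarrow> B) (at_right (ereal a))"
    using B by (simp add: ereal_tendsto_simps1)
  have T': "((F \<circ> real_of_ereal) \<longlongrightarrow> T) (at_left \<infinity>)"
    using T by (simp add: ereal_tendsto_simps1)
  have nn: "AE x in lborel. ereal a < ereal x \<longrightarrow> ereal x < \<infinity> \<longrightarrow> 0 \<le> f x"
    using nonneg by auto
  have e: "einterval (ereal a) \<infinity> = {a<..}" by (auto simp: einterval_def)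
  note ftc = interval_integral_FTC_nonneg[of "ereal a" \<infinity> F f B T, OF _ _ _ nn B' T']
  have int: "set_integrable lborel {a<..} f"
    using ftc(1) F f e by auto
  have val: "(LBINT x:{a<..}. f x) = T - B"
    using ftc(2) F f e by (auto simp: interval_lebesgue_integral_def)
  have "(\<integral>\<^sup>+x. ennreal (f x) * indicator {a<..} x \<partial>lborel)
      = (\<integral>\<^sup>+x. ennreal (indicator {a<..} x *\<^sub>R f x) \<partial>lborel)"
    by (intro nn_integral_cong) (auto simp: indicator_def)
  also have "\<dots> = ennreal (\<integral>x. indicator {a<..} x *\<^sub>R f x \<partial>lborel)"
    using int nonneg unfolding set_integrable_def
    by (intro nn_integral_eq_integral) (auto intro!: AE_I2 simp: indicator_def)
  finally show ?thesis using val by (simp add: set_lebesgue_integral_def)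
qed

text \<open>Normalised so that the tail beyond \<open>t\<close> is \<open>t powr (- d)\<close>. The
  mass near 0 is infinite: infinitely many weak stations lie far away.\<close>

definition rho :: "real \<Rightarrow> real measure" where
  "rho d = density lborel (\<lambda>s. ennreal (d * s powr (- d - 1)) * indicator {0<..} s)"

lemma sets_rho [simp, measurable_cong]: "sets (rho d) = sets borel"
  by (simp add: rho_def)

lemma space_rho [simp]: "space (rho d) = UNIV"
  by (simp add: rho_def)

lemma nn_integral_rho:
  "f \<in> borel_measurable borel \<Longrightarrow>
    (\<integral>\<^sup>+s. f s \<partial>rho d) = (\<integral>\<^sup>+s. ennreal (d * s powr (- d - 1)) * indicator {0<..} s * f s \<partial>lborel)"
  unfolding rho_def by (subst nn_integral_density) auto

lemma AE_rho_pos: "AE s in rho d. 0 < s"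
  unfolding rho_def by (subst AE_density) (auto simp: indicator_def)

lemma sigma_finite_rho: "sigma_finite_measure (rho d)"
  unfolding rho_def
  by (subst sigma_finite_measure.sigma_finite_iff_density_finite[OF sigma_finite_lborel])
     (auto simp: indicator_def)

text \<open>Removes the truncation that the infinite mass of \<open>rho d\<close> at 0 imposes; both
  the Mecke formula and the path-loss integral are first shown for powers above a positive
  level.\<close>

lemma nn_integral_trunc_LIMSEQ:
  fixes u :: "'a \<Rightarrow> real"
  assumes [measurable]: "u \<in> borel_measurable M" "f \<in> borel_measurable M"
  shows "(\<lambda>j. \<integral>\<^sup>+x. indicator {1 / real (Suc j)<..} (u x) * f x \<partial>M)
    \<longlonglongrightarrow> (\<integral>\<^sup>+x. indicator {0<..} (u x) * f x \<partial>M)"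
proof (rule nn_integral_LIMSEQ)
  have "1 / real (Suc (Suc j)) \<le> 1 / real (Suc j)" for j by (simp add: frac_le)
  then show "incseq (\<lambda>j x. indicator {1 / real (Suc j)<..} (u x) * f x)"
    by (intro incseq_SucI le_funI) (auto simp: indicator_def intro: le_less_trans)
  show "(\<lambda>j. indicator {1 / real (Suc j)<..} (u x) * f x) \<longlonglongrightarrow> indicator {0<..} (u x) * f x" for x
  proof (cases "0 < u x")
    case True
    have "(\<lambda>j. 1 / real (Suc j)) \<longlonglongrightarrow> 0" by real_asymp
    then have "\<forall>\<^sub>F j in sequentially. 1 / real (Suc j) < u x" using True by (rule order_tendstoD)
    then have "\<forall>\<^sub>F j in sequentially. indicator {1 / real (Suc j)<..} (u x) * f x = indicator {0<..} (u x) * f x"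
      by eventually_elim (use True in simp)
    then show ?thesis by (rule tendsto_eventually)
  next
    case False
    then have "\<not> 1 / real (Suc j) < u x" for j
      using order_trans[of "u x" 0 "1 / real (Suc j)"] by (simp add: not_less)
    then show ?thesis using False by (simp add: indicator_def)
  qed
qed measurable

lemma emeasure_rho_Ioi:
  assumes "0 < d" "0 < t"
  shows "emeasure (rho d) {t<..} = ennreal (t powr (- d))"
proof -
  have "emeasure (rho d) {t<..} = (\<integral>\<^sup>+s. ennreal (d * s powr (- d - 1)) * indicator {t<..} s \<partial>lborel)"
    unfolding rho_def using assms
    by (subst emeasure_density) (auto intro!: nn_integral_cong simp: indicator_def)
  also have "\<dots> = ennreal (0 - (- (t powr (- d))))"
  proof (rule nn_integral_FTC_Ioi)
    fix x assume "t < x"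
    then have x: "0 < x" using assms by simp
    show "((\<lambda>s. - (s powr (- d))) has_real_derivative d * x powr (- d - 1)) (at x)"
      using x by (auto intro!: derivative_eq_intros simp: powr_diff field_simps)
    show "isCont (\<lambda>s. d * s powr (- d - 1)) x"
      using x by (intro continuous_intros) auto
    show "0 \<le> d * x powr (- d - 1)" using assms by simp
  next
    show "((\<lambda>s. - (s powr (- d))) \<longlongrightarrow> - (t powr (- d))) (at_right t)"
      using assms by (intro tendsto_intros) auto
    show "((\<lambda>s. - (s powr (- d))) \<longlongrightarrow> 0) at_top"
      using assms by real_asymp
  qed
  finally show ?thesis by simp
qed

lemma nn_integral_Gamma_scaled:
  assumes "0 < q" "0 < y"
  shows "(\<integral>\<^sup>+u. ennreal (u powr (q - 1) * exp (- (y * u))) * indicator {0<..} u \<partial>lborel)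
       = ennreal (Gamma q * y powr (- q))"
proof -
  have "ennreal (Gamma q) = (\<integral>\<^sup>+t. ennreal (t powr (q - 1) * exp (- t)) * indicator {0<..} t \<partial>lborel)"
    unfolding Gamma_conv_nn_integral_real[OF assms(1)]
    by (intro nn_integral_cong_AE AE_I[where N="{0}"])
       (auto simp: indicator_def exp_minus divide_inverse)
  also have "\<dots> = ennreal y * (\<integral>\<^sup>+u. ennreal ((y * u) powr (q - 1) * exp (- (y * u)))
       * indicator {0<..} (y * u) \<partial>lborel)"
    using assms by (subst nn_integral_real_affine[where c=y and t=0]) auto
  also have "\<dots> = ennreal y * (\<integral>\<^sup>+u. ennreal (y powr (q - 1)) *
       (ennreal (u powr (q - 1) * exp (- (y * u))) * indicator {0<..} u) \<partial>lborel)"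
    using assms
    by (intro arg_cong[where f="(*) (ennreal y)"] nn_integral_cong)
       (auto simp: indicator_def powr_mult zero_less_mult_iff mult.assoc simp flip: ennreal_mult')
  also have "\<dots> = ennreal (y powr q) *
       (\<integral>\<^sup>+u. ennreal (u powr (q - 1) * exp (- (y * u))) * indicator {0<..} u \<partial>lborel)"
    using assms by (subst nn_integral_cmult)
      (auto simp: powr_diff simp flip: mult.assoc ennreal_mult')
  finally have eq: "ennreal (Gamma q) = ennreal (y powr q) *
       (\<integral>\<^sup>+u. ennreal (u powr (q - 1) * exp (- (y * u))) * indicator {0<..} u \<partial>lborel)"
    (is "_ = _ * ?I") .
  have "?I = ennreal (y powr (- q)) * (ennreal (y powr q) * ?I)"
    using assms by (simp flip: mult.assoc ennreal_mult' powr_add)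
  also have "\<dots> = ennreal (y powr (- q)) * ennreal (Gamma q)" by (simp add: eq)
  also have "\<dots> = ennreal (Gamma q * y powr (- q))"
    using assms by (simp add: mult.commute flip: ennreal_mult')
  finally show ?thesis .
qed

text \<open>\<open>1 - exp (- (\<theta> * s))\<close> is the integral of
  \<open>\<theta> * exp (- (\<theta> * u))\<close> over \<open>u\<close> from 0 to \<open>s\<close>.
  After Fubini the inner integral is the tail \<open>u powr (- d)\<close>, and a Gamma integral of
  parameter \<open>1 - d\<close> remains, which converges because \<open>d < 1\<close>.\<close>

lemma nn_integral_rho_Laplace:
  assumes d: "0 < d" "d < 1" and \<theta>: "0 \<le> \<theta>"
  shows "(\<integral>\<^sup>+s. ennreal (1 - exp (- (\<theta> * s))) \<partial>rho d) = ennreal (Gamma (1 - d) * \<theta> powr d)"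
proof (cases "\<theta> = 0")
  case True
  then show ?thesis using d by simp
next
  case False
  with \<theta> have \<theta>: "0 < \<theta>" by simp
  interpret rho: sigma_finite_measure "rho d" by (rule sigma_finite_rho)
  interpret pair_sigma_finite "rho d" lborel ..
  have inner: "ennreal (1 - exp (- (\<theta> * s)))
      = (\<integral>\<^sup>+u. ennreal (\<theta> * exp (- (\<theta> * u))) * indicator {0..s} u \<partial>lborel)" if "0 < s" for s
  proof -
    have "(\<integral>\<^sup>+u. ennreal (\<theta> * exp (- (\<theta> * u))) * indicator {0..s} u \<partial>lborel)
        = ennreal (- exp (- (\<theta> * s)) - (- exp (- (\<theta> * 0))))"
      using that \<theta> by (intro nn_integral_FTC_Icc) (auto intro!: derivative_eq_intros)
    then show ?thesis by simp
  qed
  have "(\<integral>\<^sup>+s. ennreal (1 - exp (- (\<theta> * s))) \<partial>rho d)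
      = (\<integral>\<^sup>+s. \<integral>\<^sup>+u. ennreal (\<theta> * exp (- (\<theta> * u))) * indicator {0..s} u \<partial>lborel \<partial>rho d)"
    using AE_rho_pos[of d] by (intro nn_integral_cong_AE) (auto simp: inner elim!: eventually_mono)
  also have "\<dots> = (\<integral>\<^sup>+u. \<integral>\<^sup>+s. ennreal (\<theta> * exp (- (\<theta> * u))) * indicator {0..s} u \<partial>rho d \<partial>lborel)"
    by (rule Fubini'[symmetric]) (auto simp: indicator_def)
  also have "\<dots> = (\<integral>\<^sup>+u. ennreal (\<theta> * (u powr ((1 - d) - 1) * exp (- (\<theta> * u)))) * indicator {0<..} u \<partial>lborel)"
  proof (rule nn_integral_cong_AE, rule AE_mp[OF AE_lborel_singleton[of 0] AE_I2], rule impI)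
    fix u :: real assume "u \<noteq> 0"
    show "(\<integral>\<^sup>+s. ennreal (\<theta> * exp (- (\<theta> * u))) * indicator {0..s} u \<partial>rho d)
      = ennreal (\<theta> * (u powr ((1 - d) - 1) * exp (- (\<theta> * u)))) * indicator {0<..} u"
    proof (cases "u > 0")
      case True
      have "(\<integral>\<^sup>+s. ennreal (\<theta> * exp (- (\<theta> * u))) * indicator {0..s} u \<partial>rho d)
          = (\<integral>\<^sup>+s. ennreal (\<theta> * exp (- (\<theta> * u))) * indicator {u<..} s \<partial>rho d)"
      proof (rule nn_integral_cong_AE)
        have "AE s in lborel. s \<noteq> u" by (rule AE_lborel_singleton)
        then have "AE s in rho d. s \<noteq> u" unfolding rho_def by (subst AE_density) auto
        then show "AE s in rho d. ennreal (\<theta> * exp (- (\<theta> * u))) * indicator {0..s} u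
           = ennreal (\<theta> * exp (- (\<theta> * u))) * indicator {u<..} s"
          by (rule eventually_mono) (use True in \<open>auto simp: indicator_def\<close>)
      qed
      also have "\<dots> = ennreal (\<theta> * exp (- (\<theta> * u))) * ennreal (u powr (- d))"
        using True d by (subst nn_integral_cmult) (auto simp: emeasure_rho_Ioi)
      finally show ?thesis using True \<theta> by (simp add: mult_ac flip: ennreal_mult')
    qed (use \<open>u \<noteq> 0\<close> in \<open>simp add: indicator_def\<close>)
  qed
  also have "\<dots> = ennreal \<theta> * ennreal (Gamma (1 - d) * \<theta> powr (- (1 - d)))"
    using \<theta> d by (subst nn_integral_Gamma_scaled[symmetric], simp, simp,
      subst nn_integral_cmult[symmetric], simp, intro nn_integral_cong)
      (auto simp: indicator_def ennreal_mult' split: if_splits)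
  also have "\<dots> = ennreal (Gamma (1 - d) * \<theta> powr d)"
    using \<theta> d by (simp add: powr_minus powr_diff field_simps flip: ennreal_mult')
  finally show ?thesis .
qed

text \<open>In the variable \<open>v = \<eta> * s powr d\<close> this is the Gamma integral of
  \<open>v ^ n * exp (- v)\<close> up to the factor \<open>1 / (d * \<eta> ^ Suc n)\<close>. An
  explicit antiderivative replaces the change of variables: \<open>exp (- v) * G v\<close> is the
  probability that a Poisson variable of mean \<open>v\<close> is at most \<open>n\<close>, and its
  derivative is minus the last weight.\<close>

lemma nn_integral_stretched_exp:
  assumes d: "0 < d" and \<eta>: "0 < \<eta>"
  shows "(\<integral>\<^sup>+s. ennreal (s powr (real (Suc n) * d - 1) * exp (- (\<eta> * s powr d))) * indicator {0<..} s \<partial>lborel)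
       = ennreal (fact n / (d * \<eta> ^ Suc n))"
proof -
  define c where "c = fact n / (d * \<eta> ^ Suc n)"
  define G where "G v = (\<Sum>k\<le>n. v ^ k / fact k)" for v :: real
  have G': "((\<lambda>v. - (exp (- v) * G v)) has_real_derivative exp (- v) * v ^ n / fact n) (at v)" for v
  proof -
    have "(G has_real_derivative (\<Sum>k\<le>n. real k * v ^ (k - 1) / fact k)) (at v)"
      unfolding G_def by (auto intro!: derivative_eq_intros)
    moreover have "(\<Sum>k\<le>n. real k * v ^ (k - 1) / fact k) = G v - v ^ n / fact n"
    proof (cases n)
      case 0 then show ?thesis by (simp add: G_def)
    next
      case (Suc m)
      have "(\<Sum>k\<le>Suc m. real k * v ^ (k - 1) / fact k) = (\<Sum>k\<le>m. real (Suc k) * v ^ k / fact (Suc k))"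
        by (subst sum.atMost_Suc_shift) simp
      also have "\<dots> = (\<Sum>k\<le>m. v ^ k / fact k)"
        by (intro sum.cong refl) (simp add: divide_simps)
      finally show ?thesis using Suc by (simp add: G_def)
    qed
    ultimately have D: "(G has_real_derivative (G v - v ^ n / fact n)) (at v)" by simp
    show ?thesis
      by (rule derivative_eq_intros D refl | simp add: algebra_simps)+
  qed
  have "(\<integral>\<^sup>+s. ennreal (s powr (real (Suc n) * d - 1) * exp (- (\<eta> * s powr d))) * indicator {0<..} s \<partial>lborel)
      = ennreal (0 - c * (- (exp (- (\<eta> * 0)) * G (\<eta> * 0))))"
  proof (rule nn_integral_FTC_Ioi)
    fix x :: real assume x: "0 < x"
    have "((\<lambda>s. \<eta> * s powr d) has_real_derivative \<eta> * (d * x powr (d - 1))) (at x)"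
      using x by (auto intro!: derivative_eq_intros)
    from DERIV_chain2[OF G' this]
    have "((\<lambda>s. c * (- (exp (- (\<eta> * s powr d)) * G (\<eta> * s powr d)))) has_real_derivative
       c * (exp (- (\<eta> * x powr d)) * (\<eta> * x powr d) ^ n / fact n * (\<eta> * (d * x powr (d - 1))))) (at x)"
      by (rule DERIV_cmult)
    moreover have "c * (exp (- (\<eta> * x powr d)) * (\<eta> * x powr d) ^ n / fact n * (\<eta> * (d * x powr (d - 1))))
        = exp (- (\<eta> * x powr d)) * ((x powr d) ^ n * x powr (d - 1))"
      using d \<eta> by (simp add: c_def power_mult_distrib field_simps)
    moreover have "(x powr d) ^ n * x powr (d - 1) = x powr (real (Suc n) * d - 1)"
      using x by (simp add: powr_power algebra_simps flip: powr_add)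
    ultimately show "((\<lambda>s. c * (- (exp (- (\<eta> * s powr d)) * G (\<eta> * s powr d)))) has_real_derivative
      x powr (real (Suc n) * d - 1) * exp (- (\<eta> * x powr d))) (at x)"
      by (simp add: mult.commute)
    show "isCont (\<lambda>s. s powr (real (Suc n) * d - 1) * exp (- (\<eta> * s powr d))) x"
      using x by (intro continuous_intros) auto
  next
    have "((\<lambda>s. s powr d) \<longlongrightarrow> 0) (at_right 0)" using d by real_asymp
    then show "((\<lambda>s. c * (- (exp (- (\<eta> * s powr d)) * G (\<eta> * s powr d))))
      \<longlongrightarrow> c * (- (exp (- (\<eta> * 0)) * G (\<eta> * 0)))) (at_right 0)"
      unfolding G_def by (intro tendsto_intros) auto
    have "((\<lambda>v::real. exp (- v) * v ^ k / fact k) \<longlongrightarrow> 0) at_top" for k :: nat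
    proof -
      have "((\<lambda>v::real. exp (- v) * v ^ k) \<longlongrightarrow> 0) at_top" by real_asymp
      then show ?thesis by (rule tendsto_divide_zero)
    qed
    then have "((\<lambda>v::real. \<Sum>k\<le>n. exp (- v) * v ^ k / fact k) \<longlongrightarrow> 0) at_top"
      by (intro tendsto_null_sum)
    then have "((\<lambda>v. exp (- v) * G v) \<longlongrightarrow> 0) at_top"
      by (simp add: G_def sum_distrib_left)
    then have "((\<lambda>v. c * (- (exp (- v) * G v))) \<longlongrightarrow> c * (- 0)) at_top"
      by (intro tendsto_intros)
    moreover have "filterlim (\<lambda>s. \<eta> * s powr d) at_top at_top" using d \<eta> by real_asymp
    ultimately show "((\<lambda>s. c * (- (exp (- (\<eta> * s powr d)) * G (\<eta> * s powr d)))) \<longlongrightarrow> 0) at_top"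
      by (auto dest: filterlim_compose)
  qed auto
  moreover have "G 0 = 1" by (simp add: G_def sum.atMost_shift)
  ultimately show ?thesis by (simp add: c_def)
qed

section \<open>The hypergeometric integral\<close>

text \<open>The quotient of the rising factorials of \<open>b\<close> and \<open>c\<close>. It is
  the Taylor coefficient of the hypergeometric function with first parameter 1, whose rising
  factorial cancels \<open>fact k\<close>.\<close>

primrec hyp_coeff :: "real \<Rightarrow> real \<Rightarrow> nat \<Rightarrow> real" where
  "hyp_coeff b c 0 = 1"
| "hyp_coeff b c (Suc k) = hyp_coeff b c k * ((b + real k) / (c + real k))"

lemma hyp_coeff_nonneg: "0 < b \<Longrightarrow> 0 < c \<Longrightarrow> 0 \<le> hyp_coeff b c k"
  by (induction k) auto

lemma Beta_real_pos: "0 < a \<Longrightarrow> 0 < b \<Longrightarrow> 0 < Beta a (b::real)"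
  by (simp add: Beta_def Gamma_real_pos)

lemma hyp_coeff_eq_Beta:
  assumes "0 < b" "b < c"
  shows "hyp_coeff b c k = Beta (b + real k) (c - b) / Beta b (c - b)"
proof (induction k)
  case 0
  then show ?case using assms using Beta_real_pos[of b "c - b"] by simp
next
  case (Suc k)
  have "(b + real k + (c - b)) * Beta (b + real k + 1) (c - b) = (b + real k) * Beta (b + real k) (c - b)"
    using assms by (intro Beta_plus1_left) (auto simp: nonpos_Ints_def)
  then have "Beta (b + real (Suc k)) (c - b) = Beta (b + real k) (c - b) * ((b + real k) / (c + real k))"
    using assms by (simp add: field_simps)
  then show ?case using Suc by simp
qed

text \<open>Euler's integral is expanded by the geometric series of \<open>1 / (1 - t * z)\<close>.
  All terms are nonnegative, so monotone convergence permits integration term by term, and each term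
  is a Beta integral. The Beta values are at most the first one, so the series is dominated by a
  geometric series.\<close>

lemma hyp2F1_1_sums:
  assumes bc: "0 < b" "b < c" and z: "0 \<le> z" "z < 1"
  shows "(\<lambda>k. hyp_coeff b c k * z ^ k) sums hyp2F1 1 b c z"
proof -
  define w where "w t = t powr (b - 1) * (1 - t) powr (c - b - 1)" for t :: real
  define S where "S m t = (\<Sum>k<m. w t * (t * z) ^ k)" for m t
  define B where "B k = Beta (b + real k) (c - b)" for k
  have B0: "0 < B 0" using bc by (simp add: B_def Beta_real_pos)
  have term_int: "((\<lambda>t. w t * (t * z) ^ k) has_integral B k * z ^ k) {0..1}" for k
  proof -
    have "((\<lambda>t. t powr (b + real k - 1) * (1 - t) powr (c - b - 1)) has_integral B k) {0..1}"
      unfolding B_def using bc by (intro has_integral_Beta_real) auto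
    then have "((\<lambda>t. t powr (b + real k - 1) * (1 - t) powr (c - b - 1) * z ^ k) has_integral B k * z ^ k) {0..1}"
      by (rule has_integral_mult_left)
    moreover have "t powr (b + real k - 1) * (1 - t) powr (c - b - 1) * z ^ k = w t * (t * z) ^ k"
      if "t \<in> {0..1}" for t
    proof (cases "t = 0")
      case False
      then have "t powr (b + real k - 1) = t powr (b - 1) * t ^ k"
        using that by (simp add: powr_realpow[symmetric] algebra_simps flip: powr_add)
      then show ?thesis by (simp add: w_def power_mult_distrib)
    qed (simp add: w_def)
    ultimately show ?thesis by (rule has_integral_eq[rotated]) auto
  qed
  have S_int: "(S m has_integral (\<Sum>k<m. B k * z ^ k)) {0..1}" for m
    unfolding S_def by (intro has_integral_sum term_int) auto
  have B_le: "B k \<le> B 0" for k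
  proof (rule has_integral_le)
    show "((\<lambda>t. t powr (b + real k - 1) * (1 - t) powr (c - b - 1)) has_integral B k) {0..1}"
      unfolding B_def using bc by (intro has_integral_Beta_real) auto
    show "((\<lambda>t. t powr (b + real 0 - 1) * (1 - t) powr (c - b - 1)) has_integral B 0) {0..1}"
      unfolding B_def using bc by (intro has_integral_Beta_real) auto
    show "t powr (b + real k - 1) * (1 - t) powr (c - b - 1) \<le> t powr (b + real 0 - 1) * (1 - t) powr (c - b - 1)"
      if "t \<in> {0..1}" for t
      using that by (intro mult_right_mono powr_mono') auto
  qed
  have B_nonneg: "0 \<le> B k" for k
    unfolding B_def using bc by (intro less_imp_le Beta_real_pos) auto
  have summ: "summable (\<lambda>k. B k * z ^ k)"
  proof (rule summable_comparison_test')
    show "summable (\<lambda>k. B 0 * z ^ k)" using z by (intro summable_mult summable_geometric) auto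
    show "norm (B k * z ^ k) \<le> B 0 * z ^ k" if "0 \<le> k" for k
      using z B_le B_nonneg by (simp add: mult_right_mono abs_mult)
  qed
  then have lim: "(\<lambda>m. \<Sum>k<m. B k * z ^ k) \<longlonglongrightarrow> (\<Sum>k. B k * z ^ k)"
    by (rule summable_LIMSEQ)
  have "((\<lambda>t. w t / (1 - t * z)) has_integral (\<Sum>k. B k * z ^ k)) {0..1}"
  proof (rule has_integral_monotone_convergence_increasing)
    show "(S m has_integral (\<Sum>k<m. B k * z ^ k)) {0..1}" for m by (rule S_int)
    show "S m t \<le> S (Suc m) t" if "t \<in> {0..1}" for m t
      using that z by (simp add: S_def w_def)
    show "(\<lambda>m. S m t) \<longlonglongrightarrow> w t / (1 - t * z)" if "t \<in> {0..1}" for t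
    proof -
      have "t * z \<le> 1 * z" using that z by (intro mult_right_mono) auto
      then have "(\<lambda>k. (t * z) ^ k) sums (1 / (1 - t * z))"
        using that z by (intro geometric_sums) auto
      from sums_mult[OF this, of "w t"] show ?thesis by (simp add: sums_def S_def)
    qed
    show "(\<lambda>m. \<Sum>k<m. B k * z ^ k) \<longlonglongrightarrow> (\<Sum>k. B k * z ^ k)" by (rule lim)
  qed
  moreover have "w t / (1 - t * z) = t powr (b - 1) * (1 - t) powr (c - b - 1) / (1 - t * z) powr 1"
    if "t \<in> {0..1}" for t
  proof -
    have "t * z \<le> 1 * z" using that z by (intro mult_right_mono) auto
    then show ?thesis using z by (simp add: w_def)
  qed
  ultimately have "integral {0..1} (\<lambda>t. t powr (b - 1) * (1 - t) powr (c - b - 1) / (1 - t * z) powr 1)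
      = (\<Sum>k. B k * z ^ k)"
    by (subst integral_cong[where g="\<lambda>t. w t / (1 - t * z)"]) (auto intro: integral_unique)
  moreover have "Gamma c / (Gamma b * Gamma (c - b)) = 1 / B 0"
    by (simp add: B_def Beta_def)
  ultimately have val: "hyp2F1 1 b c z = (\<Sum>k. B k * z ^ k) / B 0"
    by (simp add: hyp2F1_def)
  have "(\<lambda>k. B k * z ^ k / B 0) sums ((\<Sum>k. B k * z ^ k) / B 0)"
    by (intro sums_divide summable_sums summ)
  moreover have "B k * z ^ k / B 0 = hyp_coeff b c k * z ^ k" for k
    using bc by (simp add: hyp_coeff_eq_Beta B_def)
  ultimately show ?thesis using val by simp
qed

text \<open>These products are the coefficients of the boundary term left by the telescoping below.
  They start at \<open>b\<close>, and successive quotients are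
  \<open>(b + k + 1) / (1 + a + k)\<close>, at most 1 since \<open>b < a\<close>.\<close>

lemma hyp_coeff_bound:
  assumes "0 < b" "b < a"
  shows "hyp_coeff b (1 + a) k * (b + real k) \<le> b"
    and "hyp_coeff b (1 + a) (Suc k) * (b + real (Suc k)) \<le> hyp_coeff b (1 + a) k * (b + real k)"
proof -
  show dec: "hyp_coeff b (1 + a) (Suc k) * (b + real (Suc k)) \<le> hyp_coeff b (1 + a) k * (b + real k)" for k
  proof -
    have "(b + real (Suc k)) / (1 + a + real k) \<le> 1" using assms by simp
    then have "hyp_coeff b (1 + a) k * (b + real k) * ((b + real (Suc k)) / (1 + a + real k))
        \<le> hyp_coeff b (1 + a) k * (b + real k) * 1"
      using assms hyp_coeff_nonneg[of b "1 + a" k] by (intro mult_left_mono) auto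
    then show ?thesis by (simp add: mult_ac)
  qed
  show "hyp_coeff b (1 + a) k * (b + real k) \<le> b"
    using dec by (induction k) (auto intro: order_trans)
qed

text \<open>
  With \<open>w = 1 / (1 + s)\<close>, the derivative of \<open>- s powr - d * (1 + s) powr - b * (\<Sum>k\<le>m. c\<^sub>k * w ^ k)\<close>
  telescopes because of the recurrence of the coefficients, leaving only a boundary term.
\<close>

lemma nn_integral_rho_tail_aux:
  assumes d: "0 < d" and b: "0 < b" and \<beta>: "0 < \<beta>"
  shows "(\<integral>\<^sup>+s. ennreal (s powr (- d - 1) * (1 + s) powr (- b) *
           (b + d - hyp_coeff b (1 + (b + d)) m * (b + real m) * (1 / (1 + s)) ^ Suc m)) * indicator {\<beta><..} s \<partial>lborel)
       = ennreal (\<beta> powr (- d) * (1 + \<beta>) powr (- b) * (\<Sum>k\<le>m. hyp_coeff b (1 + (b + d)) k * (1 / (1 + \<beta>)) ^ k))"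
proof -
  define c where "c = hyp_coeff b (1 + (b + d))"
  define T where "T s = (\<Sum>k\<le>m. c k * (1 / (1 + s)) ^ k)" for s :: real
  \<comment> \<open>The share of the \<open>k\<close>-th summand in the derivative, with the factor
    \<open>s powr (- d - 1) * (1 + s) powr (- b)\<close> taken out and \<open>s / (1 + s)\<close>
    rewritten as \<open>1 - 1 / (1 + s)\<close>.\<close>
  define D where "D k s = c k * (1 / (1 + s)) ^ k * ((b + d + real k) - (b + real k) * (1 / (1 + s)))" for k s
  have tele: "(\<Sum>k\<le>m. D k s) = b + d - c m * (b + real m) * (1 / (1 + s)) ^ Suc m" for s
  proof (induction m)
    case 0 then show ?case by (simp add: D_def c_def)
  next
    case (Suc m)
    \<comment> \<open>The third parameter \<open>1 + (b + d)\<close> is exactly what makes the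
      leading part of the new summand cancel the old boundary term.\<close>
    have "c (Suc m) * (b + d + real (Suc m)) = c m * (b + real m)"
      using b d by (simp add: c_def field_simps)
    then have "D (Suc m) s = c m * (b + real m) * (1 / (1 + s)) ^ Suc m
        - c (Suc m) * (b + real (Suc m)) * (1 / (1 + s)) ^ Suc (Suc m)"
      by (simp add: D_def right_diff_distrib mult.commute mult.left_commute)
    with Suc show ?case by simp
  qed
  have "(\<integral>\<^sup>+s. ennreal (s powr (- d - 1) * (1 + s) powr (- b) *
           (b + d - c m * (b + real m) * (1 / (1 + s)) ^ Suc m)) * indicator {\<beta><..} s \<partial>lborel)
      = ennreal (0 - (- (\<beta> powr (- d) * (1 + \<beta>) powr (- b) * T \<beta>)))"
  proof (rule nn_integral_FTC_Ioi)
    fix x assume "\<beta> < x"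
    then have x: "0 < x" using \<beta> by simp
    have T': "(T has_real_derivative (\<Sum>k\<le>m. - (c k * real k * (1 / (1 + x)) ^ Suc k))) (at x)"
      unfolding T_def
    proof (intro DERIV_sum)
      fix k
      have "((\<lambda>s. c k * (1 / (1 + s)) ^ k) has_real_derivative
        c k * (real k * (1 / (1 + x)) ^ (k - 1) * (- (1 / (1 + x) ^ 2)))) (at x)"
        using x by (auto intro!: derivative_eq_intros simp: power2_eq_square)
      moreover have "c k * (real k * (1 / (1 + x)) ^ (k - 1) * (- (1 / (1 + x) ^ 2)))
          = - (c k * real k * (1 / (1 + x)) ^ Suc k)"
        by (cases k) (auto simp: power2_eq_square power_one_over divide_simps)
      ultimately show "((\<lambda>s. c k * (1 / (1 + s)) ^ k) has_real_derivative
        - (c k * real k * (1 / (1 + x)) ^ Suc k)) (at x)"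
        by (rule DERIV_cong)
    qed
    define u where "u = x powr (- d - 1) * (1 + x) powr (- b)"
    have p1: "((\<lambda>s. s powr (- d)) has_real_derivative - d * x powr (- d - 1)) (at x)"
      using x by (auto intro!: derivative_eq_intros simp: powr_diff)
    have p2: "((\<lambda>s. (1 + s) powr (- b)) has_real_derivative - b * (1 + x) powr (- b) * (1 / (1 + x))) (at x)"
      using x by (auto intro!: derivative_eq_intros simp: powr_diff)
    have p: "((\<lambda>s. - (s powr (- d) * (1 + s) powr (- b) * T s)) has_real_derivative
       - ((- d * x powr (- d - 1) * (1 + x) powr (- b) + - b * (1 + x) powr (- b) * (1 / (1 + x)) * x powr (- d)) * T x
          + (\<Sum>k\<le>m. - (c k * real k * (1 / (1 + x)) ^ Suc k)) * (x powr (- d) * (1 + x) powr (- b)))) (at x)"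
      by (rule DERIV_minus DERIV_mult p1 p2 T')+
    have xd: "x powr (- d) = x * x powr (- d - 1)"
      using x by (simp add: powr_diff)
    have xw: "x * (1 / (1 + x)) = 1 - 1 / (1 + x)"
      using x by (simp add: field_simps)
    have eq: "- ((- d * x powr (- d - 1) * (1 + x) powr (- b) + - b * (1 + x) powr (- b) * (1 / (1 + x)) * x powr (- d)) * T x
          + (\<Sum>k\<le>m. - (c k * real k * (1 / (1 + x)) ^ Suc k)) * (x powr (- d) * (1 + x) powr (- b)))
        = u * ((d + b * (x * (1 / (1 + x)))) * T x + (\<Sum>k\<le>m. c k * real k * (1 / (1 + x)) ^ k * (x * (1 / (1 + x)))))"
      unfolding u_def xd by (simp add: sum_negf sum_distrib_left sum_distrib_right algebra_simps)
    also have "\<dots> = u * (\<Sum>k\<le>m. D k x)"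
      unfolding xw T_def D_def sum_distrib_left sum.distrib[symmetric]
      by (intro sum.cong refl arg_cong[where f="(*) u"]) (simp add: algebra_simps add_divide_distrib)
    finally show "((\<lambda>s. - (s powr (- d) * (1 + s) powr (- b) * T s)) has_real_derivative
        x powr (- d - 1) * (1 + x) powr (- b) * (b + d - c m * (b + real m) * (1 / (1 + x)) ^ Suc m)) (at x)"
      using p unfolding tele u_def by metis
    show "isCont (\<lambda>x. x powr (- d - 1) * (1 + x) powr (- b) * (b + d - c m * (b + real m) * (1 / (1 + x)) ^ Suc m)) x"
      using x by (intro continuous_intros) auto
    have "c m * (b + real m) * (1 / (1 + x)) ^ Suc m \<le> b * 1"
      unfolding c_def using x b d hyp_coeff_bound(1)[of b "b + d" m]
      by (intro mult_mono power_le_one) auto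
    then show "0 \<le> x powr (- d - 1) * (1 + x) powr (- b) * (b + d - c m * (b + real m) * (1 / (1 + x)) ^ Suc m)"
      using d by (intro mult_nonneg_nonneg) auto
  next
    show "((\<lambda>s. - (s powr (- d) * (1 + s) powr (- b) * T s)) \<longlongrightarrow> - (\<beta> powr (- d) * (1 + \<beta>) powr (- b) * T \<beta>)) (at_right \<beta>)"
      unfolding T_def using \<beta> by (intro tendsto_intros) auto
    have "((\<lambda>s. s powr (- d)) \<longlongrightarrow> 0) at_top" using d by real_asymp
    moreover have "((\<lambda>s. (1 + s) powr (- b)) \<longlongrightarrow> 0) at_top" using b by real_asymp
    moreover have "(T \<longlongrightarrow> (\<Sum>k\<le>m. c k * 0 ^ k)) at_top"
      unfolding T_def
    proof (intro tendsto_intros)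
      show "((\<lambda>s::real. 1 / (1 + s)) \<longlongrightarrow> 0) at_top" by real_asymp
    qed
    ultimately have "((\<lambda>s. - (s powr (- d) * (1 + s) powr (- b) * T s)) \<longlongrightarrow> - (0 * 0 * (\<Sum>k\<le>m. c k * 0 ^ k))) at_top"
      by (intro tendsto_intros)
    then show "((\<lambda>s. - (s powr (- d) * (1 + s) powr (- b) * T s)) \<longlongrightarrow> 0) at_top" by simp
  qed
  then show ?thesis by (simp add: c_def T_def)
qed

text \<open>The limit \<open>m\<close> to infinity of the telescoped identity. The boundary term is
  at most \<open>b * (1 / (1 + s)) ^ Suc m\<close> and decreases to 0, so the integrands increase;
  on the right the partial sums converge to the hypergeometric series at
  \<open>1 / (1 + \<beta>)\<close>.\<close>

lemma nn_integral_rho_tail: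
  assumes d: "0 < d" and b: "0 < b" and \<beta>: "0 < \<beta>"
  shows "(\<integral>\<^sup>+s. ennreal ((b + d) * (s powr (- d - 1) * (1 + s) powr (- b))) * indicator {\<beta><..} s \<partial>lborel)
       = ennreal (\<beta> powr (- d) * (1 + \<beta>) powr (- b) * hyp2F1 1 b (1 + (b + d)) (1 / (1 + \<beta>)))"
proof (rule LIMSEQ_unique)
  define c where "c = hyp_coeff b (1 + (b + d))"
  define f where "f m s = ennreal (s powr (- d - 1) * (1 + s) powr (- b) *
           (b + d - c m * (b + real m) * (1 / (1 + s)) ^ Suc m)) * indicator {\<beta><..} s" for m s
  show "(\<lambda>m. \<integral>\<^sup>+s. f m s \<partial>lborel) \<longlonglongrightarrow>
    (\<integral>\<^sup>+s. ennreal ((b + d) * (s powr (- d - 1) * (1 + s) powr (- b))) * indicator {\<beta><..} s \<partial>lborel)"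
  proof (rule nn_integral_LIMSEQ)
    show "incseq f"
    proof (intro incseq_SucI le_funI)
      fix m s
      show "f m s \<le> f (Suc m) s"
      proof (cases "\<beta> < s")
        case True
        then have s: "0 < s" using \<beta> by simp
        have c1: "c (Suc m) * (b + real (Suc m)) \<le> c m * (b + real m)"
          unfolding c_def using b d by (intro hyp_coeff_bound) auto
        have c2: "0 \<le> c m * (b + real m)"
          unfolding c_def using b d hyp_coeff_nonneg[of b "1 + (b + d)" m] by simp
        have c3: "(1 / (1 + s)) ^ Suc (Suc m) \<le> (1 / (1 + s)) ^ Suc m"
          using s by (intro power_decreasing) auto
        have "c (Suc m) * (b + real (Suc m)) * (1 / (1 + s)) ^ Suc (Suc m)
            \<le> c m * (b + real m) * (1 / (1 + s)) ^ Suc m"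
          by (rule mult_mono[OF c1 c3 c2]) (use s in auto)
        then show ?thesis unfolding f_def
          by (intro mult_right_mono ennreal_leI mult_left_mono) auto
      qed (simp add: f_def)
    qed
    show "f m \<in> borel_measurable lborel" for m unfolding f_def by measurable
    show "(\<lambda>m. f m s) \<longlonglongrightarrow> ennreal ((b + d) * (s powr (- d - 1) * (1 + s) powr (- b))) * indicator {\<beta><..} s" for s
    proof (cases "\<beta> < s")
      case True
      then have s: "0 < s" using \<beta> by simp
      have "(\<lambda>m. c m * (b + real m) * (1 / (1 + s)) ^ Suc m) \<longlonglongrightarrow> 0"
      proof (rule Lim_null_comparison)
        show "(\<lambda>m. b * (1 / (1 + s)) ^ Suc m) \<longlonglongrightarrow> 0"
          using s by (intro tendsto_mult_right_zero LIMSEQ_Suc LIMSEQ_power_zero) auto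
        show "\<forall>\<^sub>F m in sequentially. norm (c m * (b + real m) * (1 / (1 + s)) ^ Suc m) \<le> b * (1 / (1 + s)) ^ Suc m"
        proof (intro always_eventually allI)
          fix m
          have "0 \<le> c m * (b + real m)" unfolding c_def using b d hyp_coeff_nonneg[of b "1 + (b + d)" m] by simp
          moreover have "c m * (b + real m) \<le> b" unfolding c_def using b d by (intro hyp_coeff_bound) auto
          ultimately show "norm (c m * (b + real m) * (1 / (1 + s)) ^ Suc m) \<le> b * (1 / (1 + s)) ^ Suc m"
            using s by (simp only: real_norm_def abs_mult abs_of_nonneg power_abs[symmetric])
              (intro mult_mono, auto)
        qed
      qed
      then have "(\<lambda>m. s powr (- d - 1) * (1 + s) powr (- b) * (b + d - c m * (b + real m) * (1 / (1 + s)) ^ Suc m))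
          \<longlonglongrightarrow> s powr (- d - 1) * (1 + s) powr (- b) * (b + d - 0)"
        by (intro tendsto_intros)
      then show ?thesis using True unfolding f_def by (simp add: tendsto_ennrealI mult_ac)
    qed (simp add: f_def)
  qed
  have "(\<lambda>m. \<Sum>k\<le>m. c k * (1 / (1 + \<beta>)) ^ k) \<longlonglongrightarrow> hyp2F1 1 b (1 + (b + d)) (1 / (1 + \<beta>))"
    unfolding c_def using hyp2F1_1_sums[of b "1 + (b + d)" "1 / (1 + \<beta>)"] b d \<beta>
    by (simp add: sums_def_le)
  then have "(\<lambda>m. ennreal (\<beta> powr (- d) * (1 + \<beta>) powr (- b) * (\<Sum>k\<le>m. c k * (1 / (1 + \<beta>)) ^ k)))
      \<longlonglongrightarrow> ennreal (\<beta> powr (- d) * (1 + \<beta>) powr (- b) * hyp2F1 1 b (1 + (b + d)) (1 / (1 + \<beta>)))"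
    by (intro tendsto_ennrealI tendsto_intros)
  then show "(\<lambda>m. \<integral>\<^sup>+s. f m s \<partial>lborel) \<longlonglongrightarrow>
      ennreal (\<beta> powr (- d) * (1 + \<beta>) powr (- b) * hyp2F1 1 b (1 + (b + d)) (1 / (1 + \<beta>)))"
    unfolding f_def c_def nn_integral_rho_tail_aux[OF d b \<beta>] .
qed

text \<open>Here \<open>y\<close> is the power of all other stations and \<open>s\<close> that of
  the covering one. Scaling \<open>s\<close> by \<open>y\<close> brings out the power of
  \<open>y\<close> and leaves the case \<open>y = 1\<close>. For \<open>n = 0\<close> only a tail of
  \<open>rho d\<close> is left; this case stands apart because Euler's integral in
  \<open>hyp2F1\<close> degenerates when its second parameter is 0.\<close>

lemma nn_integral_rho_covered:
  assumes d: "0 < d" and \<beta>: "0 < \<beta>" and y: "0 < y"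
  shows "(\<integral>\<^sup>+s. ennreal ((y + s) powr (- (real n * d))) * indicator {\<beta> * y..} s \<partial>rho d)
       = ennreal (y powr (- (real (Suc n) * d)) * \<beta> powr (- d) / real (Suc n) *
          (if n = 0 then 1 else hyp2F1 1 (real n * d) (1 + real (Suc n) * d) (1 / (1 + \<beta>)) / (1 + \<beta>) powr (real n * d)))"
proof -
  have "(\<integral>\<^sup>+s. ennreal ((y + s) powr (- (real n * d))) * indicator {\<beta> * y..} s \<partial>rho d)
      = (\<integral>\<^sup>+s. ennreal (d * (s powr (- d - 1) * (y + s) powr (- (real n * d)))) * indicator {\<beta> * y<..} s \<partial>lborel)"
  proof (subst nn_integral_rho, measurable, rule nn_integral_cong_AE, rule AE_mp[OF AE_lborel_singleton[of "\<beta> * y"]], rule AE_I2, rule impI)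
    fix s :: real assume "s \<noteq> \<beta> * y"
    moreover have "0 < \<beta> * y" using \<beta> y by simp
    ultimately show "ennreal (d * s powr (- d - 1)) * indicator {0<..} s *
        (ennreal ((y + s) powr (- (real n * d))) * indicator {\<beta> * y..} s)
      = ennreal (d * (s powr (- d - 1) * (y + s) powr (- (real n * d)))) * indicator {\<beta> * y<..} s"
      using d by (cases "\<beta> * y < s") (auto simp: mult.assoc ennreal_mult')
  qed
  also have "\<dots> = ennreal y * (\<integral>\<^sup>+s. ennreal (d * ((y * s) powr (- d - 1) * (y + y * s) powr (- (real n * d)))) *
      indicator {\<beta> * y<..} (y * s) \<partial>lborel)"
    using y by (subst nn_integral_real_affine[where c=y and t=0]) auto
  also have "\<dots> = ennreal y * (\<integral>\<^sup>+s. ennreal (y powr (- (real (Suc n) * d) - 1)) *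
      (ennreal (d * (s powr (- d - 1) * (1 + s) powr (- (real n * d)))) * indicator {\<beta><..} s) \<partial>lborel)"
  proof (intro arg_cong[where f="(*) (ennreal y)"] nn_integral_cong)
    fix s :: real
    show "ennreal (d * ((y * s) powr (- d - 1) * (y + y * s) powr (- (real n * d)))) * indicator {\<beta> * y<..} (y * s)
      = ennreal (y powr (- (real (Suc n) * d) - 1)) *
      (ennreal (d * (s powr (- d - 1) * (1 + s) powr (- (real n * d)))) * indicator {\<beta><..} s)"
    proof (cases "\<beta> < s")
      case True
      then have s: "0 < s" using \<beta> by simp
      have "y + y * s = y * (1 + s)" by (simp add: algebra_simps)
      moreover have "y powr (- d - 1) * y powr (- (real n * d)) = y powr (- (real (Suc n) * d) - 1)"
        by (simp add: algebra_simps flip: powr_add)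
      ultimately have E: "d * ((y * s) powr (- d - 1) * (y + y * s) powr (- (real n * d)))
         = y powr (- (real (Suc n) * d) - 1) * (d * (s powr (- d - 1) * (1 + s) powr (- (real n * d))))"
        using y s by (simp add: powr_mult mult_ac)
      have "indicator {\<beta> * y<..} (y * s) = (indicator {\<beta><..} s :: ennreal)"
        using True y by (simp add: indicator_def mult.commute)
      then show ?thesis
        by (simp only: E ennreal_mult'[OF powr_ge_zero] mult.assoc)
    next
      case False
      then show ?thesis using y by (simp add: indicator_def mult.commute)
    qed
  qed
  also have "\<dots> = ennreal (y powr (- (real (Suc n) * d))) *
      (\<integral>\<^sup>+s. ennreal (d * (s powr (- d - 1) * (1 + s) powr (- (real n * d)))) * indicator {\<beta><..} s \<partial>lborel)"
    using y by (subst nn_integral_cmult) (auto simp: powr_diff simp flip: mult.assoc ennreal_mult')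
  also have "(\<integral>\<^sup>+s. ennreal (d * (s powr (- d - 1) * (1 + s) powr (- (real n * d)))) * indicator {\<beta><..} s \<partial>lborel)
      = ennreal (\<beta> powr (- d) / real (Suc n) *
          (if n = 0 then 1 else hyp2F1 1 (real n * d) (1 + real (Suc n) * d) (1 / (1 + \<beta>)) / (1 + \<beta>) powr (real n * d)))"
  proof (cases "n = 0")
    case True
    have "ennreal (\<beta> powr (- d)) = emeasure (rho d) {\<beta><..}"
      using d \<beta> by (simp add: emeasure_rho_Ioi)
    also have "\<dots> = (\<integral>\<^sup>+s. indicator {\<beta><..} s \<partial>rho d)" by simp
    also have "\<dots> = (\<integral>\<^sup>+s. ennreal (d * s powr (- d - 1)) * indicator {\<beta><..} s \<partial>lborel)"
      using \<beta> by (subst nn_integral_rho) (auto intro!: nn_integral_cong simp: indicator_def)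
    finally show ?thesis using True \<beta>
      by (auto intro!: nn_integral_cong simp: indicator_def)
  next
    case False
    \<comment> \<open>\<open>nn_integral_rho_tail\<close> carries the factor \<open>b + d\<close>,
      which for \<open>b = n * d\<close> is \<open>Suc n\<close> times \<open>d\<close>; hence the
      factor \<open>1 / Suc n\<close>.\<close>
    have "(\<integral>\<^sup>+s. ennreal (d * (s powr (- d - 1) * (1 + s) powr (- (real n * d)))) * indicator {\<beta><..} s \<partial>lborel)
      = (\<integral>\<^sup>+s. ennreal (1 / real (Suc n)) * (ennreal ((real n * d + d) * (s powr (- d - 1) * (1 + s) powr (- (real n * d)))) * indicator {\<beta><..} s) \<partial>lborel)"
    proof (rule nn_integral_cong)
      fix s :: real
      have "d * X = 1 / real (Suc n) * ((real n * d + d) * X)" for X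
        by (simp add: divide_simps) (simp add: algebra_simps)
      then show "ennreal (d * (s powr (- d - 1) * (1 + s) powr (- (real n * d)))) * indicator {\<beta><..} s
        = ennreal (1 / real (Suc n)) * (ennreal ((real n * d + d) * (s powr (- d - 1) * (1 + s) powr (- (real n * d)))) * indicator {\<beta><..} s)"
        by (subst mult.assoc[symmetric], subst ennreal_mult'[symmetric]) simp_all
    qed
    also have "\<dots> = ennreal (1 / real (Suc n)) * ennreal (\<beta> powr (- d) * (1 + \<beta>) powr (- (real n * d)) *
        hyp2F1 1 (real n * d) (1 + (real n * d + d)) (1 / (1 + \<beta>)))"
      using False d \<beta> by (subst nn_integral_cmult) (auto simp: nn_integral_rho_tail)
    also have "\<dots> = ennreal (1 / real (Suc n) * (\<beta> powr (- d) * (1 + \<beta>) powr (- (real n * d)) *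
        hyp2F1 1 (real n * d) (1 + (real n * d + d)) (1 / (1 + \<beta>))))"
      by (rule ennreal_mult'[symmetric]) simp
    also have "1 + (real n * d + d) = 1 + real (Suc n) * d"
      by (simp add: distrib_right)
    also have "1 / real (Suc n) * (\<beta> powr (- d) * (1 + \<beta>) powr (- (real n * d)) *
        hyp2F1 1 (real n * d) (1 + real (Suc n) * d) (1 / (1 + \<beta>)))
      = \<beta> powr (- d) / real (Suc n) * (hyp2F1 1 (real n * d) (1 + real (Suc n) * d) (1 / (1 + \<beta>)) / (1 + \<beta>) powr (real n * d))"
      unfolding powr_minus[of "1 + \<beta>"] by (simp only: divide_inverse mult_ac mult_1_left)
    finally show ?thesis using False by simp
  qed
  finally show ?thesis using y by (simp add: mult.assoc flip: ennreal_mult')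
qed

section \<open>Uniqueness of Laplace transforms\<close>

text \<open>The exponential series is integrated term by term. Since |x| is at most 1, all absolute
  moments are at most 1, and the series is dominated by that of exp |t|.\<close>

lemma char_of_bounded_moments:
  assumes "real_distribution N" and bd: "AE x in N. \<bar>x\<bar> \<le> 1"
  shows "char N t = (\<Sum>k. (\<i> * of_real t) ^ k / fact k * of_real (\<integral>x. x ^ k \<partial>N))"
proof -
  interpret real_distribution N by fact
  have int: "integrable N (\<lambda>x. x ^ k)" for k
  proof (rule integrable_const_bound[where B=1])
    show "AE x in N. norm (x ^ k) \<le> 1"
      using bd by eventually_elim (auto simp: power_abs power_le_one)
  qed auto
  have intc: "integrable N (\<lambda>x. (\<i> * of_real t) ^ k / fact k * complex_of_real (x ^ k))" for k
    by (intro integrable_mult_right integrable_of_real int)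
  have norm_eq: "norm ((\<i> * of_real t) ^ k / fact k * complex_of_real (x ^ k)) = \<bar>t\<bar> ^ k / fact k * \<bar>x\<bar> ^ k" for k x
    by (simp add: norm_mult norm_divide norm_power power_abs)
  have expt: "summable (\<lambda>k. \<bar>t\<bar> ^ k / fact k)"
    using summable_exp[of "\<bar>t\<bar>"] by (simp add: divide_inverse mult.commute)
  have "char N t = (\<integral>x. (\<Sum>k. (\<i> * of_real t) ^ k / fact k * complex_of_real (x ^ k)) \<partial>N)"
    unfolding char_def
  proof (rule Bochner_Integration.integral_cong[OF refl])
    fix x
    have "(\<lambda>k. (\<i> * of_real (t * x)) ^ k /\<^sub>R fact k) sums iexp (t * x)"
      by (rule exp_converges)
    then show "iexp (t * x) = (\<Sum>k. (\<i> * of_real t) ^ k / fact k * complex_of_real (x ^ k))"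
      by (simp add: sums_iff scaleR_conv_of_real power_mult_distrib divide_inverse mult_ac)
  qed
  also have "\<dots> = (\<Sum>k. \<integral>x. (\<i> * of_real t) ^ k / fact k * complex_of_real (x ^ k) \<partial>N)"
  proof (rule integral_suminf)
    show "integrable N (\<lambda>x. (\<i> * of_real t) ^ k / fact k * complex_of_real (x ^ k))" for k by (rule intc)
    show "AE x in N. summable (\<lambda>k. norm ((\<i> * of_real t) ^ k / fact k * complex_of_real (x ^ k)))"
      using bd
    proof eventually_elim
      case (elim x)
      show ?case
      proof (rule summable_comparison_test'[OF expt])
        show "norm (norm ((\<i> * of_real t) ^ k / fact k * complex_of_real (x ^ k))) \<le> \<bar>t\<bar> ^ k / fact k" for k
        proof -
          have "\<bar>t\<bar> ^ k / fact k * \<bar>x\<bar> ^ k \<le> \<bar>t\<bar> ^ k / fact k"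
            using elim by (intro mult_left_le power_le_one) auto
          then show ?thesis unfolding norm_eq by simp
        qed
      qed
    qed
    show "summable (\<lambda>k. \<integral>x. norm ((\<i> * of_real t) ^ k / fact k * complex_of_real (x ^ k)) \<partial>N)"
    proof (rule summable_comparison_test'[OF expt])
      fix k
      have "(\<integral>x. norm ((\<i> * of_real t) ^ k / fact k * complex_of_real (x ^ k)) \<partial>N) \<le> (\<integral>x. \<bar>t\<bar> ^ k / fact k \<partial>N)"
      proof (rule integral_mono_AE)
        show "AE x in N. norm ((\<i> * of_real t) ^ k / fact k * complex_of_real (x ^ k)) \<le> \<bar>t\<bar> ^ k / fact k"
          using bd by eventually_elim (unfold norm_eq, intro mult_left_le power_le_one, auto)
      qed (simp_all only: integrable_norm[OF intc] integrable_const)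
      then show "norm (\<integral>x. norm ((\<i> * of_real t) ^ k / fact k * complex_of_real (x ^ k)) \<partial>N) \<le> \<bar>t\<bar> ^ k / fact k"
        by (simp add: prob_space[unfolded space_eq_univ])
    qed
  qed
  also have "\<dots> = (\<Sum>k. (\<i> * of_real t) ^ k / fact k * of_real (\<integral>x. x ^ k \<partial>N))"
    by (simp only: integral_mult_right_zero integral_complex_of_real)
  finally show ?thesis .
qed

text \<open>
  The substitution \<open>z = exp (- x)\<close> turns Laplace transforms at the natural numbers into the moments
  of a distribution on \<open>{0..1}\<close>, which determine its characteristic function.
\<close>

lemma prob_Laplace_unique:
  assumes M: "real_distribution M1" "real_distribution M2"
    and pos: "AE x in M1. 0 \<le> x" "AE x in M2. 0 \<le> x"
    and eq: "\<And>k::nat. (\<integral>x. exp (- (real k * x)) \<partial>M1) = (\<integral>x. exp (- (real k * x)) \<partial>M2)"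
  shows "M1 = M2"
proof -
  interpret M1: real_distribution M1 by fact
  interpret M2: real_distribution M2 by fact
  define e where "e = (\<lambda>x::real. exp (- x))"
  have [measurable]: "e \<in> borel_measurable borel" by (simp add: e_def)
  have D1: "real_distribution (distr M1 borel e)" and D2: "real_distribution (distr M2 borel e)"
    by (auto intro!: M1.real_distribution_distr M2.real_distribution_distr)
  have b1: "AE x in distr M1 borel e. \<bar>x\<bar> \<le> 1"
    by (subst AE_distr_iff) (use pos(1) in \<open>auto simp: e_def\<close>)
  have b2: "AE x in distr M2 borel e. \<bar>x\<bar> \<le> 1"
    by (subst AE_distr_iff) (use pos(2) in \<open>auto simp: e_def\<close>)
  have "(\<integral>x. x ^ k \<partial>distr M1 borel e) = (\<integral>x. x ^ k \<partial>distr M2 borel e)" for k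
    using eq[of k] by (simp add: integral_distr e_def exp_of_nat_mult[symmetric])
  then have "char (distr M1 borel e) = char (distr M2 borel e)"
    by (intro ext) (simp add: char_of_bounded_moments[OF D1 b1] char_of_bounded_moments[OF D2 b2])
  then have *: "distr M1 borel e = distr M2 borel e" using Levy_uniqueness D1 D2 by blast
  \<comment> \<open>\<open>e\<close> is undone by \<open>- ln\<close>, so nothing is lost in passing
    to the image law.\<close>
  have "distr (distr M borel e) borel (\<lambda>z. - ln z) = M" if "sets M = sets borel" for M
    using that by (subst distr_distr) (auto simp: comp_def e_def intro!: distr_id2)
  then show ?thesis using * by (metis M1.events_eq_borel M2.events_eq_borel)
qed

lemma AE_scale_measureI:
  assumes "AE x in M. P x" shows "AE x in scale_measure c M. P x"
proof -
  from assms obtain N where "{x \<in> space M. \<not> P x} \<subseteq> N" "emeasure M N = 0" "N \<in> sets M"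
    by (rule AE_E)
  then show ?thesis by (intro AE_I[where N=N]) (auto simp: space_scale_measure)
qed

text \<open>The transform at \<open>k = 0\<close> is the total mass, so both measures have the same
  mass and can be normalised to probability measures. Mass 0 admits no normalisation and is treated
  apart.\<close>

lemma finite_Laplace_unique:
  assumes "finite_measure M1" "finite_measure M2"
    and sets [simp]: "sets M1 = sets borel" "sets M2 = sets borel"
    and pos: "AE x in M1. (0::real) \<le> x" "AE x in M2. 0 \<le> x"
    and eq: "\<And>k::nat. (\<integral>\<^sup>+x. ennreal (exp (- (real k * x))) \<partial>M1) = (\<integral>\<^sup>+x. ennreal (exp (- (real k * x))) \<partial>M2)"
  shows "M1 = M2"
proof -
  interpret M1: finite_measure M1 by fact
  interpret M2: finite_measure M2 by fact
  have sp [simp]: "space M1 = UNIV" "space M2 = UNIV"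
    using sets_eq_imp_space_eq[OF sets(1)] sets_eq_imp_space_eq[OF sets(2)] by auto
  have mass: "emeasure M1 UNIV = emeasure M2 UNIV" using eq[of 0] by simp
  show ?thesis
  proof (cases "emeasure M1 UNIV = 0")
    case True
    then have "emeasure M1 A = 0" "emeasure M2 A = 0" for A
      using mass emeasure_mono[of A UNIV M1] emeasure_mono[of A UNIV M2] by auto
    then show ?thesis by (intro measure_eqI) auto
  next
    case False
    define c where "c = measure M1 UNIV"
    have c: "0 < c" "emeasure M1 UNIV = ennreal c"
      using False by (auto simp: c_def M1.emeasure_eq_measure zero_less_measure_iff)
    define s :: "real measure \<Rightarrow> real measure" where "s = scale_measure (ennreal (1 / c))"
    have restore: "scale_measure (ennreal c) (s M) = M" for M
      using c by (simp add: s_def scale_scale_measure flip: ennreal_mult')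
    have rd: "real_distribution (s M)" if "sets M = sets borel" "emeasure M UNIV = ennreal c" for M
    proof -
      have [simp]: "space M = UNIV" using sets_eq_imp_space_eq[OF that(1)] by simp
      have "prob_space (s M)"
        by (rule prob_spaceI) (use that c in \<open>simp add: s_def space_scale_measure flip: ennreal_mult'\<close>)
      then show ?thesis using that(1)
        by (simp add: real_distribution_def real_distribution_axioms_def s_def)
    qed
    have AEs: "AE x in s M. 0 \<le> x" if "AE x in M. 0 \<le> x" for M
      using that unfolding s_def by (rule AE_scale_measureI)
    have "s M1 = s M2"
    proof (rule prob_Laplace_unique)
      fix k :: nat
      have "(\<integral>x. exp (- (real k * x)) \<partial>s M) = enn2real (ennreal (1 / c) * (\<integral>\<^sup>+x. ennreal (exp (- (real k * x))) \<partial>M))"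
        if "sets M = sets borel" for M
      proof -
        have m: "(\<lambda>x. exp (- (real k * x))) \<in> borel_measurable M"
          using that by (simp cong: measurable_cong_sets)
        then show ?thesis
          by (subst integral_eq_nn_integral) (auto simp: s_def nn_integral_scale_measure)
      qed
      then show "(\<integral>x. exp (- (real k * x)) \<partial>s M1) = (\<integral>x. exp (- (real k * x)) \<partial>s M2)"
        using eq[of k] by simp
    qed (use rd c mass pos AEs in auto)
    then show ?thesis using restore by metis
  qed
qed

text \<open>The hypothesis mixes a Laplace transform in the first coordinate with a distribution
  function in the second, which is what the weights \<open>W k (thr r)\<close> deliver. Two
  one-dimensional uniqueness results are applied in turn. \<open>D\<close> is only a finite measure,
  because besides \<open>M\<close> it will be the measure that counts stations.\<close>

lemma distr_pair_Laplace:
  fixes R Y :: "'x \<Rightarrow> real"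
  assumes "finite_measure D"
    and [measurable]: "R \<in> borel_measurable D" "Y \<in> borel_measurable D"
    and R: "AE x in D. 0 \<le> R x"
    and "finite_measure \<nu>" and [simp, measurable_cong]: "sets \<nu> = sets borel"
    and \<nu>: "AE x in \<nu>. 0 \<le> x"
    and "real_distribution LY"
    and eq: "\<And>(k::nat) r. (\<integral>\<^sup>+x. ennreal (exp (- (real k * R x))) * indicator {..r} (Y x) \<partial>D)
        = (\<integral>\<^sup>+x. ennreal (exp (- (real k * x))) \<partial>\<nu>) * emeasure LY {..r}"
  shows "distr D (borel \<Otimes>\<^sub>M borel) (\<lambda>x. (R x, Y x)) = \<nu> \<Otimes>\<^sub>M LY"
proof -
  interpret D: finite_measure D by fact
  interpret \<nu>: finite_measure \<nu> by fact
  interpret LY: real_distribution LY by fact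
  have [simp]: "space \<nu> = UNIV" using sets_eq_imp_space_eq[of \<nu> borel] by simp
  have 1: "emeasure D {x \<in> space D. R x \<in> A \<and> Y x \<le> r} = emeasure \<nu> A * emeasure LY {..r}"
    if [measurable]: "A \<in> sets borel" for A r
  proof -
    \<comment> \<open>For fixed \<open>r\<close>, the law of \<open>R\<close> on the event
      \<open>Y \<le> r\<close>; the hypothesis is its Laplace transform.\<close>
    define N where "N = distr (density D (\<lambda>x. indicator {..r} (Y x))) borel R"
    have "N = scale_measure (emeasure LY {..r}) \<nu>"
    proof (rule finite_Laplace_unique)
      have "emeasure (density D (\<lambda>x. indicator {..r} (Y x))) (space D) \<le> emeasure D (space D)"
      proof -
        have "emeasure (density D (\<lambda>x. indicator {..r} (Y x))) (space D)
            = (\<integral>\<^sup>+x. indicator {..r} (Y x) * indicator (space D) x \<partial>D)"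
          by (rule emeasure_density) auto
        also have "\<dots> \<le> (\<integral>\<^sup>+x. indicator (space D) x \<partial>D)"
          by (intro nn_integral_mono) (simp add: indicator_def)
        finally show ?thesis by simp
      qed
      then have "finite_measure (density D (\<lambda>x. indicator {..r} (Y x)))"
        by (intro finite_measureI) (auto simp: top_unique)
      then show "finite_measure N" unfolding N_def
        by (rule finite_measure.finite_measure_distr) simp
      show "finite_measure (scale_measure (emeasure LY {..r}) \<nu>)"
        by (intro finite_measureI) (simp add: ennreal_mult_eq_top_iff LY.emeasure_eq_measure \<nu>.emeasure_eq_measure)
      show "AE x in N. 0 \<le> x"
        unfolding N_def using R by (subst AE_distr_iff) (auto simp: AE_density)
      show "AE x in scale_measure (emeasure LY {..r}) \<nu>. 0 \<le> x"
        using \<nu> by (rule AE_scale_measureI)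
      fix k :: nat
      have "(\<integral>\<^sup>+x. ennreal (exp (- (real k * x))) \<partial>N)
          = (\<integral>\<^sup>+x. indicator {..r} (Y x) * ennreal (exp (- (real k * R x))) \<partial>D)"
        unfolding N_def by (simp add: nn_integral_distr nn_integral_density)
      also have "\<dots> = (\<integral>\<^sup>+x. ennreal (exp (- (real k * x))) \<partial>\<nu>) * emeasure LY {..r}"
        using eq[of k r] by (simp add: mult.commute)
      finally show "(\<integral>\<^sup>+x. ennreal (exp (- (real k * x))) \<partial>N)
          = (\<integral>\<^sup>+x. ennreal (exp (- (real k * x))) \<partial>scale_measure (emeasure LY {..r}) \<nu>)"
        by (simp add: nn_integral_scale_measure mult.commute)
    qed (auto simp: N_def)
    then have "emeasure N A = emeasure LY {..r} * emeasure \<nu> A" by simp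
    moreover have "emeasure N A = emeasure D {x \<in> space D. R x \<in> A \<and> Y x \<le> r}"
    proof -
      have "emeasure N A = (\<integral>\<^sup>+x. indicator {..r} (Y x) * indicator (R -` A \<inter> space D) x \<partial>D)"
        unfolding N_def by (simp add: emeasure_distr emeasure_density)
      also have "\<dots> = (\<integral>\<^sup>+x. indicator {x \<in> space D. R x \<in> A \<and> Y x \<le> r} x \<partial>D)"
        by (intro nn_integral_cong) (auto simp: indicator_def)
      finally show ?thesis by simp
    qed
    ultimately show ?thesis by (simp add: mult.commute)
  qed
  have 2: "emeasure D {x \<in> space D. R x \<in> A \<and> Y x \<in> B} = emeasure \<nu> A * emeasure LY B"
    if [measurable]: "A \<in> sets borel" "B \<in> sets borel" for A B
  proof -
    \<comment> \<open>For fixed \<open>A\<close>, the law of \<open>Y\<close> on the event that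
      \<open>R\<close> lies in \<open>A\<close>; the first claim is its distribution
      function.\<close>
    define N where "N = distr (density D (\<lambda>x. indicator A (R x))) borel Y"
    have eN: "emeasure N B = emeasure D {x \<in> space D. R x \<in> A \<and> Y x \<in> B}" if [measurable]: "B \<in> sets borel" for B
    proof -
      have "emeasure N B = (\<integral>\<^sup>+x. indicator A (R x) * indicator (Y -` B \<inter> space D) x \<partial>D)"
        unfolding N_def by (simp add: emeasure_distr emeasure_density)
      also have "\<dots> = (\<integral>\<^sup>+x. indicator {x \<in> space D. R x \<in> A \<and> Y x \<in> B} x \<partial>D)"
        by (intro nn_integral_cong) (auto simp: indicator_def)
      finally show ?thesis by simp
    qed
    have "N = scale_measure (emeasure \<nu> A) LY"
    proof (rule cdf_unique')
      have "emeasure N UNIV \<le> emeasure D (space D)"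
        by (subst eN) (auto intro!: emeasure_mono)
      then have "finite_measure N"
        by (intro finite_measureI) (auto simp: N_def top_unique)
      then show "finite_borel_measure N"
        by (simp add: finite_borel_measure_def finite_borel_measure_axioms_def N_def)
      have "finite_measure (scale_measure (emeasure \<nu> A) LY)"
        by (intro finite_measureI) (simp add: ennreal_mult_eq_top_iff LY.emeasure_eq_measure \<nu>.emeasure_eq_measure)
      then show "finite_borel_measure (scale_measure (emeasure \<nu> A) LY)"
        by (simp add: finite_borel_measure_def finite_borel_measure_axioms_def)
      show "cdf N = cdf (scale_measure (emeasure \<nu> A) LY)"
        by (intro ext) (simp add: cdf_def measure_def eN 1)
    qed
    then show ?thesis using eN[of B] by simp
  qed
  show ?thesis
  proof (rule pair_measure_eqI[symmetric])
    show "sigma_finite_measure \<nu>" "sigma_finite_measure LY" by unfold_locales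
    show "sets (\<nu> \<Otimes>\<^sub>M LY) = sets (distr D (borel \<Otimes>\<^sub>M borel) (\<lambda>x. (R x, Y x)))"
      by (simp cong: sets_pair_measure_cong)
    fix A B assume "A \<in> sets \<nu>" "B \<in> sets LY"
    then have [measurable]: "A \<in> sets borel" "B \<in> sets borel" by auto
    have "emeasure (distr D (borel \<Otimes>\<^sub>M borel) (\<lambda>x. (R x, Y x))) (A \<times> B) = emeasure D {x \<in> space D. R x \<in> A \<and> Y x \<in> B}"
      by (subst emeasure_distr) (auto intro!: arg_cong[where f="emeasure D"])
    then show "emeasure \<nu> A * emeasure LY B = emeasure (distr D (borel \<Otimes>\<^sub>M borel) (\<lambda>x. (R x, Y x))) (A \<times> B)"
      by (simp add: 2)
  qed
qed

section \<open>The Mecke formula\<close>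

text \<open>\<open>slope j (C m)\<close> increases in both indices, so the diagonal has the same
  supremum as the double family, and that one is evaluated by \<open>slope_SUP\<close>.\<close>

lemma slope_diagonal:
  assumes "incseq C" "(\<lambda>j. C j) \<longlonglongrightarrow> c"
  shows "(\<lambda>j. slope j (C j)) \<longlonglongrightarrow> c"
proof -
  have inc: "incseq (\<lambda>j. slope j (C j))"
    using assms(1) incseq_slope by (intro incseq_SucI) (meson incseq_SucD order_trans slope_mono)
  have c: "c = (SUP m. C m)" using LIMSEQ_SUP[OF assms(1)] assms(2) LIMSEQ_unique by blast
  have "(SUP j. slope j (C j)) = c"
  proof (rule antisym)
    show "(SUP j. slope j (C j)) \<le> c"
      unfolding c by (intro SUP_mono) (auto intro: slope_le)
    have "c = (SUP m. SUP j. slope j (C m))" by (simp add: slope_SUP c)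
    also have "\<dots> \<le> (SUP j. slope j (C j))"
    proof (intro SUP_least)
      fix m j
      have "slope j (C m) \<le> slope (max m j) (C m)"
        using incseq_slope by (simp add: incseq_def)
      also have "\<dots> \<le> slope (max m j) (C (max m j))"
        using assms(1) by (intro slope_mono) (simp add: incseq_def)
      also have "\<dots> \<le> (SUP j. slope j (C j))" by (rule SUP_upper) simp
      finally show "slope j (C m) \<le> (SUP j. slope j (C j))" .
    qed
    finally show "c \<le> (SUP j. slope j (C j))" .
  qed
  then show ?thesis using LIMSEQ_SUP[OF inc] by simp
qed

lemma exp_neg_powr_LIMSEQ:
  "0 < c \<Longrightarrow> 0 < d \<Longrightarrow> (\<lambda>j. exp (- (c * real j powr d))) \<longlonglongrightarrow> 0"
  by real_asymp

text \<open>
  \<open>U i n\<close> and \<open>V i n\<close> are the powers received from the \<open>n\<close>-th active and the \<open>n\<close>-th idle station of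
  tier \<open>i\<close>. A missing station is given the power \<open>0\<close>, which the test functions do not see.
\<close>

locale shot_noise = prob_space M
  for M :: "'w measure" +
  fixes K :: nat and d :: real and a b \<beta> :: "nat \<Rightarrow> real"
    and U V :: "nat \<Rightarrow> nat \<Rightarrow> 'w \<Rightarrow> real"
  assumes d: "0 < d" "d < 1"
    and a: "\<And>i. i \<in> {1..K} \<Longrightarrow> 0 \<le> a i" and b: "\<And>i. i \<in> {1..K} \<Longrightarrow> 0 \<le> b i"
    and a_pos: "\<exists>i\<in>{1..K}. 0 < a i"
    and \<beta>_gt_1: "\<And>i. i \<in> {1..K} \<Longrightarrow> 1 < \<beta> i"
    and U_measurable [measurable]: "\<And>i n. U i n \<in> borel_measurable M"
    and V_measurable [measurable]: "\<And>i n. V i n \<in> borel_measurable M"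
    and Laplace_functional:
      "\<And>f g :: nat \<Rightarrow> real \<Rightarrow> ennreal.
        (\<And>i. f i \<in> borel_measurable borel) \<Longrightarrow> (\<And>i. g i \<in> borel_measurable borel) \<Longrightarrow>
        (\<And>i s. s \<le> 0 \<Longrightarrow> f i s = 0) \<Longrightarrow> (\<And>i s. s \<le> 0 \<Longrightarrow> g i s = 0) \<Longrightarrow>
        (\<integral>\<omega>. nexp ((\<Sum>i=1..K. \<Sum>n. f i (U i n \<omega>)) + (\<Sum>i=1..K. \<Sum>n. g i (V i n \<omega>))) \<partial>M)
        = nexp ((\<Sum>i=1..K. ennreal (a i) * (\<integral>\<^sup>+s. ennreal (1 - nexp (f i s)) \<partial>rho d)) +
                (\<Sum>i=1..K. ennreal (b i) * (\<integral>\<^sup>+s. ennreal (1 - nexp (g i s)) \<partial>rho d)))"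
begin

lemma \<beta>: "i \<in> {1..K} \<Longrightarrow> 0 < \<beta> i"
  using \<beta>_gt_1 less_trans zero_less_one by blast

section \<open>Interference, idle maximum and their exponential weights\<close>

definition Itot :: "'w \<Rightarrow> ennreal" where
  "Itot \<omega> = (\<Sum>i=1..K. \<Sum>n. ennreal (U i n \<omega>))"

text \<open>Dividing by the thresholds reduces the condition that no idle station of any tier covers
  to the single comparison of this supremum with the interference.\<close>

definition Ymax :: "'w \<Rightarrow> ennreal" where
  "Ymax \<omega> = (SUP i\<in>{1..K}. SUP n. ennreal (V i n \<omega> / \<beta> i))"

definition R :: "'w \<Rightarrow> real" where "R \<omega> = enn2real (Itot \<omega>)"
definition Y :: "'w \<Rightarrow> real" where "Y \<omega> = enn2real (Ymax \<omega>)"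

lemma Itot_measurable [measurable]: "Itot \<in> borel_measurable M"
  unfolding Itot_def by measurable

lemma Ymax_measurable [measurable]: "Ymax \<in> borel_measurable M"
  unfolding Ymax_def by measurable

lemma R_measurable [measurable]: "R \<in> borel_measurable M"
  unfolding R_def by measurable

lemma Y_measurable [measurable]: "Y \<in> borel_measurable M"
  unfolding Y_def by measurable

text \<open>The two scale constants: \<open>exp (- (eta * k powr d))\<close> will be the Laplace
  transform of the interference, and \<open>exp (- (idle_const * r powr (- d)))\<close> the
  distribution function of \<open>Ymax\<close>.\<close>

definition eta :: real where "eta = Gamma (1 - d) * (\<Sum>i=1..K. a i)"
definition idle_const :: real where "idle_const = (\<Sum>i=1..K. b i * \<beta> i powr (- d))"

lemma eta_pos: "0 < eta"
proof -
  obtain i where "i \<in> {1..K}" "0 < a i" using a_pos by blast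
  then have "0 < (\<Sum>i=1..K. a i)" using a by (intro sum_pos2[of _ i]) auto
  then show ?thesis using d by (simp add: eta_def)
qed

lemma idle_const_nonneg: "0 \<le> idle_const"
  unfolding idle_const_def using b by (intro sum_nonneg) auto

text \<open>An infinite penalty for any idle power that exceeds its threshold at interference
  \<open>r\<close>; the exponential of the summed penalties is the indicator of
  \<open>Ymax \<le> r\<close>. The condition \<open>0 < s\<close> makes the function vanish at
  nonpositive \<open>s\<close> for negative \<open>r\<close> as well.\<close>

definition thr :: "real \<Rightarrow> nat \<Rightarrow> real \<Rightarrow> ennreal" where
  "thr r i s = (if 0 < s \<and> \<beta> i * r < s then \<top> else 0)"

lemma thr_measurable [measurable]: "thr r i \<in> borel_measurable borel"
  unfolding thr_def by measurable

lemma nexp_thr: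
  assumes r: "0 \<le> r"
  shows "nexp (\<Sum>i=1..K. \<Sum>n. thr r i (V i n \<omega>)) = indicator {y. y \<le> ennreal r} (Ymax \<omega>)"
proof (cases "Ymax \<omega> \<le> ennreal r")
  case True
  have "thr r i (V i n \<omega>) = 0" if "i \<in> {1..K}" for i n
  proof -
    have "ennreal (V i n \<omega> / \<beta> i) \<le> ennreal r"
      using True that unfolding Ymax_def by (simp add: SUP_le_iff)
    then have "V i n \<omega> / \<beta> i \<le> r" using r by (simp add: ennreal_le_iff)
    then show ?thesis using \<beta>[OF that] by (simp add: thr_def field_simps)
  qed
  then show ?thesis using True by simp
next
  case False
  then obtain i n where i: "i \<in> {1..K}" and "ennreal r < ennreal (V i n \<omega> / \<beta> i)"
    unfolding Ymax_def by (auto simp: SUP_le_iff not_le)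
  then have "r < V i n \<omega> / \<beta> i" using r by (simp add: ennreal_less_iff)
  then have "\<beta> i * r < V i n \<omega>" using \<beta>[OF i] by (simp add: field_simps)
  moreover from this have "0 < V i n \<omega>" using r \<beta>[OF i] by (smt (verit) mult_nonneg_nonneg)
  ultimately have "thr r i (V i n \<omega>) = \<top>" by (simp add: thr_def)
  moreover have "thr r i (V i n \<omega>) \<le> (\<Sum>n. thr r i (V i n \<omega>))"
    using sum_le_suminf[of "\<lambda>n. thr r i (V i n \<omega>)" "{n}"] by simp
  ultimately have "(\<Sum>n. thr r i (V i n \<omega>)) = \<top>" by (simp add: top_unique)
  then have "(\<Sum>i=1..K. \<Sum>n. thr r i (V i n \<omega>)) = \<top>"
    using i by (subst sum.remove[of _ i]) auto
  then have "nexp (\<Sum>i=1..K. \<Sum>n. thr r i (V i n \<omega>)) = 0" by (simp only: nexp_top)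
  then show ?thesis using False by simp
qed

definition admissible :: "(nat \<Rightarrow> real \<Rightarrow> ennreal) \<Rightarrow> bool" where
  "admissible g \<longleftrightarrow> (\<forall>i. g i \<in> borel_measurable borel) \<and> (\<forall>i s. s \<le> 0 \<longrightarrow> g i s = 0)"

lemma admissible_thr: "admissible (thr r)"
  by (auto simp: admissible_def thr_def)

lemma admissible_0: "admissible (\<lambda>_ _. 0)"
  by (auto simp: admissible_def)

lemma admissible_measurable: "admissible g \<Longrightarrow> g i \<in> borel_measurable borel"
  by (simp add: admissible_def)

text \<open>
  The weight \<open>exp (- k * I)\<close> of the interference, times the indicator of \<open>Y \<le> r\<close> for \<open>g = thr r\<close>.
\<close>

definition W :: "real \<Rightarrow> (nat \<Rightarrow> real \<Rightarrow> ennreal) \<Rightarrow> 'w \<Rightarrow> real" where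
  "W k g \<omega> = nexp (ennreal k * Itot \<omega>) * nexp (\<Sum>i=1..K. \<Sum>n. g i (V i n \<omega>))"

lemma W_measurable [measurable]: "admissible g \<Longrightarrow> W k g \<in> borel_measurable M"
proof -
  assume "admissible g"
  then have [measurable]: "g i \<in> borel_measurable borel" for i by (rule admissible_measurable)
  show ?thesis unfolding W_def by measurable
qed

lemma W_bounds: "0 \<le> W k g \<omega>" "W k g \<omega> \<le> 1"
  by (auto simp: W_def intro!: mult_le_one)

lemma W_integrable: "admissible g \<Longrightarrow> integrable M (W k g)"
  by (rule integrable_const_bound[where B=1]) (auto simp: W_bounds)

definition idle_exponent :: "(nat \<Rightarrow> real \<Rightarrow> ennreal) \<Rightarrow> ennreal" where
  "idle_exponent g = (\<Sum>i=1..K. ennreal (b i) * (\<integral>\<^sup>+s. ennreal (1 - nexp (g i s)) \<partial>rho d))"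

definition active_exponent :: "real \<Rightarrow> ennreal" where
  "active_exponent k = (\<Sum>i=1..K. ennreal (a i) * (\<integral>\<^sup>+s. ennreal (1 - nexp (ennreal k * ennreal s)) \<partial>rho d))"

lemma Itot_scaled: "ennreal k * Itot \<omega> = (\<Sum>i=1..K. \<Sum>n. ennreal k * ennreal (U i n \<omega>))"
  by (simp add: Itot_def sum_distrib_left)

lemma active_exponent_eq:
  assumes "0 \<le> k" shows "active_exponent k = ennreal (eta * k powr d)"
proof -
  have "(\<integral>\<^sup>+s. ennreal (1 - nexp (ennreal k * ennreal s)) \<partial>rho d) = (\<integral>\<^sup>+s. ennreal (1 - exp (- (k * s))) \<partial>rho d)"
    using AE_rho_pos[of d] assms
    by (intro nn_integral_cong_AE) (auto elim!: eventually_mono simp: nexp_ennreal simp flip: ennreal_mult')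
  then have "active_exponent k = (\<Sum>i=1..K. ennreal (a i * (Gamma (1 - d) * k powr d)))"
    unfolding active_exponent_def using d assms a
    by (intro sum.cong refl) (simp add: nn_integral_rho_Laplace ennreal_mult')
  also have "\<dots> = ennreal (\<Sum>i=1..K. a i * (Gamma (1 - d) * k powr d))"
    using a d by (intro sum_ennreal) auto
  also have "(\<Sum>i=1..K. a i * (Gamma (1 - d) * k powr d)) = eta * k powr d"
    by (simp add: eta_def sum_distrib_right sum_distrib_left mult_ac)
  finally show ?thesis .
qed

lemma idle_exponent_eq:
  assumes "0 < r" shows "idle_exponent (thr r) = ennreal (idle_const * r powr (- d))"
proof -
  have "ennreal (b i) * (\<integral>\<^sup>+s. ennreal (1 - nexp (thr r i s)) \<partial>rho d) = ennreal (b i * \<beta> i powr (- d) * r powr (- d))"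
    if i: "i \<in> {1..K}" for i
  proof -
    have p: "0 < \<beta> i * r" using \<beta>[OF i] assms by simp
    have "(\<integral>\<^sup>+s. ennreal (1 - nexp (thr r i s)) \<partial>rho d) = (\<integral>\<^sup>+s. indicator {\<beta> i * r<..} s \<partial>rho d)"
      using p by (intro nn_integral_cong) (auto simp: thr_def indicator_def)
    also have "\<dots> = ennreal (\<beta> i powr (- d) * r powr (- d))"
      using p d \<beta>[OF i] assms by (simp add: emeasure_rho_Ioi powr_mult)
    finally show ?thesis using b[OF i] by (simp add: ennreal_mult' mult.assoc)
  qed
  then have "idle_exponent (thr r) = (\<Sum>i=1..K. ennreal (b i * \<beta> i powr (- d) * r powr (- d)))"
    unfolding idle_exponent_def by (intro sum.cong) auto
  also have "\<dots> = ennreal (\<Sum>i=1..K. b i * \<beta> i powr (- d) * r powr (- d))"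
    using b by (intro sum_ennreal) auto
  finally show ?thesis by (simp add: idle_const_def sum_distrib_right)
qed

text \<open>Active and idle stations enter the exponent of the Laplace functional additively, so the
  expectation is a product. In this form their independence is used.\<close>

lemma integral_W:
  assumes "admissible g"
  shows "(\<integral>\<omega>. W k g \<omega> \<partial>M) = nexp (active_exponent k) * nexp (idle_exponent g)"
proof -
  have "(\<integral>\<omega>. nexp ((\<Sum>i=1..K. \<Sum>n. ennreal k * ennreal (U i n \<omega>)) + (\<Sum>i=1..K. \<Sum>n. g i (V i n \<omega>))) \<partial>M)
     = nexp (active_exponent k + idle_exponent g)"
    unfolding active_exponent_def idle_exponent_def
    by (rule Laplace_functional) (use assms in \<open>auto simp: admissible_def ennreal_neg\<close>)
  then show ?thesis
    unfolding nexp_add W_def Itot_scaled .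
qed

text \<open>Perturb the test function of tier \<open>i0\<close> by \<open>e * h\<close>, with
  \<open>Z\<close> the sum of \<open>h\<close> over the active powers. The Laplace functional gives
  E (W * nexp (e * Z)) = E W * nexp (e * C), where \<open>C\<close> is the weighted integral of the
  difference quotient of \<open>h\<close>. Subtracting from E W and dividing by \<open>e\<close>
  turns both sides into slopes, and \<open>e = 1 / 2 ^ j\<close> tending to 0 differentiates the
  functional at \<open>e = 0\<close>. Everything is monotone, so the identity holds with values in
  \<open>ennreal\<close>.\<close>

lemma Campbell_Laplace:
  assumes i0: "i0 \<in> {1..K}" and k: "0 \<le> k" and g [measurable]: "admissible g"
    and [measurable]: "h \<in> borel_measurable borel" and h0: "\<And>s. s \<le> 0 \<Longrightarrow> h s = 0"
  shows "(\<integral>\<^sup>+\<omega>. (\<Sum>n. h (U i0 n \<omega>)) * ennreal (W k g \<omega>) \<partial>M)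
       = ennreal (\<integral>\<omega>. W k g \<omega> \<partial>M) * (ennreal (a i0) * (\<integral>\<^sup>+s. h s * ennreal (exp (- (k * s))) \<partial>rho d))"
proof (rule LIMSEQ_unique)
  define Z where "Z \<omega> = (\<Sum>n. h (U i0 n \<omega>))" for \<omega>
  have [measurable]: "Z \<in> borel_measurable M" unfolding Z_def by measurable
  define C where "C j = ennreal (a i0) * (\<integral>\<^sup>+s. slope j (h s) * ennreal (exp (- (k * s))) \<partial>rho d)" for j
  have step: "(\<integral>\<^sup>+\<omega>. slope j (Z \<omega>) * ennreal (W k g \<omega>) \<partial>M) = ennreal (\<integral>\<omega>. W k g \<omega> \<partial>M) * slope j (C j)" for j
  proof -
    define e :: real where "e = 1 / 2 ^ j"
    have e: "0 < e" by (simp add: e_def)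
    define f where "f i s = ennreal k * ennreal s + (if i = i0 then ennreal e * h s else 0)" for i s
    have [measurable]: "f i \<in> borel_measurable borel" for i unfolding f_def by measurable
    have "(\<integral>\<omega>. nexp ((\<Sum>i=1..K. \<Sum>n. f i (U i n \<omega>)) + (\<Sum>i=1..K. \<Sum>n. g i (V i n \<omega>))) \<partial>M)
        = nexp ((\<Sum>i=1..K. ennreal (a i) * (\<integral>\<^sup>+s. ennreal (1 - nexp (f i s)) \<partial>rho d)) + idle_exponent g)"
      unfolding idle_exponent_def
      by (rule Laplace_functional) (use g in \<open>auto simp: f_def admissible_def ennreal_neg h0\<close>)
    also have "(\<lambda>\<omega>. nexp ((\<Sum>i=1..K. \<Sum>n. f i (U i n \<omega>)) + (\<Sum>i=1..K. \<Sum>n. g i (V i n \<omega>))))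
        = (\<lambda>\<omega>. W k g \<omega> * nexp (ennreal e * Z \<omega>))"
    proof
      fix \<omega>
      have "(\<Sum>n. f i (U i n \<omega>)) = (\<Sum>n. ennreal k * ennreal (U i n \<omega>)) + (if i = i0 then ennreal e * Z \<omega> else 0)" for i
        by (simp add: f_def suminf_add[symmetric] Z_def)
      then have "(\<Sum>i=1..K. \<Sum>n. f i (U i n \<omega>)) = ennreal k * Itot \<omega> + ennreal e * Z \<omega>"
        using i0 by (simp add: sum.distrib Itot_scaled sum.delta)
      then show "nexp ((\<Sum>i=1..K. \<Sum>n. f i (U i n \<omega>)) + (\<Sum>i=1..K. \<Sum>n. g i (V i n \<omega>)))
          = W k g \<omega> * nexp (ennreal e * Z \<omega>)"
        by (simp only: nexp_add W_def mult_ac)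
    qed
    also have "(\<Sum>i=1..K. ennreal (a i) * (\<integral>\<^sup>+s. ennreal (1 - nexp (f i s)) \<partial>rho d))
       = active_exponent k + ennreal e * C j"
    proof -
      \<comment> \<open>With \<open>x = exp (- (k * s))\<close> and \<open>?q\<close> as below,
        \<open>1 - x * ?q = (1 - x) + (1 - ?q) * x\<close>: the unperturbed exponent plus
        \<open>e\<close> times the slope of \<open>h\<close>.\<close>
      have "(\<integral>\<^sup>+s. ennreal (1 - nexp (f i0 s)) \<partial>rho d)
          = (\<integral>\<^sup>+s. ennreal (1 - nexp (ennreal k * ennreal s)) + ennreal e * (slope j (h s) * ennreal (exp (- (k * s)))) \<partial>rho d)"
      proof (rule nn_integral_cong_AE, rule AE_mp[OF AE_rho_pos AE_I2], rule impI)
        fix s :: real assume s: "0 < s"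
        let ?q = "nexp (ennreal e * h s)"
        have q: "nexp (ennreal k * ennreal s) = exp (- (k * s))"
          using s k by (simp add: nexp_ennreal flip: ennreal_mult)
        have le: "exp (- (k * s)) \<le> 1" using s k by simp
        have "ennreal e * (slope j (h s) * ennreal (exp (- (k * s)))) = ennreal (e * (2 ^ j * (1 - ?q) * exp (- (k * s))))"
          using e unfolding slope_def e_def[symmetric]
          by (subst ennreal_mult'[symmetric], simp, subst ennreal_mult'[symmetric], simp) simp
        also have "e * (2 ^ j * (1 - ?q) * exp (- (k * s))) = (1 - ?q) * exp (- (k * s))"
          by (simp add: e_def)
        finally have "ennreal (1 - nexp (ennreal k * ennreal s)) + ennreal e * (slope j (h s) * ennreal (exp (- (k * s))))
            = ennreal (1 - exp (- (k * s)) + (1 - ?q) * exp (- (k * s)))"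
          using le unfolding q by (simp add: ennreal_plus[symmetric] del: ennreal_plus)
        then show "ennreal (1 - nexp (f i0 s)) = ennreal (1 - nexp (ennreal k * ennreal s)) + ennreal e * (slope j (h s) * ennreal (exp (- (k * s))))"
          by (simp add: f_def nexp_add q algebra_simps)
      qed
      also have "\<dots> = (\<integral>\<^sup>+s. ennreal (1 - nexp (ennreal k * ennreal s)) \<partial>rho d)
          + ennreal e * (\<integral>\<^sup>+s. slope j (h s) * ennreal (exp (- (k * s))) \<partial>rho d)"
        by (subst nn_integral_add) (auto simp: nn_integral_cmult)
      finally have i0': "ennreal (a i0) * (\<integral>\<^sup>+s. ennreal (1 - nexp (f i0 s)) \<partial>rho d)
        = ennreal (a i0) * (\<integral>\<^sup>+s. ennreal (1 - nexp (ennreal k * ennreal s)) \<partial>rho d) + ennreal e * C j"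
        by (simp add: C_def distrib_left mult_ac)
      have "ennreal (a i) * (\<integral>\<^sup>+s. ennreal (1 - nexp (f i s)) \<partial>rho d)
        = ennreal (a i) * (\<integral>\<^sup>+s. ennreal (1 - nexp (ennreal k * ennreal s)) \<partial>rho d) + (if i = i0 then ennreal e * C j else 0)" for i
        using i0' by (cases "i = i0") (auto simp: f_def)
      then show ?thesis
        using i0 by (simp add: sum.distrib active_exponent_def sum.delta)
    qed
    finally have E: "(\<integral>\<omega>. W k g \<omega> * nexp (ennreal e * Z \<omega>) \<partial>M) = (\<integral>\<omega>. W k g \<omega> \<partial>M) * nexp (ennreal e * C j)"
      by (simp add: integral_W[OF g] nexp_add)
    have int: "integrable M (\<lambda>\<omega>. W k g \<omega> * nexp (ennreal e * Z \<omega>))"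
      by (rule integrable_const_bound[where B=1])
         (auto simp: W_bounds abs_mult intro!: mult_le_one)
    have "(\<integral>\<^sup>+\<omega>. slope j (Z \<omega>) * ennreal (W k g \<omega>) \<partial>M)
        = (\<integral>\<^sup>+\<omega>. ennreal (2 ^ j * (W k g \<omega> - W k g \<omega> * nexp (ennreal e * Z \<omega>))) \<partial>M)"
      by (intro nn_integral_cong) (simp add: slope_def e_def W_bounds algebra_simps flip: ennreal_mult')
    also have "\<dots> = ennreal (\<integral>\<omega>. 2 ^ j * (W k g \<omega> - W k g \<omega> * nexp (ennreal e * Z \<omega>)) \<partial>M)"
      using int W_integrable[OF g, of k]
      by (intro nn_integral_eq_integral) (auto intro!: AE_I2 mult_nonneg_nonneg mult_left_le simp: W_bounds)
    also have "(\<integral>\<omega>. 2 ^ j * (W k g \<omega> - W k g \<omega> * nexp (ennreal e * Z \<omega>)) \<partial>M)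
        = 2 ^ j * ((\<integral>\<omega>. W k g \<omega> \<partial>M) - (\<integral>\<omega>. W k g \<omega> \<partial>M) * nexp (ennreal e * C j))"
      using int W_integrable[OF g, of k] by (simp add: E)
    also have "\<dots> = (\<integral>\<omega>. W k g \<omega> \<partial>M) * (2 ^ j * (1 - nexp (ennreal e * C j)))"
      by (simp add: algebra_simps)
    also have "ennreal \<dots> = ennreal (\<integral>\<omega>. W k g \<omega> \<partial>M) * slope j (C j)"
      by (simp add: slope_def e_def ennreal_mult'' )
    finally show ?thesis .
  qed
  show "(\<lambda>j. \<integral>\<^sup>+\<omega>. slope j (Z \<omega>) * ennreal (W k g \<omega>) \<partial>M) \<longlonglongrightarrow> (\<integral>\<^sup>+\<omega>. (\<Sum>n. h (U i0 n \<omega>)) * ennreal (W k g \<omega>) \<partial>M)"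
  proof (rule nn_integral_LIMSEQ)
    show "incseq (\<lambda>j \<omega>. slope j (Z \<omega>) * ennreal (W k g \<omega>))"
      using incseq_slope by (auto simp: incseq_def le_fun_def intro!: mult_right_mono)
    show "(\<lambda>j. slope j (Z \<omega>) * ennreal (W k g \<omega>)) \<longlonglongrightarrow> (\<Sum>n. h (U i0 n \<omega>)) * ennreal (W k g \<omega>)" for \<omega>
      unfolding Z_def[symmetric]
      by (subst (1 2) mult.commute) (intro ennreal_tendsto_cmult slope_LIMSEQ, auto)
  qed auto
  \<comment> \<open>On the right, \<open>j\<close> occurs both in the outer slope and inside
    \<open>C j\<close>, so the limit is taken along the diagonal.\<close>
  have "incseq C"
    unfolding C_def using incseq_slope
    by (auto simp: incseq_def intro!: mult_left_mono nn_integral_mono mult_right_mono)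
  moreover have "C \<longlonglongrightarrow> ennreal (a i0) * (\<integral>\<^sup>+s. h s * ennreal (exp (- (k * s))) \<partial>rho d)"
    unfolding C_def
  proof (rule ennreal_tendsto_cmult)
    show "(\<lambda>j. \<integral>\<^sup>+s. slope j (h s) * ennreal (exp (- (k * s))) \<partial>rho d) \<longlonglongrightarrow> (\<integral>\<^sup>+s. h s * ennreal (exp (- (k * s))) \<partial>rho d)"
    proof (rule nn_integral_LIMSEQ)
      show "incseq (\<lambda>j s. slope j (h s) * ennreal (exp (- (k * s))))"
        using incseq_slope by (auto simp: incseq_def le_fun_def intro!: mult_right_mono)
      show "(\<lambda>j. slope j (h s) * ennreal (exp (- (k * s)))) \<longlonglongrightarrow> h s * ennreal (exp (- (k * s)))" for s
        by (subst (1 2) mult.commute) (intro ennreal_tendsto_cmult slope_LIMSEQ, auto)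
    qed auto
  qed auto
  ultimately have "(\<lambda>j. slope j (C j)) \<longlonglongrightarrow> ennreal (a i0) * (\<integral>\<^sup>+s. h s * ennreal (exp (- (k * s))) \<partial>rho d)"
    by (rule slope_diagonal)
  then show "(\<lambda>j. \<integral>\<^sup>+\<omega>. slope j (Z \<omega>) * ennreal (W k g \<omega>) \<partial>M) \<longlonglongrightarrow>
      ennreal (\<integral>\<omega>. W k g \<omega> \<partial>M) * (ennreal (a i0) * (\<integral>\<^sup>+s. h s * ennreal (exp (- (k * s))) \<partial>rho d))"
    unfolding step by (intro ennreal_tendsto_cmult) auto
qed


section \<open>Finiteness, positivity and independence of interference and idle maximum\<close>

lemma Laplace_Itot:
  assumes "0 \<le> k"
  shows "(\<integral>\<omega>. nexp (ennreal k * Itot \<omega>) \<partial>M) = exp (- (eta * k powr d))"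
  using integral_W[OF admissible_0, of k] eta_pos assms
  by (simp add: W_def active_exponent_eq nexp_ennreal idle_exponent_def)

text \<open>For every positive \<open>k\<close> the weight
  \<open>nexp (ennreal k * Itot \<omega>)\<close> vanishes where the interference is infinite, so
  its expectation is a lower bound for the probability of finiteness. It tends to 1 as
  \<open>k\<close> tends to 0.\<close>

lemma AE_Itot_finite: "AE \<omega> in M. Itot \<omega> < \<top>"
proof -
  have "exp (- (eta * (1 / real (Suc j)) powr d)) \<le> prob {\<omega> \<in> space M. Itot \<omega> < \<top>}" for j
  proof -
    have "exp (- (eta * (1 / real (Suc j)) powr d)) = (\<integral>\<omega>. nexp (ennreal (1 / real (Suc j)) * Itot \<omega>) \<partial>M)"
      by (rule Laplace_Itot[symmetric]) simp
    also have "\<dots> \<le> (\<integral>\<omega>. indicator {\<omega> \<in> space M. Itot \<omega> < \<top>} \<omega> \<partial>M)"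
      by (intro integral_mono integrable_const_bound[where B=1])
         (auto simp: indicator_def ennreal_mult_top less_top[symmetric])
    finally show ?thesis by simp
  qed
  moreover have "(\<lambda>j. exp (- (eta * (1 / real (Suc j)) powr d))) \<longlonglongrightarrow> exp (- (eta * 0))"
  proof (intro tendsto_intros)
    show "(\<lambda>j. (1 / real (Suc j)) powr d) \<longlonglongrightarrow> 0" using d by real_asymp
  qed
  ultimately have "exp (- (eta * 0)) \<le> prob {\<omega> \<in> space M. Itot \<omega> < \<top>}"
    by (intro LIMSEQ_le_const2) auto
  then have "prob {\<omega> \<in> space M. Itot \<omega> < \<top>} = 1"
    using prob_le_1[of "{\<omega> \<in> space M. Itot \<omega> < \<top>}"] by simp
  then show ?thesis by (subst prob_Collect_eq_1[symmetric]) auto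
qed

text \<open>Where the interference vanishes the weight is 1 for every \<open>k\<close>, while its
  expectation tends to 0 as \<open>k\<close> grows. This rests on \<open>eta_pos\<close>, that is,
  on some tier being active.\<close>

lemma AE_Itot_pos: "AE \<omega> in M. 0 < Itot \<omega>"
proof -
  have "prob {\<omega> \<in> space M. Itot \<omega> = 0} \<le> exp (- (eta * real j powr d))" for j
  proof -
    have "prob {\<omega> \<in> space M. Itot \<omega> = 0} = (\<integral>\<omega>. indicator {\<omega> \<in> space M. Itot \<omega> = 0} \<omega> \<partial>M)"
      by simp
    also have "\<dots> \<le> (\<integral>\<omega>. nexp (ennreal (real j) * Itot \<omega>) \<partial>M)"
      by (intro integral_mono integrable_const_bound[where B=1]) (auto simp: indicator_def)
    finally show ?thesis by (simp add: Laplace_Itot)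
  qed
  moreover have "(\<lambda>j. exp (- (eta * real j powr d))) \<longlonglongrightarrow> 0"
    using eta_pos d(1) by (rule exp_neg_powr_LIMSEQ)
  ultimately have "prob {\<omega> \<in> space M. Itot \<omega> = 0} \<le> 0"
    by (intro LIMSEQ_le_const) auto
  then have "prob {\<omega> \<in> space M. Itot \<omega> = 0} = 0" by (simp add: measure_le_0_iff)
  then have "AE \<omega> in M. Itot \<omega> \<noteq> 0" by (subst (asm) prob_Collect_eq_0) auto
  then show ?thesis by (auto elim!: eventually_mono simp: zero_less_iff_neq_zero)
qed

lemma W0_thr: "0 \<le> r \<Longrightarrow> W 0 (thr r) \<omega> = indicator {y. y \<le> ennreal r} (Ymax \<omega>)"
  by (simp only: W_def nexp_thr) simp

lemma AE_Ymax_finite: "AE \<omega> in M. Ymax \<omega> < \<top>"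
proof -
  have "exp (- (idle_const * real (Suc j) powr (- d))) \<le> prob {\<omega> \<in> space M. Ymax \<omega> < \<top>}" for j
  proof -
    have "exp (- (idle_const * real (Suc j) powr (- d))) = (\<integral>\<omega>. W 0 (thr (real (Suc j))) \<omega> \<partial>M)"
      using idle_const_nonneg
      by (subst integral_W[OF admissible_thr]) (simp add: idle_exponent_eq active_exponent_eq nexp_ennreal)
    also have "\<dots> \<le> (\<integral>\<omega>. indicator {\<omega> \<in> space M. Ymax \<omega> < \<top>} \<omega> \<partial>M)"
      by (intro integral_mono W_integrable admissible_thr)
         (auto simp: W0_thr indicator_def less_top[symmetric] top_unique intro!: integrable_const_bound[where B=1] simp del: of_nat_Suc)
    finally show ?thesis by simp
  qed
  moreover have "(\<lambda>j. exp (- (idle_const * real (Suc j) powr (- d)))) \<longlonglongrightarrow> exp (- (idle_const * 0))"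
  proof (intro tendsto_intros)
    show "(\<lambda>j. real (Suc j) powr (- d)) \<longlonglongrightarrow> 0" using d by real_asymp
  qed
  ultimately have "exp (- (idle_const * 0)) \<le> prob {\<omega> \<in> space M. Ymax \<omega> < \<top>}"
    by (intro LIMSEQ_le_const2) auto
  then have "prob {\<omega> \<in> space M. Ymax \<omega> < \<top>} = 1"
    using prob_le_1[of "{\<omega> \<in> space M. Ymax \<omega> < \<top>}"] by simp
  then show ?thesis by (subst prob_Collect_eq_1[symmetric]) auto
qed

lemma AE_finite: "AE \<omega> in M. Itot \<omega> = ennreal (R \<omega>) \<and> 0 < R \<omega> \<and> Ymax \<omega> = ennreal (Y \<omega>)"
  using AE_Itot_finite AE_Itot_pos AE_Ymax_finite
  by eventually_elim (auto simp: R_def Y_def enn2real_positive_iff)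

lemma R_nonneg [simp]: "0 \<le> R \<omega>" and Y_nonneg [simp]: "0 \<le> Y \<omega>"
  by (simp_all add: R_def Y_def)

abbreviation "LR \<equiv> distr M borel R"
abbreviation "LY \<equiv> distr M borel Y"

lemma W_AE:
  assumes "0 \<le> k" "0 \<le> r"
  shows "AE \<omega> in M. W k (thr r) \<omega> = exp (- (k * R \<omega>)) * indicator {..r} (Y \<omega>)"
  using AE_finite
proof eventually_elim
  case (elim \<omega>)
  then have "nexp (ennreal k * Itot \<omega>) = exp (- (k * R \<omega>))"
    using assms by (simp add: nexp_ennreal flip: ennreal_mult)
  moreover have "indicator {y. y \<le> ennreal r} (Ymax \<omega>) = (indicator {..r} (Y \<omega>) :: real)"
    using elim assms by (simp add: indicator_def)
  ultimately show ?case unfolding W_def nexp_thr[OF assms(2)] by simp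
qed

lemma integral_exp_R: "0 \<le> k \<Longrightarrow> (\<integral>\<^sup>+\<omega>. ennreal (exp (- (k * R \<omega>))) \<partial>M) = ennreal (exp (- (eta * k powr d)))"
proof -
  assume k: "0 \<le> k"
  have "(\<integral>\<^sup>+\<omega>. ennreal (exp (- (k * R \<omega>))) \<partial>M) = (\<integral>\<^sup>+\<omega>. ennreal (nexp (ennreal k * Itot \<omega>)) \<partial>M)"
  proof (rule nn_integral_cong_AE)
    show "AE \<omega> in M. ennreal (exp (- (k * R \<omega>))) = ennreal (nexp (ennreal k * Itot \<omega>))"
      using AE_finite by eventually_elim (use k in \<open>simp add: nexp_ennreal flip: ennreal_mult\<close>)
  qed
  also have "\<dots> = ennreal (\<integral>\<omega>. nexp (ennreal k * Itot \<omega>) \<partial>M)"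
    by (intro nn_integral_eq_integral integrable_const_bound[where B=1]) auto
  finally show ?thesis by (simp add: Laplace_Itot k)
qed

lemma emeasure_LY: "0 \<le> r \<Longrightarrow> emeasure LY {..r} = ennreal (nexp (idle_exponent (thr r)))"
proof -
  assume r: "0 \<le> r"
  have "emeasure LY {..r} = (\<integral>\<^sup>+\<omega>. indicator {..r} (Y \<omega>) \<partial>M)"
    by (subst nn_integral_indicator[symmetric], simp, subst nn_integral_distr) auto
  also have "\<dots> = (\<integral>\<^sup>+\<omega>. ennreal (W 0 (thr r) \<omega>) \<partial>M)"
  proof (rule nn_integral_cong_AE)
    show "AE \<omega> in M. indicator {..r} (Y \<omega>) = ennreal (W 0 (thr r) \<omega>)"
      using W_AE[of 0, OF _ r, simplified] by eventually_elim (simp add: indicator_def)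
  qed
  also have "\<dots> = ennreal (\<integral>\<omega>. W 0 (thr r) \<omega> \<partial>M)"
    by (intro nn_integral_eq_integral W_integrable admissible_thr) (auto simp: W_bounds)
  also have "(\<integral>\<omega>. W 0 (thr r) \<omega> \<partial>M) = nexp (idle_exponent (thr r))"
    by (simp add: integral_W[OF admissible_thr] active_exponent_eq)
  finally show ?thesis .
qed

lemma integral_W_thr:
  assumes k: "0 \<le> k" and r: "0 \<le> r"
  shows "ennreal (\<integral>\<omega>. W k (thr r) \<omega> \<partial>M) = (\<integral>\<^sup>+x. ennreal (exp (- (k * x))) \<partial>LR) * emeasure LY {..r}"
proof -
  have "ennreal (\<integral>\<omega>. W k (thr r) \<omega> \<partial>M) = ennreal (exp (- (eta * k powr d))) * ennreal (nexp (idle_exponent (thr r)))"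
    using eta_pos unfolding integral_W[OF admissible_thr] active_exponent_eq[OF k]
    by (subst nexp_ennreal) (auto simp flip: ennreal_mult')
  then show ?thesis
    by (simp add: emeasure_LY[OF r] nn_integral_distr integral_exp_R[OF k])
qed

lemma LY_neg: "r < 0 \<Longrightarrow> emeasure LY {..r} = 0"
proof -
  assume "r < 0"
  then have "\<not> Y \<omega> \<le> r" for \<omega> using Y_nonneg[of \<omega>] by linarith
  then have "Y -` {..r} \<inter> space M = {}" by auto
  then show ?thesis by (simp add: emeasure_distr)
qed

sublocale LR: real_distribution LR by (rule real_distribution_distr) simp
sublocale LY: real_distribution LY by (rule real_distribution_distr) simp
sublocale LL: pair_prob_space LR LY ..

text \<open>Independence of \<open>R\<close> and \<open>Y\<close> is read off from the factorised
  weights: Laplace transform in \<open>R\<close>, distribution function in \<open>Y\<close>.\<close>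

lemma distr_R_Y: "distr M (borel \<Otimes>\<^sub>M borel) (\<lambda>\<omega>. (R \<omega>, Y \<omega>)) = LR \<Otimes>\<^sub>M LY"
proof (rule distr_pair_Laplace)
  show "finite_measure M" by unfold_locales
  show "finite_measure LR" by (rule LR.finite_measure_axioms)
  show "AE x in LR. 0 \<le> x" by (subst AE_distr_iff) auto
  fix k :: nat and r :: real
  show "(\<integral>\<^sup>+\<omega>. ennreal (exp (- (real k * R \<omega>))) * indicator {..r} (Y \<omega>) \<partial>M)
     = (\<integral>\<^sup>+x. ennreal (exp (- (real k * x))) \<partial>LR) * emeasure LY {..r}"
  proof (cases "0 \<le> r")
    case True
    have "(\<integral>\<^sup>+\<omega>. ennreal (exp (- (real k * R \<omega>))) * indicator {..r} (Y \<omega>) \<partial>M) = (\<integral>\<^sup>+\<omega>. ennreal (W (real k) (thr r) \<omega>) \<partial>M)"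
    proof (rule nn_integral_cong_AE)
      show "AE \<omega> in M. ennreal (exp (- (real k * R \<omega>))) * indicator {..r} (Y \<omega>) = ennreal (W (real k) (thr r) \<omega>)"
        using W_AE[of "real k" r, simplified, OF True] by eventually_elim (simp add: indicator_def)
    qed
    also have "\<dots> = ennreal (\<integral>\<omega>. W (real k) (thr r) \<omega> \<partial>M)"
      by (intro nn_integral_eq_integral W_integrable admissible_thr) (auto simp: W_bounds)
    finally show ?thesis using True by (simp add: integral_W_thr)
  next
    case False
    have "indicator {..r} (Y \<omega>) = (0::ennreal)" for \<omega>
      using False Y_nonneg[of \<omega>] by (auto simp: indicator_def simp del: Y_nonneg)
    then show ?thesis using False by (simp add: LY_neg)
  qed
qed (auto intro: LY.real_distribution_axioms)


section \<open>The Mecke formula via the measure on outcomes and station indices\<close>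

lemma measurable_pair_count:
  assumes "\<And>n. f n \<in> measurable M N"
  shows "(\<lambda>p. f (snd p) (fst p)) \<in> measurable (M \<Otimes>\<^sub>M count_space (UNIV :: nat set)) N"
  by (rule measurable_compose_countable'[where f="\<lambda>n p. f n (fst p)" and g=snd and I=UNIV])
     (use assms in auto)

text \<open>A sum over stations becomes an integral over pairs of an outcome and a station index.
  The power of the counted station is then a measurable function like any other, and its joint law
  with the rest of the network can be identified.\<close>

lemma nn_integral_pair_count:
  assumes [measurable]: "\<And>n. f n \<in> borel_measurable M"
  shows "(\<integral>\<^sup>+p. f (snd p) (fst p) \<partial>(M \<Otimes>\<^sub>M count_space (UNIV :: nat set))) = (\<integral>\<^sup>+\<omega>. (\<Sum>n. f n \<omega>) \<partial>M)"
proof -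
  interpret c: sigma_finite_measure "count_space (UNIV :: nat set)"
    by (rule sigma_finite_measure_count_space)
  have "(\<lambda>p. f (snd p) (fst p)) \<in> borel_measurable (M \<Otimes>\<^sub>M count_space (UNIV :: nat set))"
    by (rule measurable_pair_count[where f=f]) simp
  from c.nn_integral_fst[OF this] show ?thesis
    by (simp add: nn_integral_count_space_nat)
qed

abbreviation "PM \<equiv> M \<Otimes>\<^sub>M count_space (UNIV :: nat set)"

text \<open>Counting the stations with power in \<open>A\<close> and removing the counted one leaves
  the original law of \<open>R\<close> and \<open>Y\<close>, times the mean number \<open>c\<close>
  of such stations. To see this, \<open>Campbell_Laplace\<close> is applied with
  \<open>exp (k * s)\<close> on \<open>A\<close>: this factor takes the counted station out of
  \<open>exp (- (k * R \<omega>))\<close>, and on the right it cancels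
  \<open>exp (- (k * s))\<close>, so that only the mass of \<open>A\<close> is left. The cut-off
  \<open>t\<close> makes \<open>c\<close> finite.\<close>

lemma Mecke_rectangle:
  assumes i: "i \<in> {1..K}" and t: "0 < t" and A [measurable]: "A \<in> sets borel"
  defines "c \<equiv> ennreal (a i) * emeasure (rho d) (A \<inter> {t<..})"
  shows "distr (density PM (\<lambda>p. indicator (A \<inter> {t<..}) (U i (snd p) (fst p)))) (borel \<Otimes>\<^sub>M borel)
            (\<lambda>p. (R (fst p) - U i (snd p) (fst p), Y (fst p)))
       = scale_measure c LR \<Otimes>\<^sub>M LY"
proof (rule distr_pair_Laplace)
  let ?u = "\<lambda>p. U i (snd p) (fst p)"
  let ?D0 = "density PM (\<lambda>p. indicator (A \<inter> {t<..}) (?u p))"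
  define B where "B = A \<inter> {t<..}"
  have [measurable]: "B \<in> sets borel" unfolding B_def by measurable
  define D where "D = density PM (\<lambda>p. indicator B (?u p))"
  have [measurable_cong]: "sets D = sets PM" by (simp add: D_def)
  have Um [measurable]: "?u \<in> borel_measurable PM"
    by (rule measurable_pair_count[where f="U i"]) simp
  have D_int: "(\<integral>\<^sup>+p. f (snd p) (fst p) \<partial>D) = (\<integral>\<^sup>+\<omega>. (\<Sum>n. indicator B (U i n \<omega>) * f n \<omega>) \<partial>M)"
    if [measurable]: "\<And>n. f n \<in> borel_measurable M" for f :: "nat \<Rightarrow> 'w \<Rightarrow> ennreal"
    unfolding D_def
    by (subst nn_integral_density, measurable)
       (rule nn_integral_pair_count[of "\<lambda>n \<omega>. indicator B (U i n \<omega>) * f n \<omega>"], measurable)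
  have c_fin: "c < \<top>"
  proof -
    have "emeasure (rho d) (A \<inter> {t<..}) \<le> emeasure (rho d) {t<..}"
      by (intro emeasure_mono) auto
    then show ?thesis
      using t d by (auto simp: c_def emeasure_rho_Ioi ennreal_mult_less_top intro: le_less_trans)
  qed
  have Camp: "(\<integral>\<^sup>+\<omega>. (\<Sum>n. indicator B (U i n \<omega>) * ennreal (exp (k * U i n \<omega>))) * ennreal (W k g \<omega>) \<partial>M)
      = ennreal (\<integral>\<omega>. W k g \<omega> \<partial>M) * c" if k: "0 \<le> k" and g: "admissible g" for k g
  proof -
    define h where "h s = indicator B s * ennreal (exp (k * s))" for s
    have [measurable]: "h \<in> borel_measurable borel" unfolding h_def by measurable
    have "(\<integral>\<^sup>+\<omega>. (\<Sum>n. h (U i n \<omega>)) * ennreal (W k g \<omega>) \<partial>M)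
       = ennreal (\<integral>\<omega>. W k g \<omega> \<partial>M) * (ennreal (a i) * (\<integral>\<^sup>+s. h s * ennreal (exp (- (k * s))) \<partial>rho d))"
      by (rule Campbell_Laplace[OF i k g]) (use t in \<open>auto simp: h_def B_def\<close>)
    also have "(\<integral>\<^sup>+s. h s * ennreal (exp (- (k * s))) \<partial>rho d) = (\<integral>\<^sup>+s. indicator B s \<partial>rho d)"
      by (intro nn_integral_cong) (simp add: h_def indicator_def flip: ennreal_mult' exp_add)
    finally show ?thesis by (simp add: h_def c_def B_def)
  qed
  have D_space: "emeasure D (space D) = c"
  proof -
    have "emeasure D (space D) = (\<integral>\<^sup>+p. 1 \<partial>D)" by simp
    also have "\<dots> = (\<integral>\<^sup>+\<omega>. (\<Sum>n. indicator B (U i n \<omega>)) \<partial>M)"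
      using D_int[of "\<lambda>_ _. 1"] by simp
    also have "\<dots> = c"
      using Camp[of 0, OF _ admissible_0] by (simp add: W_def prob_space)
    finally show ?thesis .
  qed
  show "finite_measure ?D0"
    unfolding B_def[symmetric] D_def[symmetric] by (intro finite_measureI) (use D_space c_fin in auto)
  show "(\<lambda>p. R (fst p) - ?u p) \<in> borel_measurable ?D0"
    by measurable
  show "(\<lambda>p. Y (fst p)) \<in> borel_measurable ?D0"
    by measurable
  show "AE p in ?D0. 0 \<le> R (fst p) - ?u p"
  proof -
    \<comment> \<open>Each power is at most the total. The almost sure statement passes from
      outcomes to pairs through the integral of the indicator of its failure.\<close>
    have "AE p in PM. 0 \<le> R (fst p) - ?u p"
    proof -
      have "AE \<omega> in M. \<forall>n. U i n \<omega> \<le> R \<omega>"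
        using AE_finite
      proof eventually_elim
        case (elim \<omega>)
        show ?case
        proof
          fix n
          have "ennreal (U i n \<omega>) \<le> (\<Sum>n. ennreal (U i n \<omega>))"
            using sum_le_suminf[of "\<lambda>n. ennreal (U i n \<omega>)" "{n}"] by simp
          also have "\<dots> \<le> Itot \<omega>"
            unfolding Itot_def using i by (intro member_le_sum) auto
          finally show "U i n \<omega> \<le> R \<omega>" using elim by (simp add: ennreal_le_iff)
        qed
      qed
      then have "AE \<omega> in M. (\<Sum>n. indicator {x. 0 < x} (U i n \<omega> - R \<omega>)) = (0::ennreal)"
        by eventually_elim (simp add: indicator_def not_le[symmetric])
      then have "(\<integral>\<^sup>+\<omega>. (\<Sum>n. indicator {x. 0 < x} (U i n \<omega> - R \<omega>)) \<partial>M) = 0"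
        by (subst nn_integral_0_iff_AE) auto
      then have "(\<integral>\<^sup>+p. indicator {x. 0 < x} (?u p - R (fst p)) \<partial>PM) = 0"
        by (subst nn_integral_pair_count[of "\<lambda>n \<omega>. indicator {x. 0 < x} (U i n \<omega> - R \<omega>)"]) auto
      then show ?thesis
        by (subst (asm) nn_integral_0_iff_AE) (auto simp: indicator_def not_less)
    qed
    then show ?thesis by (subst AE_density) auto
  qed
  have "emeasure LR UNIV = 1" using LR.emeasure_space_1 by simp
  then show "finite_measure (scale_measure c LR)"
    using c_fin by (intro finite_measureI) (simp add: space_scale_measure)
  show "AE x in scale_measure c LR. 0 \<le> x"
    by (intro AE_scale_measureI) (subst AE_distr_iff, auto)
  show "real_distribution LY" by (rule LY.real_distribution_axioms)
  fix k :: nat and r :: real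
  show "(\<integral>\<^sup>+p. ennreal (exp (- (real k * (R (fst p) - ?u p)))) * indicator {..r} (Y (fst p))
        \<partial>?D0)
     = (\<integral>\<^sup>+x. ennreal (exp (- (real k * x))) \<partial>scale_measure c LR) * emeasure LY {..r}"
    unfolding B_def[symmetric] D_def[symmetric]
  proof (cases "0 \<le> r")
    case True
    have "(\<integral>\<^sup>+p. ennreal (exp (- (real k * (R (fst p) - ?u p)))) * indicator {..r} (Y (fst p)) \<partial>D)
      = (\<integral>\<^sup>+\<omega>. (\<Sum>n. indicator B (U i n \<omega>) * (ennreal (exp (- (real k * (R \<omega> - U i n \<omega>)))) * indicator {..r} (Y \<omega>))) \<partial>M)"
      by (rule D_int) measurable
    also have "\<dots> = (\<integral>\<^sup>+\<omega>. (\<Sum>n. indicator B (U i n \<omega>) * ennreal (exp (real k * U i n \<omega>))) * ennreal (W (real k) (thr r) \<omega>) \<partial>M)"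
    proof (rule nn_integral_cong_AE)
      show "AE \<omega> in M. (\<Sum>n. indicator B (U i n \<omega>) * (ennreal (exp (- (real k * (R \<omega> - U i n \<omega>)))) * indicator {..r} (Y \<omega>)))
        = (\<Sum>n. indicator B (U i n \<omega>) * ennreal (exp (real k * U i n \<omega>))) * ennreal (W (real k) (thr r) \<omega>)"
        using W_AE[of "real k" r, simplified, OF True]
      proof eventually_elim
        case (elim \<omega>)
        have "ennreal (exp (- (real k * (R \<omega> - x)))) * indicator {..r} (Y \<omega>)
            = ennreal (exp (real k * x)) * ennreal (W (real k) (thr r) \<omega>)" for x
          unfolding elim
          by (simp add: indicator_def algebra_simps flip: ennreal_mult' exp_add)
        then show ?case by (simp only: ennreal_suminf_multc[symmetric] mult.assoc)
      qed
    qed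
    also have "\<dots> = ennreal (\<integral>\<omega>. W (real k) (thr r) \<omega> \<partial>M) * c"
      by (rule Camp) (auto intro: admissible_thr)
    finally show "(\<integral>\<^sup>+p. ennreal (exp (- (real k * (R (fst p) - ?u p)))) * indicator {..r} (Y (fst p)) \<partial>D)
      = (\<integral>\<^sup>+x. ennreal (exp (- (real k * x))) \<partial>scale_measure c LR) * emeasure LY {..r}"
      using True by (simp add: integral_W_thr nn_integral_scale_measure mult_ac)
  next
    case False
    have "indicator {..r} (Y \<omega>) = (0::ennreal)" for \<omega>
      using False Y_nonneg[of \<omega>] by (auto simp: indicator_def simp del: Y_nonneg)
    then show "(\<integral>\<^sup>+p. ennreal (exp (- (real k * (R (fst p) - ?u p)))) * indicator {..r} (Y (fst p)) \<partial>D)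
      = (\<integral>\<^sup>+x. ennreal (exp (- (real k * x))) \<partial>scale_measure c LR) * emeasure LY {..r}"
      using False by (simp add: LY_neg)
  qed
qed auto

text \<open>The previous lemma fixes the joint law of the counted power, the remaining interference
  and the idle maximum on rectangles, hence as a product measure, for powers above \<open>t\<close>.
  Letting \<open>t\<close> decrease to 0 along \<open>1 / Suc j\<close> covers all stations of
  positive power.\<close>

theorem Mecke:
  assumes i: "i \<in> {1..K}"
    and [measurable]: "\<phi> \<in> borel_measurable (borel \<Otimes>\<^sub>M (borel \<Otimes>\<^sub>M borel))"
  shows "(\<integral>\<^sup>+\<omega>. (\<Sum>n. indicator {0<..} (U i n \<omega>) * \<phi> (U i n \<omega>, R \<omega> - U i n \<omega>, Y \<omega>)) \<partial>M)
       = ennreal (a i) * (\<integral>\<^sup>+s. \<integral>\<^sup>+z. \<phi> (s, z) \<partial>(LR \<Otimes>\<^sub>M LY) \<partial>rho d)"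
proof -
  let ?u = "\<lambda>p. U i (snd p) (fst p)" and ?LL = "LR \<Otimes>\<^sub>M LY" and ?b = "borel :: real measure"
  let ?v = "\<lambda>p. (R (fst p) - ?u p, Y (fst p))"
  have [measurable]: "?u \<in> borel_measurable PM"
    by (rule measurable_pair_count[where f="U i"]) simp
  have count: "(\<integral>\<^sup>+p. indicator {t<..} (?u p) * \<phi> (?u p, ?v p) \<partial>PM)
      = (\<integral>\<^sup>+\<omega>. (\<Sum>n. indicator {t<..} (U i n \<omega>) * \<phi> (U i n \<omega>, R \<omega> - U i n \<omega>, Y \<omega>)) \<partial>M)" for t
    by (rule nn_integral_pair_count[of "\<lambda>n \<omega>. indicator {t<..} (U i n \<omega>) * \<phi> (U i n \<omega>, R \<omega> - U i n \<omega>, Y \<omega>)"])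
       measurable
  have fixed: "(\<integral>\<^sup>+p. indicator {t<..} (?u p) * \<phi> (?u p, ?v p) \<partial>PM)
      = ennreal (a i) * (\<integral>\<^sup>+s. indicator {t<..} s * (\<integral>\<^sup>+z. \<phi> (s, z) \<partial>?LL) \<partial>rho d)" if t: "0 < t" for t
  proof -
    define T where "T p = (?u p, ?v p)" for p
    have [measurable]: "T \<in> PM \<rightarrow>\<^sub>M ?b \<Otimes>\<^sub>M (?b \<Otimes>\<^sub>M ?b)" unfolding T_def by measurable
    define M1 where "M1 = density (rho d) (\<lambda>s. ennreal (a i) * indicator {t<..} s)"
    define Q where "Q = distr (density PM (\<lambda>p. indicator {t<..} (?u p))) (?b \<Otimes>\<^sub>M (?b \<Otimes>\<^sub>M ?b)) T"
    have Q_int: "(\<integral>\<^sup>+z. f z \<partial>Q) = (\<integral>\<^sup>+p. indicator {t<..} (?u p) * f (T p) \<partial>PM)"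
      if [measurable]: "f \<in> borel_measurable (?b \<Otimes>\<^sub>M (?b \<Otimes>\<^sub>M ?b))" for f
      unfolding Q_def by (simp add: nn_integral_distr nn_integral_density)
    have M1A: "emeasure M1 A = ennreal (a i) * emeasure (rho d) (A \<inter> {t<..})" if [measurable]: "A \<in> sets borel" for A
    proof -
      have "emeasure M1 A = (\<integral>\<^sup>+s. ennreal (a i) * indicator (A \<inter> {t<..}) s \<partial>rho d)"
        unfolding M1_def
        by (subst emeasure_density) (auto intro!: nn_integral_cong simp: indicator_def)
      then show ?thesis by (simp add: nn_integral_cmult)
    qed
    have "emeasure M1 UNIV < \<top>"
      using M1A[of UNIV] d t by (simp add: emeasure_rho_Ioi ennreal_mult_less_top)
    then have "finite_measure M1" by (intro finite_measureI) (simp add: M1_def)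
    then have sf: "sigma_finite_measure M1" by (simp add: finite_measure_def)
    have "M1 \<Otimes>\<^sub>M ?LL = Q"
    proof (rule pair_measure_eqI[OF sf])
      show "sigma_finite_measure ?LL" by unfold_locales
      show "sets (M1 \<Otimes>\<^sub>M ?LL) = sets Q"
        unfolding Q_def M1_def by (simp cong: sets_pair_measure_cong)
      fix A B assume "A \<in> sets M1" "B \<in> sets ?LL"
      then have A [measurable]: "A \<in> sets borel" and B [measurable]: "B \<in> sets (?b \<Otimes>\<^sub>M ?b)"
        by (auto simp: M1_def cong: sets_pair_measure_cong)
      let ?D = "density PM (\<lambda>p. indicator (A \<inter> {t<..}) (?u p))" and ?c = "emeasure M1 A"
      have [measurable_cong]: "sets (scale_measure ?c LR) = sets borel" by simp
      have "emeasure Q (A \<times> B) = (\<integral>\<^sup>+z. indicator (A \<times> B) z \<partial>Q)"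
        by (rule nn_integral_indicator[symmetric]) (simp add: Q_def)
      also have "\<dots> = (\<integral>\<^sup>+p. indicator {t<..} (?u p) * indicator (A \<times> B) (T p) \<partial>PM)"
        by (rule Q_int) measurable
      also have "\<dots> = (\<integral>\<^sup>+p. indicator (A \<inter> {t<..}) (?u p) * indicator B (?v p) \<partial>PM)"
        by (intro nn_integral_cong) (auto simp: T_def indicator_def)
      also have "\<dots> = (\<integral>\<^sup>+p. indicator B (?v p) \<partial>?D)"
        by (rule nn_integral_density[symmetric]) measurable
      also have "\<dots> = (\<integral>\<^sup>+z. indicator B z \<partial>distr ?D (?b \<Otimes>\<^sub>M ?b) ?v)"
        by (rule nn_integral_distr[symmetric]) measurable
      also have "\<dots> = (\<integral>\<^sup>+z. indicator B z \<partial>(scale_measure ?c LR \<Otimes>\<^sub>M LY))"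
        by (simp only: Mecke_rectangle[OF i t A] M1A[OF A])
      also have "\<dots> = (\<integral>\<^sup>+x. \<integral>\<^sup>+y. indicator B (x, y) \<partial>LY \<partial>scale_measure ?c LR)"
        by (rule LY.nn_integral_fst[symmetric]) measurable
      also have "\<dots> = ?c * (\<integral>\<^sup>+x. \<integral>\<^sup>+y. indicator B (x, y) \<partial>LY \<partial>LR)"
        by (rule nn_integral_scale_measure) measurable
      also have "(\<integral>\<^sup>+x. \<integral>\<^sup>+y. indicator B (x, y) \<partial>LY \<partial>LR) = (\<integral>\<^sup>+z. indicator B z \<partial>?LL)"
        by (rule LY.nn_integral_fst) measurable
      also have "\<dots> = emeasure ?LL B" by (rule nn_integral_indicator) measurable
      finally show "?c * emeasure ?LL B = emeasure Q (A \<times> B)" by simp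
    qed
    then have "(\<integral>\<^sup>+p. indicator {t<..} (?u p) * \<phi> (?u p, ?v p) \<partial>PM) = (\<integral>\<^sup>+z. \<phi> z \<partial>(M1 \<Otimes>\<^sub>M ?LL))"
      using Q_int[of \<phi>] by (simp add: T_def)
    also have "\<dots> = (\<integral>\<^sup>+s. \<integral>\<^sup>+z. \<phi> (s, z) \<partial>?LL \<partial>M1)"
      by (rule LL.nn_integral_fst[symmetric]) (simp add: M1_def)
    also have "\<dots> = (\<integral>\<^sup>+s. ennreal (a i) * indicator {t<..} s * (\<integral>\<^sup>+z. \<phi> (s, z) \<partial>?LL) \<partial>rho d)"
      unfolding M1_def by (rule nn_integral_density) measurable
    also have "\<dots> = ennreal (a i) * (\<integral>\<^sup>+s. indicator {t<..} s * (\<integral>\<^sup>+z. \<phi> (s, z) \<partial>?LL) \<partial>rho d)"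
      unfolding mult.assoc by (rule nn_integral_cmult) measurable
    finally show ?thesis .
  qed
  have L1: "(\<lambda>j. ennreal (a i) * (\<integral>\<^sup>+s. indicator {1 / real (Suc j)<..} s * (\<integral>\<^sup>+z. \<phi> (s, z) \<partial>?LL) \<partial>rho d))
      \<longlonglongrightarrow> (\<integral>\<^sup>+p. indicator {0<..} (?u p) * \<phi> (?u p, ?v p) \<partial>PM)"
    by (subst fixed[symmetric], simp, rule nn_integral_trunc_LIMSEQ) measurable
  have L2: "(\<lambda>j. ennreal (a i) * (\<integral>\<^sup>+s. indicator {1 / real (Suc j)<..} s * (\<integral>\<^sup>+z. \<phi> (s, z) \<partial>?LL) \<partial>rho d))
      \<longlonglongrightarrow> ennreal (a i) * (\<integral>\<^sup>+s. indicator {0<..} s * (\<integral>\<^sup>+z. \<phi> (s, z) \<partial>?LL) \<partial>rho d)"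
    by (intro ennreal_tendsto_cmult nn_integral_trunc_LIMSEQ) measurable
  have E: "(\<integral>\<^sup>+s. indicator {0<..} s * (\<integral>\<^sup>+z. \<phi> (s, z) \<partial>?LL) \<partial>rho d) = (\<integral>\<^sup>+s. \<integral>\<^sup>+z. \<phi> (s, z) \<partial>?LL \<partial>rho d)"
    using AE_rho_pos[of d] by (intro nn_integral_cong_AE) (auto elim!: eventually_mono)
  show ?thesis using LIMSEQ_unique[OF L1 L2] unfolding count E .
qed

end

section \<open>Coverage and interference moments\<close>

text \<open>The Lagrange remainder of the Taylor polynomial is
  \<open>exp t / fact N * (- u) ^ N\<close>, whose sign is decided by the parity of
  \<open>N\<close>.\<close>

lemma exp_alternating:
  fixes u :: real
  assumes "0 \<le> u"
  shows "even N \<Longrightarrow> (\<Sum>n<N. (- u) ^ n / fact n) \<le> exp (- u)"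
    and "odd N \<Longrightarrow> exp (- u) \<le> (\<Sum>n<N. (- u) ^ n / fact n)"
proof -
  obtain t where t: "exp (- u) = (\<Sum>n<N. (- u) ^ n / fact n) + exp t / fact N * (- u) ^ N"
    using Maclaurin_exp_le[of "- u" N] by blast
  show "even N \<Longrightarrow> (\<Sum>n<N. (- u) ^ n / fact n) \<le> exp (- u)"
    unfolding t by (simp add: zero_le_even_power)
  show "odd N \<Longrightarrow> exp (- u) \<le> (\<Sum>n<N. (- u) ^ n / fact n)"
    unfolding t using assms by (simp add: mult_nonneg_nonpos power_minus_odd)
qed

context shot_noise
begin

section \<open>Negative moments of the interference and the idle void probability\<close>

lemma AE_R_pos: "AE \<omega> in M. 0 < R \<omega>"
  using AE_finite by (rule eventually_mono) simp

lemma AE_LR_pos: "AE x in LR. 0 < x"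
  by (subst AE_distr_iff) (use AE_R_pos in auto)

lemma emeasure_LR_nonpos: "emeasure LR {..0} = 0"
  using AE_LR_pos by (subst (asm) AE_iff_measurable[OF _ refl]) (auto simp: not_less atMost_def)

text \<open>A negative power is a Gamma integral: \<open>Gamma q * R powr (- q)\<close> is the
  integral of \<open>u powr (q - 1) * exp (- (R * u))\<close>. Fubini inserts the Laplace transform
  of \<open>R\<close> and leaves a stretched exponential integral. The Gamma integral needs a
  positive \<open>q\<close>, so \<open>n = 0\<close> is separate.\<close>

lemma R_moment:
  "(\<integral>\<^sup>+\<omega>. ennreal (R \<omega> powr (- (real n * d))) \<partial>M) = ennreal (fact n / (Gamma (1 + real n * d) * eta ^ n))"
proof (cases n)
  case 0
  have "(\<integral>\<^sup>+\<omega>. ennreal (R \<omega> powr 0) \<partial>M) = (\<integral>\<^sup>+\<omega>. 1 \<partial>M)"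
    by (intro nn_integral_cong_AE) (use AE_R_pos in \<open>auto elim!: eventually_mono\<close>)
  then show ?thesis using 0 by (simp add: emeasure_space_1)
next
  case (Suc m)
  define q where "q = real n * d"
  have q: "0 < q" using Suc d by (simp add: q_def)
  have G: "0 < Gamma q" using q by (rule Gamma_real_pos)
  have "ennreal (Gamma q) * (\<integral>\<^sup>+\<omega>. ennreal (R \<omega> powr (- q)) \<partial>M) = (\<integral>\<^sup>+\<omega>. ennreal (Gamma q * R \<omega> powr (- q)) \<partial>M)"
    using G by (simp add: nn_integral_cmult ennreal_mult')
  also have "\<dots> = (\<integral>\<^sup>+\<omega>. \<integral>\<^sup>+u. ennreal (u powr (q - 1) * exp (- (R \<omega> * u))) * indicator {0<..} u \<partial>lborel \<partial>M)"
    by (intro nn_integral_cong_AE)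
       (use AE_R_pos in \<open>auto elim!: eventually_mono simp: nn_integral_Gamma_scaled[OF q]\<close>)
  also have "\<dots> = (\<integral>\<^sup>+u. \<integral>\<^sup>+\<omega>. ennreal (u powr (q - 1) * exp (- (R \<omega> * u))) * indicator {0<..} u \<partial>M \<partial>lborel)"
  proof -
    interpret pair_sigma_finite M lborel ..
    show ?thesis by (rule Fubini'[symmetric]) measurable
  qed
  also have "\<dots> = (\<integral>\<^sup>+u. ennreal (u powr (real (Suc m) * d - 1) * exp (- (eta * u powr d))) * indicator {0<..} u \<partial>lborel)"
  proof (rule nn_integral_cong)
    fix u :: real
    show "(\<integral>\<^sup>+\<omega>. ennreal (u powr (q - 1) * exp (- (R \<omega> * u))) * indicator {0<..} u \<partial>M)
       = ennreal (u powr (real (Suc m) * d - 1) * exp (- (eta * u powr d))) * indicator {0<..} u"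
    proof (cases "0 < u")
      case True
      have "(\<integral>\<^sup>+\<omega>. ennreal (u powr (q - 1) * exp (- (R \<omega> * u))) * indicator {0<..} u \<partial>M)
         = (\<integral>\<^sup>+\<omega>. ennreal (u powr (q - 1)) * ennreal (exp (- (u * R \<omega>))) \<partial>M)"
        using True by (intro nn_integral_cong) (simp add: mult.commute flip: ennreal_mult')
      also have "\<dots> = ennreal (u powr (q - 1)) * ennreal (exp (- (eta * u powr d)))"
        using True by (simp add: nn_integral_cmult integral_exp_R)
      finally show ?thesis using True Suc by (simp add: q_def flip: ennreal_mult')
    qed simp
  qed
  also have "\<dots> = ennreal (fact m / (d * eta ^ Suc m))"
    by (rule nn_integral_stretched_exp[OF d(1) eta_pos])
  finally have eq: "ennreal (Gamma q) * (\<integral>\<^sup>+\<omega>. ennreal (R \<omega> powr (- q)) \<partial>M) = ennreal (fact m / (d * eta ^ Suc m))" .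
  have "(\<integral>\<^sup>+\<omega>. ennreal (R \<omega> powr (- q)) \<partial>M)
      = ennreal (1 / Gamma q) * (ennreal (Gamma q) * (\<integral>\<^sup>+\<omega>. ennreal (R \<omega> powr (- q)) \<partial>M))"
    using G by (simp flip: mult.assoc ennreal_mult')
  also have "\<dots> = ennreal (1 / Gamma q * (fact m / (d * eta ^ Suc m)))"
    unfolding eq using G by (intro ennreal_mult'[symmetric]) simp
  also have "1 / Gamma q * (fact m / (d * eta ^ Suc m)) = fact n / (Gamma (1 + q) * eta ^ n)"
  proof -
    have "Gamma (q + 1) = q * Gamma q"
      using q by (intro Gamma_plus1) (auto simp: nonpos_Ints_def)
    then have G1: "Gamma (1 + q) = real n * d * Gamma q" by (simp add: add.commute q_def)
    have fact_n: "fact n = real n * fact m" using Suc by simp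
    have "real n \<noteq> 0" "d \<noteq> 0" "Gamma q \<noteq> 0" "eta ^ n \<noteq> 0" using Suc d G eta_pos by auto
    then show ?thesis unfolding G1 fact_n Suc[symmetric] by (simp add: divide_simps)
  qed
  finally show ?thesis by (simp add: q_def)
qed

text \<open>The conditional probability, given interference \<open>r\<close>, that no idle station
  covers.\<close>

definition void :: "real \<Rightarrow> real" where "void r = exp (- (idle_const * r powr (- d)))"

lemma void_measurable [measurable]: "void \<in> borel_measurable borel"
  unfolding void_def by measurable

text \<open>The outage event asks for strict inequality, whereas the distribution function is known
  for closed half-lines. Approximation from below and continuity of \<open>void\<close> bridge the
  gap.\<close>

lemma emeasure_LY_less:
  assumes r: "0 < r"
  shows "emeasure LY {..<r} = ennreal (void r)"
proof (rule LIMSEQ_unique)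
  \<comment> \<open>The double successor keeps \<open>t 0 = r / 2\<close> positive, as
    \<open>idle_exponent_eq\<close> requires.\<close>
  define t where "t j = r - r / real (Suc (Suc j))" for j
  have t: "0 < t j" "t j < r" for j using r by (auto simp: t_def field_simps intro!: add_pos_nonneg)
  have U: "{..<r} = (\<Union>j. {..t j})"
  proof (safe, rule ccontr)
    fix x assume x: "x < r" "x \<notin> (\<Union>j. {..t j})"
    have "t \<longlonglongrightarrow> r" unfolding t_def by real_asymp
    then have "\<forall>\<^sub>F j in sequentially. x < t j" using x(1) by (rule order_tendstoD)
    then obtain j where "x < t j" by (auto simp: eventually_sequentially)
    then show False using x(2) by (auto intro: less_imp_le)
  qed (use t(2) in \<open>auto intro: le_less_trans\<close>)
  have "incseq (\<lambda>j. {..t j})"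
    using r by (intro incseq_SucI) (auto simp: t_def frac_le intro: order_trans)
  then have "(\<lambda>j. emeasure LY {..t j}) \<longlonglongrightarrow> emeasure LY (\<Union>j. {..t j})"
    by (intro Lim_emeasure_incseq) auto
  then show "(\<lambda>j. emeasure LY {..t j}) \<longlonglongrightarrow> emeasure LY {..<r}" by (simp only: U)
  have "emeasure LY {..t j} = ennreal (void (t j))" for j
    using t[of j] idle_const_nonneg by (simp add: emeasure_LY less_imp_le idle_exponent_eq void_def nexp_ennreal)
  moreover have "(\<lambda>j. void (t j)) \<longlonglongrightarrow> void r"
    unfolding void_def
  proof (intro tendsto_intros)
    show "t \<longlonglongrightarrow> r" unfolding t_def by real_asymp
  qed (use r in auto)
  ultimately show "(\<lambda>j. emeasure LY {..t j}) \<longlonglongrightarrow> ennreal (void r)"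
    by (simp add: tendsto_ennrealI)
qed

lemma integral_LL:
  assumes [measurable]: "G \<in> borel_measurable (borel \<Otimes>\<^sub>M borel)"
  shows "(\<integral>\<^sup>+z. G z \<partial>(LR \<Otimes>\<^sub>M LY)) = (\<integral>\<^sup>+x. \<integral>\<^sup>+y. G (x, y) \<partial>LY \<partial>LR)"
  by (rule LY.nn_integral_fst[symmetric]) measurable

lemma measurable_less_indicator [measurable]:
  "(\<lambda>z. indicator {..<fst z} (snd z) :: ennreal) \<in> borel_measurable (borel \<Otimes>\<^sub>M (borel :: real measure))"
  unfolding indicator_def lessThan_iff by measurable

lemma void_idle: "(\<integral>\<^sup>+\<omega>. indicator {..<R \<omega>} (Y \<omega>) \<partial>M) = (\<integral>\<^sup>+\<omega>. ennreal (void (R \<omega>)) \<partial>M)"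
proof -
  have "(\<integral>\<^sup>+\<omega>. indicator {..<R \<omega>} (Y \<omega>) \<partial>M) = (\<integral>\<^sup>+z. indicator {..<fst z} (snd z) \<partial>(LR \<Otimes>\<^sub>M LY))"
    by (subst distr_R_Y[symmetric], subst nn_integral_distr) auto
  also have "\<dots> = (\<integral>\<^sup>+x. \<integral>\<^sup>+y. indicator {..<x} y \<partial>LY \<partial>LR)"
    by (subst integral_LL) auto
  also have "\<dots> = (\<integral>\<^sup>+x. ennreal (void x) \<partial>LR)"
    by (intro nn_integral_cong_AE) (use AE_LR_pos in \<open>auto elim!: eventually_mono simp: emeasure_LY_less\<close>)
  finally show ?thesis by (simp add: nn_integral_distr)
qed

section \<open>Covering active stations\<close>

text \<open>Here \<open>R \<omega> - u\<close> is the interference from all stations other than the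
  counted one. The condition on the ratio is multiplied out, so no denominator has to be
  nonzero.\<close>

definition Cov :: "nat \<Rightarrow> 'w \<Rightarrow> ennreal" where
  "Cov i \<omega> = (\<Sum>n. indicator {u. 0 < u \<and> \<beta> i * (R \<omega> - u) \<le> u} (U i n \<omega>))"

lemma Cov_measurable [measurable]: "Cov i \<in> borel_measurable M"
  unfolding Cov_def by measurable

text \<open>After the counted station is split off, the total is \<open>x + s\<close> with
  \<open>x\<close> the power of the others, and covering means
  \<open>\<beta> i * x \<le> s\<close>.\<close>

lemma Mecke_Cov:
  assumes i: "i \<in> {1..K}" and [measurable]: "\<psi> \<in> borel_measurable (borel \<Otimes>\<^sub>M borel)"
  shows "(\<integral>\<^sup>+\<omega>. Cov i \<omega> * \<psi> (R \<omega>, Y \<omega>) \<partial>M)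
     = ennreal (a i) * (\<integral>\<^sup>+s. \<integral>\<^sup>+x. indicator {\<beta> i * x..} s * (\<integral>\<^sup>+y. \<psi> (x + s, y) \<partial>LY) \<partial>LR \<partial>rho d)"
proof -
  define \<phi> where "\<phi> z = indicator {\<beta> i * fst (snd z)..} (fst z) * \<psi> (fst (snd z) + fst z, snd (snd z))"
    for z :: "real \<times> real \<times> real"
  have [measurable]: "\<phi> \<in> borel_measurable (borel \<Otimes>\<^sub>M (borel \<Otimes>\<^sub>M borel))"
    unfolding \<phi>_def indicator_def atLeast_iff by measurable
  have "(\<integral>\<^sup>+\<omega>. Cov i \<omega> * \<psi> (R \<omega>, Y \<omega>) \<partial>M)
      = (\<integral>\<^sup>+\<omega>. (\<Sum>n. indicator {0<..} (U i n \<omega>) * \<phi> (U i n \<omega>, R \<omega> - U i n \<omega>, Y \<omega>)) \<partial>M)"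
    by (intro nn_integral_cong, unfold Cov_def, subst ennreal_suminf_multc[symmetric], intro suminf_cong)
       (auto simp: \<phi>_def indicator_def)
  also have "\<dots> = ennreal (a i) * (\<integral>\<^sup>+s. \<integral>\<^sup>+z. \<phi> (s, z) \<partial>(LR \<Otimes>\<^sub>M LY) \<partial>rho d)"
    by (rule Mecke[OF i]) measurable
  also have "(\<integral>\<^sup>+s. \<integral>\<^sup>+z. \<phi> (s, z) \<partial>(LR \<Otimes>\<^sub>M LY) \<partial>rho d)
      = (\<integral>\<^sup>+s. \<integral>\<^sup>+x. indicator {\<beta> i * x..} s * (\<integral>\<^sup>+y. \<psi> (x + s, y) \<partial>LY) \<partial>LR \<partial>rho d)"
  proof (rule nn_integral_cong)
    fix s :: real
    have "(\<integral>\<^sup>+z. \<phi> (s, z) \<partial>(LR \<Otimes>\<^sub>M LY)) = (\<integral>\<^sup>+x. \<integral>\<^sup>+y. \<phi> (s, x, y) \<partial>LY \<partial>LR)"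
      by (rule integral_LL) measurable
    also have "\<dots> = (\<integral>\<^sup>+x. indicator {\<beta> i * x..} s * (\<integral>\<^sup>+y. \<psi> (x + s, y) \<partial>LY) \<partial>LR)"
    proof (rule nn_integral_cong)
      fix x :: real
      have "(\<lambda>y. \<psi> (x + s, y)) \<in> borel_measurable LY" by measurable
      then show "(\<integral>\<^sup>+y. \<phi> (s, x, y) \<partial>LY) = indicator {\<beta> i * x..} s * (\<integral>\<^sup>+y. \<psi> (x + s, y) \<partial>LY)"
        unfolding \<phi>_def fst_conv snd_conv by (rule nn_integral_cmult)
    qed
    finally show "(\<integral>\<^sup>+z. \<phi> (s, z) \<partial>(LR \<Otimes>\<^sub>M LY)) = (\<integral>\<^sup>+x. indicator {\<beta> i * x..} s * (\<integral>\<^sup>+y. \<psi> (x + s, y) \<partial>LY) \<partial>LR)" .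
  qed
  finally show ?thesis .
qed

text \<open>In the Mecke formula the idle maximum is integrated separately from \<open>x\<close> and
  \<open>s\<close>, so it may be averaged out at fixed total \<open>x + s\<close> even in the
  presence of the count.\<close>

lemma void_Cov:
  assumes i: "i \<in> {1..K}"
  shows "(\<integral>\<^sup>+\<omega>. Cov i \<omega> * indicator {..<R \<omega>} (Y \<omega>) \<partial>M) = (\<integral>\<^sup>+\<omega>. Cov i \<omega> * ennreal (void (R \<omega>)) \<partial>M)"
proof -
  have "(\<integral>\<^sup>+\<omega>. Cov i \<omega> * indicator {..<R \<omega>} (Y \<omega>) \<partial>M)
      = ennreal (a i) * (\<integral>\<^sup>+s. \<integral>\<^sup>+x. indicator {\<beta> i * x..} s * (\<integral>\<^sup>+y. indicator {..<x + s} y \<partial>LY) \<partial>LR \<partial>rho d)"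
    using Mecke_Cov[OF i measurable_less_indicator] by simp
  also have "\<dots> = ennreal (a i) * (\<integral>\<^sup>+s. \<integral>\<^sup>+x. indicator {\<beta> i * x..} s * ennreal (void (x + s)) \<partial>LR \<partial>rho d)"
  proof (intro arg_cong[where f="(*) (ennreal (a i))"] nn_integral_cong_AE AE_mp[OF AE_rho_pos AE_I2] impI AE_mp[OF AE_LR_pos AE_I2])
    fix s x :: real assume "0 < s" "0 < x"
    then have "(\<integral>\<^sup>+y. indicator {..<x + s} y \<partial>LY) = ennreal (void (x + s))"
      using emeasure_LY_less[of "x + s"] by simp
    then show "indicator {\<beta> i * x..} s * (\<integral>\<^sup>+y. indicator {..<x + s} y \<partial>LY) = indicator {\<beta> i * x..} s * ennreal (void (x + s))"
      by simp
  qed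
  also have "\<dots> = (\<integral>\<^sup>+\<omega>. Cov i \<omega> * ennreal (void (R \<omega>)) \<partial>M)"
    using Mecke_Cov[OF i, of "\<lambda>z. ennreal (void (fst z))"] LY.emeasure_space_1 by simp
  finally show ?thesis .
qed

text \<open>At \<open>n = 0\<close> the value 1 is that of the hypergeometric series with second
  parameter 0.\<close>

definition hyp_factor :: "nat \<Rightarrow> real \<Rightarrow> real" where
  "hyp_factor n z = (if n = 0 then 1 else hyp2F1 1 (real n * d) (1 + real (Suc n) * d) (1 / (1 + z)) / (1 + z) powr (real n * d))"

definition cov_moment :: "nat \<Rightarrow> nat \<Rightarrow> real" where
  "cov_moment n i = a i * \<beta> i powr (- d) * hyp_factor n (\<beta> i) * fact n / (Gamma (1 + real (Suc n) * d) * eta ^ Suc n)"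

text \<open>For given power \<open>x\<close> of the others, integrating out the covering power
  yields a constant times \<open>x powr (- (real (Suc n) * d))\<close>. Thus the moment of order
  \<open>n\<close> weighted by the count becomes the plain moment of order \<open>Suc n\<close>,
  which explains the shifted Gamma factor and the additional power of \<open>eta\<close>.\<close>

lemma Cov_moment:
  assumes i: "i \<in> {1..K}"
  shows "(\<integral>\<^sup>+\<omega>. Cov i \<omega> * ennreal (R \<omega> powr (- (real n * d))) \<partial>M) = ennreal (cov_moment n i)"
proof -
  interpret rho: sigma_finite_measure "rho d" by (rule sigma_finite_rho)
  interpret pair_sigma_finite "rho d" LR ..
  define c where "c = \<beta> i powr (- d) / real (Suc n) * hyp_factor n (\<beta> i)"
  have "(\<integral>\<^sup>+\<omega>. Cov i \<omega> * ennreal (R \<omega> powr (- (real n * d))) \<partial>M)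
     = ennreal (a i) * (\<integral>\<^sup>+s. \<integral>\<^sup>+x. indicator {\<beta> i * x..} s * ennreal ((x + s) powr (- (real n * d))) \<partial>LR \<partial>rho d)"
    using Mecke_Cov[OF i, of "\<lambda>z. ennreal (fst z powr (- (real n * d)))"] LY.emeasure_space_1 by simp
  also have "(\<integral>\<^sup>+s. \<integral>\<^sup>+x. indicator {\<beta> i * x..} s * ennreal ((x + s) powr (- (real n * d))) \<partial>LR \<partial>rho d)
     = (\<integral>\<^sup>+x. \<integral>\<^sup>+s. indicator {\<beta> i * x..} s * ennreal ((x + s) powr (- (real n * d))) \<partial>rho d \<partial>LR)"
    by (rule Fubini'[symmetric]) (simp add: indicator_def)
  also have "\<dots> = (\<integral>\<^sup>+x. ennreal c * ennreal (x powr (- (real (Suc n) * d))) \<partial>LR)"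
  proof (intro nn_integral_cong_AE AE_mp[OF AE_LR_pos AE_I2] impI)
    fix x :: real assume x: "0 < x"
    have "(\<integral>\<^sup>+s. indicator {\<beta> i * x..} s * ennreal ((x + s) powr (- (real n * d))) \<partial>rho d)
      = ennreal (x powr (- (real (Suc n) * d)) * \<beta> i powr (- d) / real (Suc n) * hyp_factor n (\<beta> i))"
      using nn_integral_rho_covered[OF d(1) \<beta>[OF i] x, of n] by (simp only: hyp_factor_def mult.commute)
    also have "x powr (- (real (Suc n) * d)) * \<beta> i powr (- d) / real (Suc n) * hyp_factor n (\<beta> i)
       = c * x powr (- (real (Suc n) * d))" by (simp add: c_def)
    finally show "(\<integral>\<^sup>+s. indicator {\<beta> i * x..} s * ennreal ((x + s) powr (- (real n * d))) \<partial>rho d)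
      = ennreal c * ennreal (x powr (- (real (Suc n) * d)))" by (simp add: ennreal_mult'')
  qed
  also have "\<dots> = ennreal c * (\<integral>\<^sup>+\<omega>. ennreal (R \<omega> powr (- (real (Suc n) * d))) \<partial>M)"
    by (simp add: nn_integral_cmult nn_integral_distr)
  also have "\<dots> = ennreal c * ennreal (fact (Suc n) / (Gamma (1 + real (Suc n) * d) * eta ^ Suc n))"
    by (simp only: R_moment)
  also have "ennreal (a i) * \<dots> = ennreal (a i * (c * (fact (Suc n) / (Gamma (1 + real (Suc n) * d) * eta ^ Suc n))))"
  proof -
    have "0 \<le> fact (Suc n) / (Gamma (1 + real (Suc n) * d) * eta ^ Suc n)"
      using eta_pos d by (intro divide_nonneg_nonneg mult_nonneg_nonneg less_imp_le[OF Gamma_real_pos] zero_le_power add_pos_nonneg) auto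
    then show ?thesis using a[OF i] by (simp only: ennreal_mult' ennreal_mult'')
  qed
  also have "a i * (c * (fact (Suc n) / (Gamma (1 + real (Suc n) * d) * eta ^ Suc n))) = cov_moment n i"
    by (simp only: c_def cov_moment_def fact_Suc of_nat_mult) (simp add: divide_simps)
  finally show ?thesis .
qed

text \<open>By the Mecke formula, the interference without the counted station again has law
  \<open>LR\<close>, which gives no mass to \<open>{..0}\<close>. So almost surely no station is the
  only source of power, and the denominators in the event are positive.\<close>

lemma AE_less_R: "AE \<omega> in M. \<forall>i\<in>{1..K}. \<forall>n. 0 < U i n \<omega> \<longrightarrow> U i n \<omega> < R \<omega>"
proof -
  have "AE \<omega> in M. \<forall>n. 0 < U i n \<omega> \<longrightarrow> U i n \<omega> < R \<omega>" if i: "i \<in> {1..K}" for i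
  proof -
    have "(\<integral>\<^sup>+z. indicator {..0} (fst z) \<partial>(LR \<Otimes>\<^sub>M LY)) = 0"
      using LY.emeasure_space_1 emeasure_LR_nonpos by (subst integral_LL) auto
    then have "(\<integral>\<^sup>+\<omega>. (\<Sum>n. indicator {0<..} (U i n \<omega>) * indicator {..0} (R \<omega> - U i n \<omega>)) \<partial>M) = 0"
      using Mecke[OF i, of "\<lambda>z. indicator {..0} (fst (snd z))"] by simp
    then have "AE \<omega> in M. (\<Sum>n. indicator {0<..} (U i n \<omega>) * indicator {..0} (R \<omega> - U i n \<omega>)) = (0::ennreal)"
      by (subst (asm) nn_integral_0_iff_AE) auto
    then show ?thesis
      by eventually_elim (auto simp: suminf_eq_zero_iff indicator_def split: if_splits)
  qed
  then show ?thesis by (subst AE_ball_countable) auto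
qed

lemma pair_le_Itot:
  assumes "i \<in> {1..K}" "i' \<in> {1..K}" "(i, n) \<noteq> (i', n')"
  shows "ennreal (U i n \<omega>) + ennreal (U i' n' \<omega>) \<le> Itot \<omega>"
proof (cases "i = i'")
  case True
  then have "n \<noteq> n'" using assms by simp
  then have "ennreal (U i n \<omega>) + ennreal (U i n' \<omega>) \<le> (\<Sum>n. ennreal (U i n \<omega>))"
    using sum_le_suminf[of "\<lambda>n. ennreal (U i n \<omega>)" "{n, n'}"] by simp
  also have "\<dots> \<le> Itot \<omega>"
    unfolding Itot_def using assms by (intro member_le_sum) auto
  finally show ?thesis using True by simp
next
  case False
  have "ennreal (U i n \<omega>) + ennreal (U i' n' \<omega>) \<le> (\<Sum>n. ennreal (U i n \<omega>)) + (\<Sum>n. ennreal (U i' n \<omega>))"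
    using sum_le_suminf[of "\<lambda>n. ennreal (U i n \<omega>)" "{n}"] sum_le_suminf[of "\<lambda>n. ennreal (U i' n \<omega>)" "{n'}"]
    by (intro add_mono) auto
  also have "\<dots> = (\<Sum>i\<in>{i, i'}. \<Sum>n. ennreal (U i n \<omega>))" using False by simp
  also have "\<dots> \<le> Itot \<omega>" unfolding Itot_def using assms by (intro sum_mono2) auto
  finally show ?thesis .
qed

text \<open>
  Since all thresholds exceed 1, a covering station contributes more than half of the total power,
  so there is at most one.
\<close>

lemma AE_Cov:
  "AE \<omega> in M. (\<Sum>i=1..K. Cov i \<omega>) =
     indicator {\<omega>. \<exists>i\<in>{1..K}. \<exists>n. 0 < U i n \<omega> \<and> \<beta> i * (R \<omega> - U i n \<omega>) \<le> U i n \<omega>} \<omega>"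
  using AE_finite AE_less_R
proof eventually_elim
  case (elim \<omega>)
  define P where "P i n \<longleftrightarrow> 0 < U i n \<omega> \<and> \<beta> i * (R \<omega> - U i n \<omega>) \<le> U i n \<omega>" for i n
  have half: "R \<omega> < 2 * U i n \<omega>" if "i \<in> {1..K}" "P i n" for i n
  proof -
    have "0 < R \<omega> - U i n \<omega>" using elim that by (auto simp: P_def)
    then have "1 * (R \<omega> - U i n \<omega>) < \<beta> i * (R \<omega> - U i n \<omega>)"
      using \<beta>_gt_1[OF that(1)] by (intro mult_strict_right_mono) auto
    then show ?thesis using that(2) by (simp add: P_def)
  qed
  have unique: "(i, n) = (i', n')" if "i \<in> {1..K}" "P i n" "i' \<in> {1..K}" "P i' n'" for i n i' n'
  proof (rule ccontr)
    assume "(i, n) \<noteq> (i', n')"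
    then have "ennreal (U i n \<omega>) + ennreal (U i' n' \<omega>) \<le> ennreal (R \<omega>)"
      using pair_le_Itot[of i i' n n' \<omega>] that elim by simp
    moreover have "0 < U i n \<omega>" "0 < U i' n' \<omega>" using that by (auto simp: P_def)
    ultimately have "U i n \<omega> + U i' n' \<omega> \<le> R \<omega>"
      by (simp add: ennreal_le_iff flip: ennreal_plus)
    then show False using half[OF that(1,2)] half[OF that(3,4)] by simp
  qed
  have Cov_eq: "Cov i \<omega> = (\<Sum>n. of_bool (P i n))" for i
    by (simp add: Cov_def P_def indicator_def)
  show ?case
  proof (cases "\<exists>i\<in>{1..K}. \<exists>n. P i n")
    case True
    then obtain i0 n0 where i0: "i0 \<in> {1..K}" "P i0 n0" by blast
    have "Cov i \<omega> = of_bool (i = i0)" if "i \<in> {1..K}" for i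
    proof -
      have "P i n \<longleftrightarrow> i = i0 \<and> n = n0" for n
        using unique[OF that _ i0, of n] i0 by blast
      then have "(\<Sum>n. of_bool (P i n) :: ennreal) = (\<Sum>n\<in>{n0}. of_bool (i = i0 \<and> n = n0))"
        by (simp only:) (rule suminf_finite, auto)
      also have "\<dots> = of_bool (i = i0)" by simp
      finally show ?thesis by (simp add: Cov_eq)
    qed
    then have "(\<Sum>i=1..K. Cov i \<omega>) = (\<Sum>i=1..K. of_bool (i = i0))" by (intro sum.cong) auto
    also have "\<dots> = 1" using i0 by (simp add: sum.delta of_bool_def)
    finally show ?thesis using True by (simp add: P_def)
  next
    case False
    then have "(\<Sum>i=1..K. Cov i \<omega>) = 0" by (simp add: Cov_eq)
    then show ?thesis using False by (simp add: P_def)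
  qed
qed

section \<open>The event that no active station covers, and its weighted moments\<close>

definition uncov :: "'w \<Rightarrow> real" where
  "uncov \<omega> = indicator {\<omega>. \<forall>i\<in>{1..K}. \<forall>n. \<not> (0 < U i n \<omega> \<and> \<beta> i * (R \<omega> - U i n \<omega>) \<le> U i n \<omega>)} \<omega>"

lemma uncov_measurable [measurable]: "uncov \<in> borel_measurable M"
  unfolding uncov_def indicator_def by measurable

lemma uncov_bounds: "0 \<le> uncov \<omega>" "uncov \<omega> \<le> 1"
  by (auto simp: uncov_def indicator_def)

text \<open>Almost surely \<open>uncov\<close> is one minus the number of covering stations. The
  identity is stated as a sum because the integrals may be infinite, where subtraction in
  \<open>ennreal\<close> is unsafe.\<close>

lemma nn_integral_uncov:
  assumes [measurable]: "f \<in> borel_measurable M"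
  shows "(\<integral>\<^sup>+\<omega>. f \<omega> * ennreal (uncov \<omega>) \<partial>M) + (\<Sum>i=1..K. \<integral>\<^sup>+\<omega>. Cov i \<omega> * f \<omega> \<partial>M) = (\<integral>\<^sup>+\<omega>. f \<omega> \<partial>M)"
proof -
  have "(\<Sum>i=1..K. \<integral>\<^sup>+\<omega>. Cov i \<omega> * f \<omega> \<partial>M) = (\<integral>\<^sup>+\<omega>. (\<Sum>i=1..K. Cov i \<omega>) * f \<omega> \<partial>M)"
    by (simp add: nn_integral_sum[symmetric] sum_distrib_right)
  then have "(\<integral>\<^sup>+\<omega>. f \<omega> * ennreal (uncov \<omega>) \<partial>M) + (\<Sum>i=1..K. \<integral>\<^sup>+\<omega>. Cov i \<omega> * f \<omega> \<partial>M)
      = (\<integral>\<^sup>+\<omega>. f \<omega> * ennreal (uncov \<omega>) + (\<Sum>i=1..K. Cov i \<omega>) * f \<omega> \<partial>M)"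
    by (simp add: nn_integral_add)
  also have "\<dots> = (\<integral>\<^sup>+\<omega>. f \<omega> \<partial>M)"
  proof (rule nn_integral_cong_AE)
    show "AE \<omega> in M. f \<omega> * ennreal (uncov \<omega>) + (\<Sum>i=1..K. Cov i \<omega>) * f \<omega> = f \<omega>"
      using AE_Cov
    proof eventually_elim
      case (elim \<omega>)
      define P where "P \<longleftrightarrow> (\<exists>i\<in>{1..K}. \<exists>n. 0 < U i n \<omega> \<and> \<beta> i * (R \<omega> - U i n \<omega>) \<le> U i n \<omega>)"
      have "(\<Sum>i=1..K. Cov i \<omega>) = (if P then 1 else 0)" unfolding elim by (simp add: P_def)
      moreover have "uncov \<omega> = (if P then 0 else 1)" by (auto simp: uncov_def P_def indicator_def)
      ultimately show ?case by (simp only:) simp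
    qed
  qed
  finally show ?thesis .
qed

definition uncov_moment :: "nat \<Rightarrow> real" where
  "uncov_moment n = fact n / (Gamma (1 + real n * d) * eta ^ n) - (\<Sum>i=1..K. cov_moment n i)"

text \<open>The right side of \<open>nn_integral_uncov\<close> is a finite moment, so every summand
  is finite and the covering part can be subtracted in the reals.\<close>

lemma R_powr_uncov:
  shows "integrable M (\<lambda>\<omega>. R \<omega> powr (- (real n * d)) * uncov \<omega>)"
    and "(\<integral>\<omega>. R \<omega> powr (- (real n * d)) * uncov \<omega> \<partial>M) = uncov_moment n"
proof -
  let ?f = "\<lambda>\<omega>. ennreal (R \<omega> powr (- (real n * d)))"
  let ?I = "\<integral>\<^sup>+\<omega>. ennreal (R \<omega> powr (- (real n * d)) * uncov \<omega>) \<partial>M"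
  have eq: "?I + (\<Sum>i=1..K. ennreal (cov_moment n i)) = ennreal (fact n / (Gamma (1 + real n * d) * eta ^ n))"
    using nn_integral_uncov[of ?f] by (simp add: Cov_moment R_moment ennreal_mult'' uncov_bounds)
  have fin: "?I < \<top>"
  proof -
    have "?I \<le> ?I + (\<Sum>i=1..K. ennreal (cov_moment n i))" by simp
    also have "\<dots> < \<top>" unfolding eq by simp
    finally show ?thesis .
  qed
  show int: "integrable M (\<lambda>\<omega>. R \<omega> powr (- (real n * d)) * uncov \<omega>)"
    using fin by (intro integrableI_nonneg) (auto simp: uncov_bounds)
  \<comment> \<open>Nonnegativity allows the \<open>ennreal\<close> terms to be merged into one; for
    the hypergeometric factor it follows from the series with nonnegative coefficients.\<close>
  have cm: "0 \<le> cov_moment n i" if i: "i \<in> {1..K}" for i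
  proof -
    have "0 \<le> hyp_factor n (\<beta> i)"
    proof (cases "n = 0")
      case False
      have "0 \<le> hyp2F1 1 (real n * d) (1 + real (Suc n) * d) (1 / (1 + \<beta> i))"
      proof (rule sums_le[OF _ sums_zero hyp2F1_1_sums])
        show "0 \<le> hyp_coeff (real n * d) (1 + real (Suc n) * d) k * (1 / (1 + \<beta> i)) ^ k" for k
          using False d \<beta>[OF i] by (intro mult_nonneg_nonneg hyp_coeff_nonneg) (auto intro!: add_pos_nonneg)
      qed (use False d \<beta>[OF i] in \<open>auto simp: distrib_right\<close>)
      then show ?thesis using \<beta>[OF i] by (simp add: hyp_factor_def)
    qed (simp add: hyp_factor_def)
    moreover have "0 \<le> Gamma (1 + real (Suc n) * d)"
      using d by (intro less_imp_le[OF Gamma_real_pos] add_pos_nonneg) auto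
    ultimately show ?thesis
      unfolding cov_moment_def using a[OF i] eta_pos
      by (intro divide_nonneg_nonneg mult_nonneg_nonneg) auto
  qed
  have nn: "?I = ennreal (\<integral>\<omega>. R \<omega> powr (- (real n * d)) * uncov \<omega> \<partial>M)"
    by (intro nn_integral_eq_integral int) (auto simp: uncov_bounds)
  have ge0: "0 \<le> (\<integral>\<omega>. R \<omega> powr (- (real n * d)) * uncov \<omega> \<partial>M)"
    by (intro integral_nonneg_AE) (auto simp: uncov_bounds)
  have "0 \<le> fact n / (Gamma (1 + real n * d) * eta ^ n)"
    using d eta_pos by (intro divide_nonneg_nonneg mult_nonneg_nonneg less_imp_le[OF Gamma_real_pos] add_pos_nonneg zero_le_power) auto
  moreover have s: "0 \<le> (\<Sum>i=1..K. cov_moment n i)" using cm by (intro sum_nonneg) auto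
  moreover have "ennreal ((\<integral>\<omega>. R \<omega> powr (- (real n * d)) * uncov \<omega> \<partial>M) + (\<Sum>i=1..K. cov_moment n i))
      = ennreal (fact n / (Gamma (1 + real n * d) * eta ^ n))"
    unfolding eq[symmetric] nn ennreal_plus[OF ge0 s] using cm by (subst sum_ennreal) auto
  ultimately have "(\<integral>\<omega>. R \<omega> powr (- (real n * d)) * uncov \<omega> \<partial>M) + (\<Sum>i=1..K. cov_moment n i)
      = fact n / (Gamma (1 + real n * d) * eta ^ n)"
    using ge0 by (subst (asm) ennreal_inj) auto
  then show "(\<integral>\<omega>. R \<omega> powr (- (real n * d)) * uncov \<omega> \<partial>M) = uncov_moment n"
    by (simp add: uncov_moment_def)
qed

text \<open>This averages out the idle stations. By \<open>void_idle\<close> and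
  \<open>void_Cov\<close>, both integrals are completed by the same sum over covering stations to
  the same total; this total is finite, so the sum can be cancelled.\<close>

lemma integral_uncov_void:
  "(\<integral>\<omega>. indicator {..<R \<omega>} (Y \<omega>) * uncov \<omega> \<partial>M) = (\<integral>\<omega>. void (R \<omega>) * uncov \<omega> \<partial>M)"
proof -
  let ?A = "\<integral>\<^sup>+\<omega>. indicator {..<R \<omega>} (Y \<omega>) * ennreal (uncov \<omega>) \<partial>M"
  let ?B = "\<integral>\<^sup>+\<omega>. ennreal (void (R \<omega>)) * ennreal (uncov \<omega>) \<partial>M"
  let ?C = "\<Sum>i=1..K. \<integral>\<^sup>+\<omega>. Cov i \<omega> * ennreal (void (R \<omega>)) \<partial>M"
  have m1: "(\<lambda>\<omega>. indicator {..<R \<omega>} (Y \<omega>) :: ennreal) \<in> borel_measurable M"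
    unfolding indicator_def lessThan_iff by measurable
  have A: "?A + ?C = (\<integral>\<^sup>+\<omega>. ennreal (void (R \<omega>)) \<partial>M)"
    using nn_integral_uncov[OF m1] by (simp add: void_Cov void_idle)
  have B: "?B + ?C = (\<integral>\<^sup>+\<omega>. ennreal (void (R \<omega>)) \<partial>M)"
    by (rule nn_integral_uncov) measurable
  have void: "0 \<le> void r" "void r \<le> 1" for r using idle_const_nonneg by (auto simp: void_def)
  have "(\<integral>\<^sup>+\<omega>. ennreal (void (R \<omega>)) \<partial>M) \<le> (\<integral>\<^sup>+\<omega>. 1 \<partial>M)"
    using void by (intro nn_integral_mono) (simp flip: ennreal_1)
  then have "(\<integral>\<^sup>+\<omega>. ennreal (void (R \<omega>)) \<partial>M) < \<top>"
    by (simp add: emeasure_space_1 le_less_trans[of _ 1])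
  moreover have "?C \<le> ?B + ?C" by (rule add_increasing) simp_all
  ultimately have "?C < \<top>" unfolding B by (rule le_less_trans[rotated])
  then have "?A = ?B" using ennreal_add_left_cancel[of ?C ?A ?B] A B by (simp only: add.commute[of ?C] infinity_ennreal_def less_irrefl simp_thms) auto
  then have "(\<integral>\<^sup>+\<omega>. ennreal (indicator {..<R \<omega>} (Y \<omega>) * uncov \<omega>) \<partial>M) = (\<integral>\<^sup>+\<omega>. ennreal (void (R \<omega>) * uncov \<omega>) \<partial>M)"
    by (simp add: ennreal_mult'' uncov_bounds ennreal_indicator)
  moreover have "(\<lambda>\<omega>. indicator {..<R \<omega>} (Y \<omega>) :: real) \<in> borel_measurable M"
    unfolding indicator_def lessThan_iff by measurable
  ultimately show ?thesis
    by (simp add: integral_eq_nn_integral uncov_bounds void)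
qed

lemma AE_taylor:
  "AE \<omega> in M. (\<Sum>n<N. (- (idle_const * R \<omega> powr (- d))) ^ n / fact n) * uncov \<omega>
      = (\<Sum>n<N. (- idle_const) ^ n / fact n * (R \<omega> powr (- (real n * d)) * uncov \<omega>))"
  using AE_R_pos
proof eventually_elim
  case (elim \<omega>)
  have "(- (idle_const * R \<omega> powr (- d))) ^ n = (- idle_const) ^ n * R \<omega> powr (- (real n * d))" for n
  proof -
    have "(R \<omega> powr (- d)) ^ n = R \<omega> powr (- (real n * d))"
      using elim by (simp add: powr_power mult.commute)
    then show ?thesis by (metis mult_minus_left power_mult_distrib)
  qed
  then show ?case by (simp add: sum_distrib_right mult.assoc)
qed

lemma integral_taylor:
  shows "integrable M (\<lambda>\<omega>. (\<Sum>n<N. (- (idle_const * R \<omega> powr (- d))) ^ n / fact n) * uncov \<omega>)"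
    and "(\<integral>\<omega>. (\<Sum>n<N. (- (idle_const * R \<omega> powr (- d))) ^ n / fact n) * uncov \<omega> \<partial>M)
       = (\<Sum>n<N. (- idle_const) ^ n / fact n * uncov_moment n)"
proof -
  let ?g = "\<lambda>\<omega>. \<Sum>n<N. (- idle_const) ^ n / fact n * (R \<omega> powr (- (real n * d)) * uncov \<omega>)"
  have g: "integrable M ?g"
    by (intro Bochner_Integration.integrable_sum integrable_mult_right R_powr_uncov)
  show "integrable M (\<lambda>\<omega>. (\<Sum>n<N. (- (idle_const * R \<omega> powr (- d))) ^ n / fact n) * uncov \<omega>)"
    by (rule integrable_cong_AE_imp[OF g]) (use AE_taylor[of N] in \<open>auto elim!: eventually_mono\<close>)
  have "(\<integral>\<omega>. (\<Sum>n<N. (- (idle_const * R \<omega> powr (- d))) ^ n / fact n) * uncov \<omega> \<partial>M) = (\<integral>\<omega>. ?g \<omega> \<partial>M)"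
    using AE_taylor[of N] by (intro integral_cong_AE) auto
  also have "\<dots> = (\<Sum>n<N. \<integral>\<omega>. (- idle_const) ^ n / fact n * (R \<omega> powr (- (real n * d)) * uncov \<omega>) \<partial>M)"
    by (intro Bochner_Integration.integral_sum integrable_mult_right R_powr_uncov)
  also have "\<dots> = (\<Sum>n<N. (- idle_const) ^ n / fact n * uncov_moment n)"
    by (intro sum.cong refl) (simp only: integral_mult_right_zero R_powr_uncov)
  finally show "(\<integral>\<omega>. (\<Sum>n<N. (- (idle_const * R \<omega> powr (- d))) ^ n / fact n) * uncov \<omega> \<partial>M)
       = (\<Sum>n<N. (- idle_const) ^ n / fact n * uncov_moment n)" .
qed

text \<open>Given the interference, the number of covering idle stations is Poisson with mean
  \<open>idle_const * R \<omega> powr (- d)\<close>, so up to sign the Taylor terms are the expected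
  numbers of sets of \<open>n\<close> such stations. The pointwise bounds survive multiplication by
  \<open>uncov\<close>, which is nonnegative.\<close>

lemma Bonferroni:
  shows "even N \<Longrightarrow> (\<Sum>n<N. (- idle_const) ^ n / fact n * uncov_moment n) \<le> (\<integral>\<omega>. indicator {..<R \<omega>} (Y \<omega>) * uncov \<omega> \<partial>M)"
    and "odd N \<Longrightarrow> (\<integral>\<omega>. indicator {..<R \<omega>} (Y \<omega>) * uncov \<omega> \<partial>M) \<le> (\<Sum>n<N. (- idle_const) ^ n / fact n * uncov_moment n)"
proof -
  have int: "integrable M (\<lambda>\<omega>. void (R \<omega>) * uncov \<omega>)"
    by (rule integrable_const_bound[where B=1])
       (auto simp: void_def uncov_bounds abs_mult idle_const_nonneg intro!: mult_le_one)
  have nn: "0 \<le> idle_const * R \<omega> powr (- d)" for \<omega> using idle_const_nonneg by simp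
  show "(\<Sum>n<N. (- idle_const) ^ n / fact n * uncov_moment n) \<le> (\<integral>\<omega>. indicator {..<R \<omega>} (Y \<omega>) * uncov \<omega> \<partial>M)" if "even N"
    unfolding integral_uncov_void integral_taylor(2)[symmetric]
    by (intro integral_mono integral_taylor int mult_right_mono uncov_bounds)
       (unfold void_def, intro exp_alternating(1) nn that)
  show "(\<integral>\<omega>. indicator {..<R \<omega>} (Y \<omega>) * uncov \<omega> \<partial>M) \<le> (\<Sum>n<N. (- idle_const) ^ n / fact n * uncov_moment n)" if "odd N"
    unfolding integral_uncov_void integral_taylor(2)[symmetric]
    by (intro integral_mono integral_taylor int mult_right_mono uncov_bounds)
       (unfold void_def, intro exp_alternating(2) nn that)
qed

end

section \<open>Laplace functionals of Poisson processes\<close>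

lemma (in prob_space) Poisson_pgf:
  fixes N :: "'a \<Rightarrow> nat"
  assumes [measurable]: "N \<in> measurable M (count_space UNIV)"
    and N: "\<And>k. prob {\<omega> \<in> space M. N \<omega> = k} = exp (- m) * m ^ k / fact k"
    and m: "0 \<le> m" and c: "0 \<le> c"
  shows "(\<integral>\<^sup>+\<omega>. ennreal (c ^ N \<omega>) \<partial>M) = ennreal (exp (- (m * (1 - c))))"
proof -
  have "(\<integral>\<^sup>+\<omega>. ennreal (c ^ N \<omega>) \<partial>M) = (\<integral>\<^sup>+\<omega>. (\<Sum>k. ennreal (c ^ k) * indicator {\<omega> \<in> space M. N \<omega> = k} \<omega>) \<partial>M)"
  proof (rule nn_integral_cong)
    fix \<omega> assume "\<omega> \<in> space M"
    then have "(\<Sum>k. ennreal (c ^ k) * indicator {\<omega> \<in> space M. N \<omega> = k} \<omega>)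
        = (\<Sum>k\<in>{N \<omega>}. ennreal (c ^ k) * indicator {\<omega> \<in> space M. N \<omega> = k} \<omega>)"
      by (intro suminf_finite) auto
    then show "ennreal (c ^ N \<omega>) = (\<Sum>k. ennreal (c ^ k) * indicator {\<omega> \<in> space M. N \<omega> = k} \<omega>)"
      using \<open>\<omega> \<in> space M\<close> by simp
  qed
  also have "\<dots> = (\<Sum>k. ennreal (c ^ k) * emeasure M {\<omega> \<in> space M. N \<omega> = k})"
    by (subst nn_integral_suminf) (auto simp: nn_integral_cmult_indicator)
  also have "\<dots> = (\<Sum>k. ennreal (exp (- m) * ((m * c) ^ k / fact k)))"
    using c m by (intro suminf_cong) (simp add: emeasure_eq_measure N power_mult_distrib mult_ac flip: ennreal_mult')
  also have "\<dots> = ennreal (exp (- m) * exp (m * c))"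
  proof (rule suminf_ennreal_eq)
    have "(\<lambda>k. (m * c) ^ k /\<^sub>R fact k) sums exp (m * c)" by (rule exp_converges)
    then show "(\<lambda>k. exp (- m) * ((m * c) ^ k / fact k)) sums (exp (- m) * exp (m * c))"
      by (intro sums_mult) (simp add: divide_inverse mult.commute)
  qed (use m c in simp)
  also have "exp (- m) * exp (m * c) = exp (- (m * (1 - c)))"
    by (simp add: algebra_simps flip: exp_add)
  finally show ?thesis .
qed

lemma simple_function_representation:
  fixes f :: "'a::euclidean_space \<Rightarrow> ennreal"
  assumes f: "simple_function borel f" and fin: "\<And>x. f x < \<top>" and bd: "bounded {x. f x \<noteq> 0}"
  obtains n :: nat and A :: "nat \<Rightarrow> 'a set" and c :: "nat \<Rightarrow> real"
  where "disjoint_family_on A {..<n}" "\<And>i. i < n \<Longrightarrow> A i \<in> sets borel" "\<And>i. i < n \<Longrightarrow> bounded (A i)"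
    "\<And>i. i < n \<Longrightarrow> 0 \<le> c i" "\<And>x. f x = (\<Sum>i<n. ennreal (c i) * indicator (A i) x)"
proof -
  \<comment> \<open>The value 0 is left out: its level set is unbounded, while a Poisson process is
    observed only on bounded sets.\<close>
  define Y where "Y = range f - {0}"
  have "finite Y" using f by (auto simp: Y_def simple_function_def)
  then obtain e where e: "bij_betw e {0..<card Y} Y" using ex_bij_betw_nat_finite by blast
  define n where "n = card Y"
  define A where "A i = f -` {e i}" for i
  have eY: "e i \<in> Y" if "i < n" for i using e that by (auto simp: bij_betw_def n_def)
  have inj: "e i = e j \<Longrightarrow> i = j" if "i < n" "j < n" for i j
    using e that by (auto simp: bij_betw_def n_def inj_on_def)
  show ?thesis
  proof (rule that[of A n "\<lambda>i. enn2real (e i)"])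
    show "disjoint_family_on A {..<n}"
      using inj by (auto simp: disjoint_family_on_def A_def)
    show "A i \<in> sets borel" if "i < n" for i
      using f that eY[OF that] by (auto simp: A_def Y_def simple_function_def)
    show "bounded (A i)" if "i < n" for i
      by (rule bounded_subset[OF bd]) (use eY[OF that] in \<open>auto simp: A_def Y_def\<close>)
    show "0 \<le> enn2real (e i)" for i by simp
    show "f x = (\<Sum>i<n. ennreal (enn2real (e i)) * indicator (A i) x)" for x
    proof (cases "f x = 0")
      case True
      have "x \<notin> A i" if "i < n" for i using True eY[OF that] by (auto simp: A_def Y_def)
      then show ?thesis using True by (simp add: indicator_def)
    next
      case False
      then have "f x \<in> Y" by (simp add: Y_def)
      moreover have "e ` {0..<n} = Y" using e by (simp add: bij_betw_def n_def)
      ultimately obtain i where i: "i < n" "e i = f x" by (metis atLeastLessThan_iff imageE)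
      have "(\<Sum>i<n. ennreal (enn2real (e i)) * indicator (A i) x) = (\<Sum>j<n. if j = i then f x else 0)"
        using i inj fin[of x] by (intro sum.cong) (auto simp: A_def indicator_def)
      then show ?thesis using i by (simp add: sum.delta)
    qed
  qed
qed

text \<open>At most one indicator is nonzero at \<open>x\<close>, so the nonlinear map
  \<open>1 - nexp\<close> acts summand by summand.\<close>

lemma one_minus_nexp_disjoint_sum:
  fixes n :: nat
  assumes A: "disjoint_family_on A {..<n}" and c: "\<And>i. i < n \<Longrightarrow> 0 \<le> c i"
  shows "ennreal (1 - nexp (\<Sum>i<n. ennreal (c i) * indicator (A i) x)) = (\<Sum>i<n. ennreal (1 - exp (- c i)) * indicator (A i) x)"
proof (cases "\<exists>i<n. x \<in> A i")
  case True
  then obtain i where i: "i < n" "x \<in> A i" by blast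
  have j: "x \<in> A j \<longleftrightarrow> j = i" if "j < n" for j
    using A i that by (auto simp: disjoint_family_on_def)
  have "(\<Sum>j<n. ennreal (c j) * indicator (A j) x) = (\<Sum>j<n. if j = i then ennreal (c i) else 0)"
    using j by (intro sum.cong) (auto simp: indicator_def)
  moreover have "(\<Sum>j<n. ennreal (1 - exp (- c j)) * indicator (A j) x) = (\<Sum>j<n. if j = i then ennreal (1 - exp (- c i)) else 0)"
    using j by (intro sum.cong) (auto simp: indicator_def)
  ultimately have "ennreal (1 - nexp (\<Sum>j<n. ennreal (c j) * indicator (A j) x)) = ennreal (1 - nexp (ennreal (c i)))"
    "(\<Sum>j<n. ennreal (1 - exp (- c j)) * indicator (A j) x) = ennreal (1 - exp (- c i))"
    using i by simp_all
  then show ?thesis using i c by (simp only: nexp_ennreal)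
qed (auto simp: indicator_def)

lemma nn_integral_count_space_disjoint_sum:
  fixes n :: nat
  assumes "\<And>i. i < n \<Longrightarrow> finite (S \<inter> A i)"
  shows "(\<integral>\<^sup>+x. (\<Sum>i<n. ennreal (c i) * indicator (A i) x) \<partial>count_space S) = (\<Sum>i<n. ennreal (c i) * of_nat (card (S \<inter> A i)))"
proof -
  have "(\<integral>\<^sup>+x. (\<Sum>i<n. ennreal (c i) * indicator (A i) x) \<partial>count_space S) = (\<Sum>i<n. ennreal (c i) * (\<integral>\<^sup>+x. indicator (A i) x \<partial>count_space S))"
    by (subst nn_integral_sum, simp, subst nn_integral_cmult, simp, simp)
  also have "\<dots> = (\<Sum>i<n. ennreal (c i) * of_nat (card (S \<inter> A i)))"
  proof (intro sum.cong refl arg_cong2[where f="(*)"])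
    fix i assume i: "i \<in> {..<n}"
    have "(\<integral>\<^sup>+x. indicator (A i) x \<partial>count_space S) = (\<integral>\<^sup>+x. indicator (S \<inter> A i) x \<partial>count_space S)"
      by (intro nn_integral_cong) (simp add: indicator_def)
    then show "(\<integral>\<^sup>+x. indicator (A i) x \<partial>count_space S) = of_nat (card (S \<inter> A i))"
      using assms i by simp
  qed
  finally show ?thesis .
qed

lemma nexp_sum_card:
  fixes n :: nat
  assumes "\<And>i. i < n \<Longrightarrow> 0 \<le> c i"
  shows "nexp (\<Sum>i<n. ennreal (c i) * of_nat (k i)) = (\<Prod>i<n. exp (- c i) ^ k i)"
proof -
  have "nexp (ennreal (c i) * of_nat (k i)) = exp (- c i) ^ k i" if "i < n" for i
    using assms[OF that]
    by (simp add: ennreal_of_nat_eq_real_of_nat nexp_ennreal mult.commute flip: ennreal_mult exp_of_nat_mult)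
  then show ?thesis by (simp add: nexp_sum)
qed

section \<open>Laplace functionals of independent Poisson processes\<close>

context prob_space
begin

text \<open>On a simple function the functional is a product, over disjoint sets, of Poisson
  generating functions at \<open>exp (- c i)\<close>. Measurability is recorded for the
  sigma-algebra generated by the counts, because \<open>indep_processes\<close> is a statement about
  these sigma-algebras.\<close>

lemma ppp_simple_Laplace:
  fixes \<Phi> :: "'a \<Rightarrow> 'b::euclidean_space set"
  assumes ppp: "homogeneous_ppp M d \<Phi>" and d: "0 \<le> d"
    and f: "simple_function borel f" "\<And>x. f x < \<top>" "bounded {x. f x \<noteq> 0}"
  shows "(\<integral>\<^sup>+\<omega>. ennreal (nexp (\<integral>\<^sup>+x. f x \<partial>count_space (\<Phi> \<omega>))) \<partial>M)
       = ennreal (nexp (ennreal d * (\<integral>\<^sup>+x. ennreal (1 - nexp (f x)) \<partial>lborel)))"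
    and "(\<lambda>\<omega>. \<integral>\<^sup>+x. f x \<partial>count_space (\<Phi> \<omega>)) \<in>
      borel_measurable (sigma (space M) {{\<omega> \<in> space M. card (\<Phi> \<omega> \<inter> B) = k} | B k. B \<in> sets borel \<and> bounded B})"
proof -
  obtain n :: nat and A c where A: "disjoint_family_on A {..<n}" "\<And>i. i < n \<Longrightarrow> A i \<in> sets borel" "\<And>i. i < n \<Longrightarrow> bounded (A i)"
    and c: "\<And>i. i < n \<Longrightarrow> 0 \<le> c i" and feq: "\<And>x. f x = (\<Sum>i<n. ennreal (c i) * indicator (A i) x)"
    by (rule simple_function_representation[OF f]) (rule that)
  have count: "(\<integral>\<^sup>+x. f x \<partial>count_space (\<Phi> \<omega>)) = (\<Sum>i<n. ennreal (c i) * of_nat (card (\<Phi> \<omega> \<inter> A i)))" if "\<omega> \<in> space M" for \<omega>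
    unfolding feq using ppp A that
    by (intro nn_integral_count_space_disjoint_sum) (auto simp: homogeneous_ppp_def)
  have card_meas [measurable]: "(\<lambda>\<omega>. card (\<Phi> \<omega> \<inter> A i)) \<in> measurable M (count_space UNIV)" if "i < n" for i
    using ppp A that by (auto simp: homogeneous_ppp_def)
  have prob: "prob {\<omega> \<in> space M. card (\<Phi> \<omega> \<inter> A i) = k} = exp (- (d * measure lborel (A i))) * (d * measure lborel (A i)) ^ k / fact k"
    if "i < n" for i k
    using ppp A that by (auto simp: homogeneous_ppp_def)
  have indep: "indep_vars (\<lambda>_. count_space UNIV) (\<lambda>i \<omega>. card (\<Phi> \<omega> \<inter> A i)) {..<n}"
    using ppp A by (auto simp: homogeneous_ppp_def)
  have fin: "emeasure lborel (A i) = ennreal (measure lborel (A i))" if "i < n" for i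
    using emeasure_bounded_finite[OF A(3)[OF that]] by (intro emeasure_eq_ennreal_measure) auto
  have "(\<integral>\<^sup>+\<omega>. ennreal (nexp (\<integral>\<^sup>+x. f x \<partial>count_space (\<Phi> \<omega>))) \<partial>M)
      = (\<integral>\<^sup>+\<omega>. (\<Prod>i<n. ennreal (exp (- c i) ^ card (\<Phi> \<omega> \<inter> A i))) \<partial>M)"
    by (intro nn_integral_cong) (simp add: count nexp_sum_card[OF c] prod_ennreal)
  also have "\<dots> = (\<Prod>i<n. \<integral>\<^sup>+\<omega>. ennreal (exp (- c i) ^ card (\<Phi> \<omega> \<inter> A i)) \<partial>M)"
    by (rule indep_vars_nn_integral) (auto intro!: indep_vars_compose2[OF indep])
  also have "\<dots> = (\<Prod>i<n. ennreal (exp (- (d * measure lborel (A i) * (1 - exp (- c i))))))"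
    using d by (intro prod.cong refl Poisson_pgf card_meas prob) auto
  also have "\<dots> = ennreal (exp (- (\<Sum>i<n. d * measure lborel (A i) * (1 - exp (- c i)))))"
    by (simp add: prod_ennreal exp_sum sum_negf[symmetric])
  also have "\<dots> = ennreal (nexp (ennreal (\<Sum>i<n. d * measure lborel (A i) * (1 - exp (- c i)))))"
    using d c by (subst nexp_ennreal) (auto intro!: sum_nonneg mult_nonneg_nonneg)
  also have "ennreal (\<Sum>i<n. d * measure lborel (A i) * (1 - exp (- c i))) = ennreal d * (\<integral>\<^sup>+x. ennreal (1 - nexp (f x)) \<partial>lborel)"
  proof -
    have "(\<integral>\<^sup>+x. ennreal (1 - nexp (f x)) \<partial>lborel) = (\<integral>\<^sup>+x. (\<Sum>i<n. ennreal (1 - exp (- c i)) * indicator (A i) x) \<partial>lborel)"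
      unfolding feq using A(1) c by (intro nn_integral_cong one_minus_nexp_disjoint_sum)
    also have "\<dots> = (\<Sum>i<n. ennreal (1 - exp (- c i)) * emeasure lborel (A i))"
      using A(2) by (subst nn_integral_sum) (auto simp: nn_integral_cmult_indicator)
    also have "\<dots> = (\<Sum>i<n. ennreal ((1 - exp (- c i)) * measure lborel (A i)))"
      using c by (intro sum.cong refl) (simp add: fin ennreal_mult')
    also have "\<dots> = ennreal (\<Sum>i<n. (1 - exp (- c i)) * measure lborel (A i))"
      using c by (intro sum_ennreal) auto
    finally show ?thesis using d by (simp add: sum_distrib_left mult_ac flip: ennreal_mult')
  qed
  finally show "(\<integral>\<^sup>+\<omega>. ennreal (nexp (\<integral>\<^sup>+x. f x \<partial>count_space (\<Phi> \<omega>))) \<partial>M)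
       = ennreal (nexp (ennreal d * (\<integral>\<^sup>+x. ennreal (1 - nexp (f x)) \<partial>lborel)))" .
  let ?G = "{{\<omega> \<in> space M. card (\<Phi> \<omega> \<inter> B) = k} | B k. B \<in> sets borel \<and> bounded B}"
  have sp: "space (sigma (space M) ?G) = space M" by (rule space_measure_of) auto
  have st: "sets (sigma (space M) ?G) = sigma_sets (space M) ?G" by (rule sets_measure_of) auto
  have "(\<lambda>\<omega>. card (\<Phi> \<omega> \<inter> A i)) \<in> measurable (sigma (space M) ?G) (count_space UNIV)" if "i < n" for i
  proof -
    have "(\<lambda>\<omega>. card (\<Phi> \<omega> \<inter> A i)) -` {k} \<inter> space (sigma (space M) ?G) \<in> sets (sigma (space M) ?G)" for k
    proof -
      have "(\<lambda>\<omega>. card (\<Phi> \<omega> \<inter> A i)) -` {k} \<inter> space M \<in> ?G"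
        using A that by (auto intro!: exI[of _ "A i"] exI[of _ k])
      then show ?thesis unfolding sp st by (rule sigma_sets.Basic)
    qed
    then show ?thesis by (subst measurable_count_space_eq2_countable) auto
  qed
  then have "(\<lambda>\<omega>. \<Sum>i<n. ennreal (c i) * of_nat (card (\<Phi> \<omega> \<inter> A i))) \<in> borel_measurable (sigma (space M) ?G)"
    by (intro borel_measurable_sum borel_measurable_times borel_measurable_const measurable_compose[of _ _ "count_space UNIV" of_nat]) auto
  then show "(\<lambda>\<omega>. \<integral>\<^sup>+x. f x \<partial>count_space (\<Phi> \<omega>)) \<in> borel_measurable (sigma (space M) ?G)"
    by (rule measurable_cong[THEN iffD1, rotated]) (unfold sp, simp add: count)
qed

text \<open>Each factor is measurable for the counts of its own process, so independence of the
  count sigma-algebras makes the factors independent.\<close>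

lemma ppp_simple_Laplace_family:
  fixes \<Theta> :: "'j \<Rightarrow> 'a \<Rightarrow> 'b::euclidean_space set"
  assumes J: "finite J" and indep: "indep_processes M J \<Theta>"
    and ppp: "\<And>j. j \<in> J \<Longrightarrow> homogeneous_ppp M (d j) (\<Theta> j)" and d: "\<And>j. j \<in> J \<Longrightarrow> 0 \<le> d j"
    and f: "\<And>j. simple_function borel (f j)" "\<And>j x. f j x < \<top>" "\<And>j. bounded {x. f j x \<noteq> 0}"
  shows "(\<integral>\<^sup>+\<omega>. ennreal (nexp (\<Sum>j\<in>J. \<integral>\<^sup>+x. f j x \<partial>count_space (\<Theta> j \<omega>))) \<partial>M)
       = ennreal (nexp (\<Sum>j\<in>J. ennreal (d j) * (\<integral>\<^sup>+x. ennreal (1 - nexp (f j x)) \<partial>lborel)))"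
    and "j \<in> J \<Longrightarrow> (\<lambda>\<omega>. \<integral>\<^sup>+x. f j x \<partial>count_space (\<Theta> j \<omega>)) \<in> borel_measurable M"
proof -
  define G where "G j = {{\<omega> \<in> space M. card (\<Theta> j \<omega> \<inter> B) = k} | B k. B \<in> sets borel \<and> bounded B}" for j
  define F where "F j \<omega> = ennreal (nexp (\<integral>\<^sup>+x. f j x \<partial>count_space (\<Theta> j \<omega>)))" for j \<omega>
  have sp: "space (sigma (space M) (G j)) = space M" for j by (rule space_measure_of) (auto simp: G_def)
  have st: "sets (sigma (space M) (G j)) = sigma_sets (space M) (G j)" for j by (rule sets_measure_of) (auto simp: G_def)
  have ind: "indep_sets (\<lambda>j. sigma_sets (space M) (G j)) J"
    using indep by (simp add: indep_processes_def G_def)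
  have Lm: "(\<lambda>\<omega>. \<integral>\<^sup>+x. f j x \<partial>count_space (\<Theta> j \<omega>)) \<in> borel_measurable (sigma (space M) (G j))" if "j \<in> J" for j
    unfolding G_def by (rule ppp_simple_Laplace(2)[OF ppp[OF that] d[OF that] f])
  have sub: "measurable (sigma (space M) (G j)) borel \<subseteq> measurable M borel" if "j \<in> J" for j
    using ind that by (auto simp: measurable_def sp st indep_sets_def)
  then show "j \<in> J \<Longrightarrow> (\<lambda>\<omega>. \<integral>\<^sup>+x. f j x \<partial>count_space (\<Theta> j \<omega>)) \<in> borel_measurable M"
    using Lm by blast
  have Fm: "F j \<in> borel_measurable (sigma (space M) (G j))" if "j \<in> J" for j
    unfolding F_def using Lm[OF that] by measurable
  have "indep_vars (\<lambda>_. borel) F J"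
    unfolding indep_vars_def2
  proof (intro conjI ballI)
    show "F j \<in> borel_measurable M" if "j \<in> J" for j using Fm[OF that] sub[OF that] by blast
    show "indep_sets (\<lambda>i. {F i -` A \<inter> space M |A. A \<in> sets borel}) J"
    proof (rule indep_sets_mono_sets[OF ind])
      fix j assume "j \<in> J"
      from measurable_sets[OF Fm[OF this]]
      show "{F j -` A \<inter> space M |A. A \<in> sets borel} \<subseteq> sigma_sets (space M) (G j)"
        by (auto simp: sp st)
    qed
  qed
  then have "(\<integral>\<^sup>+\<omega>. (\<Prod>j\<in>J. F j \<omega>) \<partial>M) = (\<Prod>j\<in>J. \<integral>\<^sup>+\<omega>. F j \<omega> \<partial>M)"
    using J by (intro indep_vars_nn_integral) auto
  also have "\<dots> = (\<Prod>j\<in>J. ennreal (nexp (ennreal (d j) * (\<integral>\<^sup>+x. ennreal (1 - nexp (f j x)) \<partial>lborel))))"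
    unfolding F_def by (intro prod.cong refl ppp_simple_Laplace(1) ppp d f)
  finally show "(\<integral>\<^sup>+\<omega>. ennreal (nexp (\<Sum>j\<in>J. \<integral>\<^sup>+x. f j x \<partial>count_space (\<Theta> j \<omega>))) \<partial>M)
       = ennreal (nexp (\<Sum>j\<in>J. ennreal (d j) * (\<integral>\<^sup>+x. ennreal (1 - nexp (f j x)) \<partial>lborel)))"
    by (simp add: F_def prod_ennreal nexp_sum[OF J])
qed

text \<open>Simple functions increasing to \<open>f j\<close> are cut off to growing balls, which
  gives them bounded support. The left side converges by dominated convergence, as
  \<open>nexp\<close> is at most 1, and the right side by monotone convergence in the
  exponent.\<close>

lemma ppp_Laplace_family:
  fixes \<Theta> :: "'j \<Rightarrow> 'a \<Rightarrow> 'b::euclidean_space set"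
  assumes J: "finite J" and indep: "indep_processes M J \<Theta>"
    and ppp: "\<And>j. j \<in> J \<Longrightarrow> homogeneous_ppp M (d j) (\<Theta> j)" and d: "\<And>j. j \<in> J \<Longrightarrow> 0 \<le> d j"
    and f: "\<And>j. f j \<in> borel_measurable borel"
  shows "(\<integral>\<^sup>+\<omega>. ennreal (nexp (\<Sum>j\<in>J. \<integral>\<^sup>+x. f j x \<partial>count_space (\<Theta> j \<omega>))) \<partial>M)
       = ennreal (nexp (\<Sum>j\<in>J. ennreal (d j) * (\<integral>\<^sup>+x. ennreal (1 - nexp (f j x)) \<partial>lborel)))"
proof -
  have "\<exists>s. (\<forall>k. simple_function borel (s k)) \<and> incseq s \<and> (\<forall>k x. s k x < \<top>) \<and> (\<forall>x. (SUP k. s k x) = f j x)" for j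
    using borel_measurable_implies_simple_function_sequence'[OF f[of j]] by metis
  then obtain s where s: "\<And>j k. simple_function borel (s j k)" "\<And>j. incseq (s j)" "\<And>j k x. s j k x < \<top>"
      "\<And>j x. (SUP k. s j k x) = f j x" by metis
  define g where "g k j x = s j k x * indicator (ball 0 (real k)) x" for k j x
  have g1: "simple_function borel (g k j)" for k j
    unfolding g_def by (intro simple_function_mult s simple_function_indicator) auto
  have g2: "g k j x < \<top>" for k j x
    using s(3) by (simp add: g_def indicator_def)
  have g3: "bounded {x. g k j x \<noteq> 0}" for k j
    by (rule bounded_subset[OF bounded_ball[of 0 "real k"]]) (auto simp: g_def indicator_def)
  have ginc: "incseq (\<lambda>k. g k j x)" for j x
    using s(2)[of j] by (auto simp: g_def incseq_def le_fun_def indicator_def intro!: mult_mono)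
  have glim: "(\<lambda>k. g k j x) \<longlonglongrightarrow> f j x" for j x
  proof -
    have "incseq (\<lambda>k. s j k x)" using s(2)[of j] by (auto simp: incseq_def le_fun_def)
    from LIMSEQ_SUP[OF this] have "(\<lambda>k. s j k x) \<longlonglongrightarrow> f j x" by (simp add: s(4))
    moreover have "\<forall>\<^sub>F k in sequentially. s j k x = g k j x"
      using eventually_gt_at_top[of "nat \<lceil>norm x\<rceil>"]
      by eventually_elim (auto simp: g_def indicator_def, linarith)
    ultimately show ?thesis by (rule Lim_transform_eventually)
  qed
  have gm: "g k j \<in> borel_measurable borel" for k j
    by (rule borel_measurable_simple_function[OF g1])
  have limL: "(\<lambda>k. \<Sum>j\<in>J. \<integral>\<^sup>+x. g k j x \<partial>count_space (\<Theta> j \<omega>)) \<longlonglongrightarrow> (\<Sum>j\<in>J. \<integral>\<^sup>+x. f j x \<partial>count_space (\<Theta> j \<omega>))" for \<omega>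
    by (intro tendsto_sum nn_integral_LIMSEQ) (use ginc glim in \<open>auto simp: incseq_def le_fun_def\<close>)
  have simple: "(\<integral>\<^sup>+\<omega>. ennreal (nexp (\<Sum>j\<in>J. \<integral>\<^sup>+x. g k j x \<partial>count_space (\<Theta> j \<omega>))) \<partial>M)
       = ennreal (nexp (\<Sum>j\<in>J. ennreal (d j) * (\<integral>\<^sup>+x. ennreal (1 - nexp (g k j x)) \<partial>lborel)))" for k
    using ppp d by (intro ppp_simple_Laplace_family(1)[OF J indep] g1 g2 g3) auto
  have Lm: "(\<lambda>\<omega>. \<Sum>j\<in>J. \<integral>\<^sup>+x. g k j x \<partial>count_space (\<Theta> j \<omega>)) \<in> borel_measurable M" for k
    by (intro borel_measurable_sum ppp_simple_Laplace_family(2)[OF J indep ppp d g1 g2 g3])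
  have Lm': "(\<lambda>\<omega>. \<Sum>j\<in>J. \<integral>\<^sup>+x. f j x \<partial>count_space (\<Theta> j \<omega>)) \<in> borel_measurable M"
    by (rule borel_measurable_LIMSEQ_order[OF limL Lm])
  have "(\<lambda>k. \<integral>\<^sup>+\<omega>. ennreal (nexp (\<Sum>j\<in>J. \<integral>\<^sup>+x. g k j x \<partial>count_space (\<Theta> j \<omega>))) \<partial>M)
     \<longlonglongrightarrow> (\<integral>\<^sup>+\<omega>. ennreal (nexp (\<Sum>j\<in>J. \<integral>\<^sup>+x. f j x \<partial>count_space (\<Theta> j \<omega>))) \<partial>M)"
  proof (rule nn_integral_dominated_convergence[where w="\<lambda>_. 1"])
    show "(\<lambda>\<omega>. ennreal (nexp (\<Sum>j\<in>J. \<integral>\<^sup>+x. g k j x \<partial>count_space (\<Theta> j \<omega>)))) \<in> borel_measurable M" for k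
      using Lm by measurable
    show "(\<lambda>\<omega>. ennreal (nexp (\<Sum>j\<in>J. \<integral>\<^sup>+x. f j x \<partial>count_space (\<Theta> j \<omega>)))) \<in> borel_measurable M"
      using Lm' by measurable
    show "AE \<omega> in M. (\<lambda>k. ennreal (nexp (\<Sum>j\<in>J. \<integral>\<^sup>+x. g k j x \<partial>count_space (\<Theta> j \<omega>))))
       \<longlonglongrightarrow> ennreal (nexp (\<Sum>j\<in>J. \<integral>\<^sup>+x. f j x \<partial>count_space (\<Theta> j \<omega>)))"
      by (intro AE_I2 tendsto_ennrealI tendsto_nexp limL)
  qed (auto simp: emeasure_space_1)
  moreover have "(\<lambda>k. \<integral>\<^sup>+\<omega>. ennreal (nexp (\<Sum>j\<in>J. \<integral>\<^sup>+x. g k j x \<partial>count_space (\<Theta> j \<omega>))) \<partial>M)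
     \<longlonglongrightarrow> ennreal (nexp (\<Sum>j\<in>J. ennreal (d j) * (\<integral>\<^sup>+x. ennreal (1 - nexp (f j x)) \<partial>lborel)))"
    unfolding simple
  proof (intro tendsto_ennrealI tendsto_nexp tendsto_sum ennreal_tendsto_cmult nn_integral_LIMSEQ)
    fix j
    show "incseq (\<lambda>k x. ennreal (1 - nexp (g k j x)))"
      using ginc[of j] by (auto simp: incseq_def le_fun_def intro!: ennreal_leI nexp_antimono)
    show "(\<lambda>k. 1 - nexp (g k j x)) \<longlonglongrightarrow> 1 - nexp (f j x)" for x
      by (intro tendsto_intros tendsto_nexp glim)
    show "(\<lambda>x. ennreal (1 - nexp (g k j x))) \<in> borel_measurable lborel" for k
      using gm by measurable
  qed auto
  ultimately show ?thesis by (rule LIMSEQ_unique)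
qed

end

section \<open>Independent exponential marks\<close>

abbreviation "E1 \<equiv> density lborel (\<lambda>x. ennreal (exponential_density 1 x))"

lemma prob_space_E1: "prob_space E1"
  using prob_space_exponential_density[of 1] by simp

context prob_space
begin

text \<open>\<open>indep_set\<close> contains the assertion that both generated sigma-algebras
  consist of events; measurability of the marks and of the enumeration is extracted from it.\<close>

lemma indep_set_vimage_algebra:
  assumes ind: "indep_set (sets (vimage_algebra (space M) f N)) (sets (vimage_algebra (space M) g L))"
    and f: "f \<in> space M \<rightarrow> space N" and g: "g \<in> space M \<rightarrow> space L"
  shows "f \<in> measurable M N" "g \<in> measurable M L"
    and "distr M N f \<Otimes>\<^sub>M distr M L g = distr M (N \<Otimes>\<^sub>M L) (\<lambda>x. (f x, g x))"
proof -
  have ev: "sets (vimage_algebra (space M) f N) \<subseteq> events" "sets (vimage_algebra (space M) g L) \<subseteq> events"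
    using ind by (auto simp: indep_sets2_eq)
  show fm: "f \<in> measurable M N"
    using ev(1) f by (intro measurableI) (auto intro: in_vimage_algebra)
  show gm: "g \<in> measurable M L"
    using ev(2) g by (intro measurableI) (auto intro: in_vimage_algebra)
  interpret F: prob_space "distr M N f" by (rule prob_space_distr) (rule fm)
  interpret G: prob_space "distr M L g" by (rule prob_space_distr) (rule gm)
  note [measurable] = fm gm
  show "distr M N f \<Otimes>\<^sub>M distr M L g = distr M (N \<Otimes>\<^sub>M L) (\<lambda>x. (f x, g x))"
  proof (rule pair_measure_eqI)
    fix A B assume "A \<in> sets (distr M N f)" "B \<in> sets (distr M L g)"
    then have A [measurable]: "A \<in> sets N" and B [measurable]: "B \<in> sets L" by auto
    have "prob ((f -` A \<inter> space M) \<inter> (g -` B \<inter> space M)) = prob (f -` A \<inter> space M) * prob (g -` B \<inter> space M)"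
      using ind in_vimage_algebra[OF A, of f "space M"] in_vimage_algebra[OF B, of g "space M"]
      by (simp add: indep_sets2_eq)
    moreover have "(\<lambda>x. (f x, g x)) -` (A \<times> B) \<inter> space M = (f -` A \<inter> space M) \<inter> (g -` B \<inter> space M)"
      by auto
    ultimately show "emeasure (distr M N f) A * emeasure (distr M L g) B = emeasure (distr M (N \<Otimes>\<^sub>M L) (\<lambda>x. (f x, g x))) (A \<times> B)"
      by (simp add: emeasure_distr emeasure_eq_measure ennreal_mult')
  qed (auto intro: F.sigma_finite_measure_axioms G.sigma_finite_measure_axioms cong: sets_pair_measure_cong)
qed

text \<open>The distributional clauses of \<open>iid_exponential_marks\<close> for fixed witnesses;
  the clause about the enumeration is kept separate.\<close>

definition exponential_marks ::
    "'j set \<Rightarrow> ('j \<Rightarrow> 'a \<Rightarrow> enat) \<Rightarrow> ('j \<Rightarrow> nat \<Rightarrow> 'a \<Rightarrow> 'b::euclidean_space) \<Rightarrow> ('j \<Rightarrow> nat \<Rightarrow> 'a \<Rightarrow> real) \<Rightarrow> bool"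
  where
  "exponential_marks J N X H \<longleftrightarrow>
     (\<forall>j\<in>J. \<forall>n. distributed M lborel (H j n) (exponential_density 1)) \<and>
     indep_vars (\<lambda>_. borel) (\<lambda>(j, n). H j n) (J \<times> UNIV) \<and>
     indep_set
       (sets (vimage_algebra (space M)
          (\<lambda>\<omega>. \<lambda>(j, n)\<in>J \<times> UNIV. H j n \<omega>)
          (PiM (J \<times> UNIV) (\<lambda>_. borel))))
       (sets (vimage_algebra (space M)
          (\<lambda>\<omega>. (\<lambda>j\<in>J. N j \<omega>, \<lambda>(j, n)\<in>J \<times> UNIV. X j n \<omega>))
          (PiM J (\<lambda>_. count_space UNIV) \<Otimes>\<^sub>M PiM (J \<times> UNIV) (\<lambda>_. borel))))"

text \<open>The marks are independent of all counts and positions, so by Fubini they can be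
  integrated first with the positions frozen. Their mutual independence then splits the integral of
  the product into a product of integrals. Restricting to \<open>n < m\<close> keeps the product
  finite.\<close>

lemma marked_finite_product:
  fixes N :: "'j \<Rightarrow> 'a \<Rightarrow> enat" and X :: "'j \<Rightarrow> nat \<Rightarrow> 'a \<Rightarrow> 'b::euclidean_space" and H :: "'j \<Rightarrow> nat \<Rightarrow> 'a \<Rightarrow> real"
  assumes J: "finite J"
    and marks: "exponential_marks J N X H"
    and v [measurable]: "\<And>j. v j \<in> borel_measurable (borel \<Otimes>\<^sub>M borel)"
  shows "(\<integral>\<^sup>+\<omega>. (\<Prod>(j, n)\<in>J \<times> {..<m}. if enat n < N j \<omega> then v j (X j n \<omega>, H j n \<omega>) else 1) \<partial>M)
       = (\<integral>\<^sup>+\<omega>. (\<Prod>(j, n)\<in>J \<times> {..<m}. if enat n < N j \<omega> then \<integral>\<^sup>+h. v j (X j n \<omega>, h) \<partial>E1 else 1) \<partial>M)"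
    and "j \<in> J \<Longrightarrow> N j \<in> measurable M (count_space UNIV)"
    and "j \<in> J \<Longrightarrow> X j n \<in> borel_measurable M"
    and "j \<in> J \<Longrightarrow> H j n \<in> borel_measurable M"
proof -
  note marks' = marks[unfolded exponential_marks_def]
  have H: "\<And>j n. j \<in> J \<Longrightarrow> distributed M lborel (H j n) (exponential_density 1)" using marks' by blast
  note H_indep = marks'[THEN conjunct2, THEN conjunct1] and indep = marks'[THEN conjunct2, THEN conjunct2]
  define MH :: "('j \<times> nat \<Rightarrow> real) measure" where "MH = PiM (J \<times> UNIV) (\<lambda>_. borel)"
  define MX :: "(('j \<Rightarrow> enat) \<times> ('j \<times> nat \<Rightarrow> 'b)) measure"
    where "MX = PiM J (\<lambda>_. count_space UNIV) \<Otimes>\<^sub>M PiM (J \<times> UNIV) (\<lambda>_. borel)"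
  define h where "h \<omega> = (\<lambda>(j, n)\<in>J \<times> UNIV. H j n \<omega>)" for \<omega>
  define x where "x \<omega> = (\<lambda>j\<in>J. N j \<omega>, \<lambda>(j, n)\<in>J \<times> UNIV. X j n \<omega>)" for \<omega>
  have hsp: "h \<in> space M \<rightarrow> space MH" by (auto simp: h_def MH_def space_PiM)
  have xsp: "x \<in> space M \<rightarrow> space MX" by (auto simp: x_def MX_def space_PiM space_pair_measure)
  note ind = indep_set_vimage_algebra[OF indep[folded h_def[abs_def] x_def[abs_def] MH_def MX_def] hsp xsp]
  note [measurable] = ind(1,2)
  have cN [measurable]: "(\<lambda>a. fst a j) \<in> measurable MX (count_space UNIV)" if "j \<in> J" for j
    unfolding MX_def using that
    by (intro measurable_compose[OF measurable_fst] measurable_component_singleton)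
  have cX [measurable]: "(\<lambda>a. snd a (j, n)) \<in> borel_measurable MX" if "j \<in> J" for j n
    unfolding MX_def using that
    by (intro measurable_compose[OF measurable_snd] measurable_component_singleton) auto
  have cH [measurable]: "(\<lambda>b. b (j, n)) \<in> borel_measurable MH" if "j \<in> J" for j n
    unfolding MH_def using that by (intro measurable_component_singleton) auto
  show N_meas: "j \<in> J \<Longrightarrow> N j \<in> measurable M (count_space UNIV)"
    using measurable_compose[OF ind(2) cN[of j]] by (simp add: x_def)
  show X_meas: "j \<in> J \<Longrightarrow> X j n \<in> borel_measurable M"
    using measurable_compose[OF ind(2) cX[of j n]] by (simp add: x_def)
  show H_meas: "j \<in> J \<Longrightarrow> H j n \<in> borel_measurable M"
    using measurable_compose[OF ind(1) cH[of j n]] by (simp add: h_def)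
  interpret DH: prob_space "distr M MH h" by (rule prob_space_distr) simp
  interpret DX: prob_space "distr M MX x" by (rule prob_space_distr) simp
  interpret DP: pair_prob_space "distr M MH h" "distr M MX x" ..
  define \<Phi> where "\<Phi> b a = (\<Prod>(j, n)\<in>J \<times> {..<m}. if enat n < fst a j then v j (snd a (j, n), b (j, n)) else 1)"
    for a b
  have \<Phi>_m [measurable]: "(\<lambda>p. \<Phi> (fst p) (snd p)) \<in> borel_measurable (MH \<Otimes>\<^sub>M MX)"
    unfolding \<Phi>_def
  proof (rule borel_measurable_prod_ennreal)
    fix jn assume "jn \<in> J \<times> {..<m}"
    then obtain j n where jn: "jn = (j, n)" and j [measurable]: "j \<in> J" by auto
    have [measurable]: "(\<lambda>p. fst (snd p) j) \<in> measurable (MH \<Otimes>\<^sub>M MX) (count_space UNIV)"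
      by (rule measurable_compose[OF measurable_snd cN[OF j]])
    have [measurable]: "(\<lambda>p. snd (snd p) (j, n)) \<in> borel_measurable (MH \<Otimes>\<^sub>M MX)"
      by (rule measurable_compose[OF measurable_snd cX[OF j]])
    have [measurable]: "(\<lambda>p. fst p (j, n)) \<in> borel_measurable (MH \<Otimes>\<^sub>M MX)"
      by (rule measurable_compose[OF measurable_fst cH[OF j]])
    show "(\<lambda>p. case jn of (j, n) \<Rightarrow> if enat n < fst (snd p) j then v j (snd (snd p) (j, n), fst p (j, n)) else 1)
      \<in> borel_measurable (MH \<Otimes>\<^sub>M MX)"
      unfolding jn prod.case by measurable
  qed
  have "(\<lambda>p. (snd p, fst p)) \<in> MX \<Otimes>\<^sub>M MH \<rightarrow>\<^sub>M MH \<Otimes>\<^sub>M MX" by measurable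
  from measurable_compose[OF this \<Phi>_m]
  have \<Phi>_m' [measurable]: "(\<lambda>p. \<Phi> (snd p) (fst p)) \<in> borel_measurable (MX \<Otimes>\<^sub>M MH)"
    by (simp only: fst_conv snd_conv)
  have "(\<integral>\<^sup>+\<omega>. (\<Prod>(j, n)\<in>J \<times> {..<m}. if enat n < N j \<omega> then v j (X j n \<omega>, H j n \<omega>) else 1) \<partial>M)
     = (\<integral>\<^sup>+\<omega>. \<Phi> (h \<omega>) (x \<omega>) \<partial>M)"
    unfolding \<Phi>_def h_def x_def by (intro nn_integral_cong prod.cong) auto
  also have "\<dots> = (\<integral>\<^sup>+p. \<Phi> (fst p) (snd p) \<partial>distr M (MH \<Otimes>\<^sub>M MX) (\<lambda>\<omega>. (h \<omega>, x \<omega>)))"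
  proof -
    have "(\<integral>\<^sup>+p. \<Phi> (fst p) (snd p) \<partial>distr M (MH \<Otimes>\<^sub>M MX) (\<lambda>\<omega>. (h \<omega>, x \<omega>)))
        = (\<integral>\<^sup>+\<omega>. \<Phi> (fst (h \<omega>, x \<omega>)) (snd (h \<omega>, x \<omega>)) \<partial>M)"
    proof (rule nn_integral_distr)
      show "(\<lambda>p. \<Phi> (fst p) (snd p)) \<in> borel_measurable (distr M (MH \<Otimes>\<^sub>M MX) (\<lambda>\<omega>. (h \<omega>, x \<omega>)))"
        unfolding measurable_distr_eq1 by (rule \<Phi>_m)
    qed measurable
    then show ?thesis by simp
  qed
  also have "\<dots> = (\<integral>\<^sup>+a. \<integral>\<^sup>+b. \<Phi> b a \<partial>distr M MH h \<partial>distr M MX x)"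
  proof -
    have "(\<lambda>p. \<Phi> (fst p) (snd p)) \<in> borel_measurable (distr M MH h \<Otimes>\<^sub>M distr M MX x)"
    proof -
      have S: "sets (distr M MH h \<Otimes>\<^sub>M distr M MX x) = sets (MH \<Otimes>\<^sub>M MX)"
        by (intro sets_pair_measure_cong) simp_all
      show ?thesis using \<Phi>_m unfolding measurable_cong_sets[OF S refl] .
    qed
    from DP.nn_integral_snd[OF this] show ?thesis unfolding ind(3)[symmetric] by simp
  qed
  also have "\<dots> = (\<integral>\<^sup>+\<omega>. \<integral>\<^sup>+b. \<Phi> b (x \<omega>) \<partial>distr M MH h \<partial>M)"
    by (rule nn_integral_distr) measurable
  also have "\<dots> = (\<integral>\<^sup>+\<omega>. (\<Prod>(j, n)\<in>J \<times> {..<m}. if enat n < N j \<omega> then \<integral>\<^sup>+h. v j (X j n \<omega>, h) \<partial>E1 else 1) \<partial>M)"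
  proof (rule nn_integral_cong)
    fix \<omega> assume "\<omega> \<in> space M"
    define \<phi> where "\<phi> jn y = (if enat (snd jn) < N (fst jn) \<omega> then v (fst jn) (X (fst jn) (snd jn) \<omega>, y) else 1)" for jn y
    have [measurable]: "\<phi> jn \<in> borel_measurable borel" for jn unfolding \<phi>_def by measurable
    have "(\<integral>\<^sup>+b. \<Phi> b (x \<omega>) \<partial>distr M MH h) = (\<integral>\<^sup>+\<omega>'. \<Phi> (h \<omega>') (x \<omega>) \<partial>M)"
    proof (rule nn_integral_distr)
      have "x \<omega> \<in> space MX" using xsp \<open>\<omega> \<in> space M\<close> by blast
      from measurable_Pair1[OF \<Phi>_m this]
      show "(\<lambda>b. \<Phi> b (x \<omega>)) \<in> borel_measurable (distr M MH h)"
        unfolding measurable_distr_eq1 by (simp only: fst_conv snd_conv)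
    qed simp
    also have "\<dots> = (\<integral>\<^sup>+\<omega>'. (\<Prod>jn\<in>J \<times> {..<m}. \<phi> jn ((\<lambda>(j, n). H j n) jn \<omega>')) \<partial>M)"
      unfolding \<Phi>_def h_def x_def \<phi>_def by (intro nn_integral_cong prod.cong) auto
    also have "\<dots> = (\<Prod>jn\<in>J \<times> {..<m}. \<integral>\<^sup>+\<omega>'. \<phi> jn ((\<lambda>(j, n). H j n) jn \<omega>') \<partial>M)"
      using J by (intro indep_vars_nn_integral indep_vars_compose2[OF indep_vars_subset[OF H_indep]]) auto
    also have "\<dots> = (\<Prod>(j, n)\<in>J \<times> {..<m}. if enat n < N j \<omega> then \<integral>\<^sup>+h. v j (X j n \<omega>, h) \<partial>E1 else 1)"
    proof (rule prod.cong[OF refl])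
      fix jn assume "jn \<in> J \<times> {..<m}"
      then obtain j n where jn: "jn = (j, n)" and j: "j \<in> J" by auto
      have "(\<integral>\<^sup>+\<omega>'. \<phi> (j, n) (H j n \<omega>') \<partial>M) = (\<integral>\<^sup>+y. \<phi> (j, n) y \<partial>distr M lborel (H j n))"
        using H[OF j, of n] by (subst nn_integral_distr) (auto simp: distributed_def)
      also have "\<dots> = (\<integral>\<^sup>+y. \<phi> (j, n) y \<partial>E1)"
        using H[OF j, of n] by (simp add: distributed_def)
      finally show "(\<integral>\<^sup>+\<omega>'. \<phi> jn ((case jn of (j, n) \<Rightarrow> H j n) \<omega>') \<partial>M)
         = (case jn of (j, n) \<Rightarrow> if enat n < N j \<omega> then \<integral>\<^sup>+h. v j (X j n \<omega>, h) \<partial>E1 else 1)"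
        using prob_space.emeasure_space_1[OF prob_space_E1] by (simp add: \<phi>_def jn)
    qed
    finally show "(\<integral>\<^sup>+b. \<Phi> b (x \<omega>) \<partial>distr M MH h)
      = (\<Prod>(j, n)\<in>J \<times> {..<m}. if enat n < N j \<omega> then \<integral>\<^sup>+h. v j (X j n \<omega>, h) \<partial>E1 else 1)" .
  qed
  finally show "(\<integral>\<^sup>+\<omega>. (\<Prod>(j, n)\<in>J \<times> {..<m}. if enat n < N j \<omega> then v j (X j n \<omega>, H j n \<omega>) else 1) \<partial>M)
       = (\<integral>\<^sup>+\<omega>. (\<Prod>(j, n)\<in>J \<times> {..<m}. if enat n < N j \<omega> then \<integral>\<^sup>+h. v j (X j n \<omega>, h) \<partial>E1 else 1) \<partial>M)" .
qed

text \<open>The marking theorem. Averaging the exponential over the mark replaces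
  \<open>f j (x, h)\<close> by a function \<open>g j x\<close> of the position alone, after which
  the functional of the unmarked processes applies. The replacement is made for finitely many points
  and passes to the limit since the exponentials are bounded by 1.\<close>

lemma marked_Laplace:
  fixes \<Theta> :: "'j \<Rightarrow> 'a \<Rightarrow> 'b::euclidean_space set"
    and N :: "'j \<Rightarrow> 'a \<Rightarrow> enat" and X :: "'j \<Rightarrow> nat \<Rightarrow> 'a \<Rightarrow> 'b" and H :: "'j \<Rightarrow> nat \<Rightarrow> 'a \<Rightarrow> real"
  assumes J: "finite J" and indep_\<Theta>: "indep_processes M J \<Theta>"
    and ppp: "\<And>j. j \<in> J \<Longrightarrow> homogeneous_ppp M (d j) (\<Theta> j)" and d: "\<And>j. j \<in> J \<Longrightarrow> 0 \<le> d j"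
    and enum: "\<And>j \<omega>. j \<in> J \<Longrightarrow> \<omega> \<in> space M \<Longrightarrow> bij_betw (\<lambda>n. X j n \<omega>) {n. enat n < N j \<omega>} (\<Theta> j \<omega>)"
    and marks: "exponential_marks J N X H"
    and f [measurable]: "\<And>j. f j \<in> borel_measurable (borel \<Otimes>\<^sub>M borel)"
  shows "(\<integral>\<^sup>+\<omega>. ennreal (nexp (\<Sum>j\<in>J. \<Sum>n. if enat n < N j \<omega> then f j (X j n \<omega>, H j n \<omega>) else 0)) \<partial>M)
       = ennreal (nexp (\<Sum>j\<in>J. ennreal (d j) * (\<integral>\<^sup>+x. \<integral>\<^sup>+h. ennreal (1 - nexp (f j (x, h))) \<partial>E1 \<partial>lborel)))"
proof -
  interpret E1: prob_space E1 by (rule prob_space_E1)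
  define v where "v j p = ennreal (nexp (f j p))" for j p
  have [measurable]: "v j \<in> borel_measurable (borel \<Otimes>\<^sub>M borel)" for j unfolding v_def by measurable
  note fin = marked_finite_product[OF J marks, where v=v]
  have Nm [measurable]: "N j \<in> measurable M (count_space UNIV)" if "j \<in> J" for j using fin(2)[OF _ that] by simp
  have Xm [measurable]: "X j n \<in> borel_measurable M" if "j \<in> J" for j n using fin(3)[OF _ that] by simp
  have Hm [measurable]: "H j n \<in> borel_measurable M" if "j \<in> J" for j n using fin(4)[OF _ that] by simp
  define w where "w j x = (\<integral>h. nexp (f j (x, h)) \<partial>E1)" for j x
  have [measurable]: "w j \<in> borel_measurable borel" for j unfolding w_def by measurable
  have int: "integrable E1 (\<lambda>h. nexp (f j (x, h)))" for j x
    by (rule E1.integrable_const_bound[where B=1]) auto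
  have w0: "0 \<le> w j x" for j x unfolding w_def by (intro integral_nonneg_AE) auto
  have w1: "w j x \<le> 1" for j x
    unfolding w_def using integral_mono[OF int, of "\<lambda>_. 1" j x] E1.prob_space by simp
  have wv: "(\<integral>\<^sup>+h. v j (x, h) \<partial>E1) = ennreal (w j x)" for j x
    unfolding v_def w_def by (intro nn_integral_eq_integral int) auto
  have w': "(\<integral>\<^sup>+h. ennreal (1 - nexp (f j (x, h))) \<partial>E1) = ennreal (1 - w j x)" for j x
  proof -
    have "(\<integral>\<^sup>+h. ennreal (1 - nexp (f j (x, h))) \<partial>E1) = ennreal (\<integral>h. 1 - nexp (f j (x, h)) \<partial>E1)"
      using int by (intro nn_integral_eq_integral) auto
    also have "(\<integral>h. 1 - nexp (f j (x, h)) \<partial>E1) = 1 - w j x"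
      unfolding w_def using int E1.prob_space by (subst Bochner_Integration.integral_diff) auto
    finally show ?thesis .
  qed
  \<comment> \<open>The effective test function is minus the logarithm of the mark average
    \<open>w j x\<close>; where the average is 0 the exponent has to be
    \<open>\<top>\<close>.\<close>
  define g where "g j x = (if w j x = 0 then \<top> else ennreal (- ln (w j x)))" for j x
  have [measurable]: "g j \<in> borel_measurable borel" for j unfolding g_def by measurable
  have g: "nexp (g j x) = w j x" for j x
    using w0[of j x] w1[of j x] by (auto simp: g_def nexp_ennreal)
  define F where "F = (\<lambda>j n \<omega>. if enat n < N j \<omega> then f j (X j n \<omega>, H j n \<omega>) else 0)"
  define G where "G = (\<lambda>j n \<omega>. if enat n < N j \<omega> then g j (X j n \<omega>) else 0)"
  have Fm [measurable]: "F j n \<in> borel_measurable M" if [measurable]: "j \<in> J" for j n unfolding F_def by measurable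
  have Gm [measurable]: "G j n \<in> borel_measurable M" if [measurable]: "j \<in> J" for j n unfolding G_def by measurable
  have step: "(\<integral>\<^sup>+\<omega>. ennreal (nexp (\<Sum>j\<in>J. \<Sum>n<m. F j n \<omega>)) \<partial>M) = (\<integral>\<^sup>+\<omega>. ennreal (nexp (\<Sum>j\<in>J. \<Sum>n<m. G j n \<omega>)) \<partial>M)" for m
  proof -
    have "ennreal (nexp (\<Sum>j\<in>J. \<Sum>n<m. F j n \<omega>)) = (\<Prod>(j, n)\<in>J \<times> {..<m}. if enat n < N j \<omega> then v j (X j n \<omega>, H j n \<omega>) else 1)" for \<omega>
      using J unfolding sum.cartesian_product
      by (subst nexp_sum, simp, subst prod_ennreal[symmetric], simp, intro prod.cong) (auto simp: F_def v_def)
    moreover have "ennreal (nexp (\<Sum>j\<in>J. \<Sum>n<m. G j n \<omega>)) = (\<Prod>(j, n)\<in>J \<times> {..<m}. if enat n < N j \<omega> then \<integral>\<^sup>+h. v j (X j n \<omega>, h) \<partial>E1 else 1)" for \<omega>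
      using J unfolding sum.cartesian_product wv
      by (subst nexp_sum, simp, subst prod_ennreal[symmetric], simp, intro prod.cong) (auto simp: G_def g)
    ultimately show ?thesis using fin(1)[of m] by simp
  qed
  have lim: "(\<lambda>m. \<integral>\<^sup>+\<omega>. ennreal (nexp (\<Sum>j\<in>J. \<Sum>n<m. Q j n \<omega>)) \<partial>M) \<longlonglongrightarrow> (\<integral>\<^sup>+\<omega>. ennreal (nexp (\<Sum>j\<in>J. \<Sum>n. Q j n \<omega>)) \<partial>M)"
    if Q: "\<And>j n. j \<in> J \<Longrightarrow> Q j n \<in> borel_measurable M" for Q
  proof (rule nn_integral_dominated_convergence[where w="\<lambda>_. 1"])
    have "(\<lambda>\<omega>. \<Sum>j\<in>J. \<Sum>n<m. Q j n \<omega>) \<in> borel_measurable M" for m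
      by (intro borel_measurable_sum Q)
    then show "(\<lambda>\<omega>. ennreal (nexp (\<Sum>j\<in>J. \<Sum>n<m. Q j n \<omega>))) \<in> borel_measurable M" for m by measurable
    have "(\<lambda>\<omega>. \<Sum>j\<in>J. \<Sum>n. Q j n \<omega>) \<in> borel_measurable M"
    proof (rule borel_measurable_sum)
      fix j assume "j \<in> J"
      note [measurable] = Q[OF this]
      show "(\<lambda>\<omega>. \<Sum>n. Q j n \<omega>) \<in> borel_measurable M" by measurable
    qed
    then show "(\<lambda>\<omega>. ennreal (nexp (\<Sum>j\<in>J. \<Sum>n. Q j n \<omega>))) \<in> borel_measurable M" by measurable
    show "AE \<omega> in M. (\<lambda>m. ennreal (nexp (\<Sum>j\<in>J. \<Sum>n<m. Q j n \<omega>))) \<longlonglongrightarrow> ennreal (nexp (\<Sum>j\<in>J. \<Sum>n. Q j n \<omega>))"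
      by (intro AE_I2 tendsto_ennrealI tendsto_nexp tendsto_sum summable_LIMSEQ) auto
  qed (auto simp: emeasure_space_1)
  have "(\<integral>\<^sup>+\<omega>. ennreal (nexp (\<Sum>j\<in>J. \<Sum>n. F j n \<omega>)) \<partial>M) = (\<integral>\<^sup>+\<omega>. ennreal (nexp (\<Sum>j\<in>J. \<Sum>n. G j n \<omega>)) \<partial>M)"
    using lim[of F, OF Fm] lim[of G, OF Gm] unfolding step by (rule LIMSEQ_unique)
  also have "\<dots> = (\<integral>\<^sup>+\<omega>. ennreal (nexp (\<Sum>j\<in>J. \<integral>\<^sup>+x. g j x \<partial>count_space (\<Theta> j \<omega>))) \<partial>M)"
  proof (intro nn_integral_cong arg_cong[where f=ennreal] arg_cong[where f=nexp] sum.cong refl)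
    fix \<omega> j assume \<omega>: "\<omega> \<in> space M" and j: "j \<in> J"
    have "(\<integral>\<^sup>+x. g j x \<partial>count_space (\<Theta> j \<omega>)) = (\<integral>\<^sup>+n. g j (X j n \<omega>) \<partial>count_space {n. enat n < N j \<omega>})"
      by (rule nn_integral_bij_count_space[OF enum[OF j \<omega>], symmetric])
    also have "\<dots> = (\<integral>\<^sup>+n. g j (X j n \<omega>) * indicator {n. enat n < N j \<omega>} n \<partial>count_space UNIV)"
      by (simp add: nn_integral_count_space_indicator)
    also have "\<dots> = (\<Sum>n. G j n \<omega>)"
      unfolding nn_integral_count_space_nat by (intro suminf_cong) (simp add: G_def indicator_def)
    finally show "(\<Sum>n. G j n \<omega>) = (\<integral>\<^sup>+x. g j x \<partial>count_space (\<Theta> j \<omega>))" by simp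
  qed
  also have "\<dots> = ennreal (nexp (\<Sum>j\<in>J. ennreal (d j) * (\<integral>\<^sup>+x. ennreal (1 - nexp (g j x)) \<partial>lborel)))"
    by (rule ppp_Laplace_family[OF J indep_\<Theta>]) (auto intro: ppp d)
  finally show ?thesis by (simp only: F_def g w')
qed

end

section \<open>Received powers as a Poisson process on the half-line\<close>

text \<open>For a fixed mark \<open>h\<close>, the received power exceeds \<open>u\<close> exactly
  inside a disc of radius \<open>(P * h / u) powr (1 / \<alpha>)\<close>, up to a null set. Its area
  is \<open>pi * (P * h / u) powr (2 / \<alpha>)\<close>, and the exponential mean of
  \<open>h powr (2 / \<alpha>)\<close> is the Gamma factor.\<close>

lemma emeasure_path_loss_Ioi:
  fixes P \<alpha> u :: real
  assumes P: "0 < P" and \<alpha>: "2 < \<alpha>" and u: "0 < u"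
  shows "(\<integral>\<^sup>+(x::real^2). \<integral>\<^sup>+h. indicator {u<..} (P * h * norm x powr (- \<alpha>)) \<partial>E1 \<partial>lborel)
       = ennreal (pi * P powr (2 / \<alpha>) * Gamma (1 + 2 / \<alpha>) * u powr (- (2 / \<alpha>)))"
proof -
  interpret E1: prob_space E1 by (rule prob_space_E1)
  interpret pair_sigma_finite lborel E1 ..
  define d where "d = 2 / \<alpha>"
  have d: "0 < d" using \<alpha> by (simp add: d_def)
  have "(\<integral>\<^sup>+(x::real^2). \<integral>\<^sup>+h. indicator {u<..} (P * h * norm x powr (- \<alpha>)) \<partial>E1 \<partial>lborel)
      = (\<integral>\<^sup>+h. \<integral>\<^sup>+(x::real^2). indicator {u<..} (P * h * norm x powr (- \<alpha>)) \<partial>lborel \<partial>E1)"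
    by (rule Fubini'[symmetric]) measurable
  also have "\<dots> = (\<integral>\<^sup>+h. ennreal (pi * (P / u) powr d * h powr d) \<partial>E1)"
  proof (rule nn_integral_cong_AE)
    have "AE h in lborel. (0::real) < ennreal (exponential_density 1 h) \<longrightarrow> 0 < h"
      using AE_lborel_singleton[of "0::real"] by eventually_elim (auto simp: exponential_density_def)
    then have "AE h in E1. 0 < h" by (subst AE_density) auto
    then show "AE h in E1. (\<integral>\<^sup>+(x::real^2). indicator {u<..} (P * h * norm x powr (- \<alpha>)) \<partial>lborel) = ennreal (pi * (P / u) powr d * h powr d)"
    proof eventually_elim
      case (elim h)
      define r where "r = (P * h / u) powr (1 / \<alpha>)"
      have q: "0 < P * h / u" using P u elim by simp
      have r: "0 < r" unfolding r_def using q by (subst powr_gt_zero) linarith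
      have ra: "r powr \<alpha> = P * h / u" using P u elim \<alpha> by (simp add: r_def powr_powr)
      \<comment> \<open>The origin is excluded because \<open>0 powr (- \<alpha>)\<close> is 0, so
        the formula assigns it power 0; it is a null set.\<close>
      have eq: "u < P * h * norm x powr (- \<alpha>) \<longleftrightarrow> norm x < r" if "x \<noteq> 0" for x :: "real^2"
      proof -
        have n: "0 < norm x powr \<alpha>" using that by simp
        have "u < P * h * norm x powr (- \<alpha>) \<longleftrightarrow> norm x powr \<alpha> < r powr \<alpha>"
          unfolding ra powr_minus using u n by (simp add: field_simps)
        also have "\<dots> \<longleftrightarrow> norm x < r"
          using \<alpha> r by (metis linorder_not_less norm_ge_zero powr_less_mono2 powr_mono2 less_imp_le less_trans zero_less_numeral)
        finally show ?thesis .
      qed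
      have "(\<integral>\<^sup>+(x::real^2). indicator {u<..} (P * h * norm x powr (- \<alpha>)) \<partial>lborel) = (\<integral>\<^sup>+(x::real^2). indicator (ball 0 r) x \<partial>lborel)"
        by (rule nn_integral_cong_AE, rule AE_mp[OF AE_lborel_singleton[of 0] AE_I2]) (auto simp: indicator_def eq)
      also have "\<dots> = ennreal (pi * r ^ 2)"
        using r by (simp add: emeasure_ball unit_ball_vol_2)
      also have "r ^ 2 = (P * h / u) powr d"
        by (simp add: r_def d_def power2_eq_square flip: powr_add)
      also have "\<dots> = (P / u) powr d * h powr d"
        using P u elim by (simp add: powr_mult[symmetric] mult.commute)
      finally show ?case by (simp add: mult.assoc)
    qed
  qed
  also have "\<dots> = ennreal (pi * (P / u) powr d) * (\<integral>\<^sup>+h. ennreal (h powr d) \<partial>E1)"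
    by (subst nn_integral_cmult[symmetric]) (auto simp: ennreal_mult')
  also have "(\<integral>\<^sup>+h. ennreal (h powr d) \<partial>E1) = ennreal (Gamma (1 + d))"
  proof -
    have "(\<integral>\<^sup>+h. ennreal (h powr d) \<partial>E1) = (\<integral>\<^sup>+h. ennreal (exponential_density 1 h) * ennreal (h powr d) \<partial>lborel)"
      by (subst nn_integral_density) auto
    also have "\<dots> = (\<integral>\<^sup>+h. ennreal (h powr ((1 + d) - 1) * exp (- (1 * h))) * indicator {0<..} h \<partial>lborel)"
      by (rule nn_integral_cong_AE, rule AE_mp[OF AE_lborel_singleton[of 0] AE_I2])
         (auto simp: exponential_density_def indicator_def mult.commute simp flip: ennreal_mult')
    also have "\<dots> = ennreal (Gamma (1 + d))"
      using d by (subst nn_integral_Gamma_scaled) auto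
    finally show ?thesis .
  qed
  also have "ennreal (pi * (P / u) powr d) * ennreal (Gamma (1 + d)) = ennreal (pi * P powr d * Gamma (1 + d) * u powr (- d))"
  proof -
    have "(P / u) powr d = P powr d * u powr (- d)" using P u by (simp add: powr_divide powr_minus_divide)
    moreover have "0 \<le> Gamma (1 + d)" using d by (intro less_imp_le[OF Gamma_real_pos]) auto
    ultimately show ?thesis by (simp add: mult_ac flip: ennreal_mult'')
  qed
  finally show ?thesis by (simp add: d_def)
qed

text \<open>The mapping theorem at the level of intensities: the image of Lebesgue measure times the
  mark law under the power map is a multiple of \<open>rho (2 / \<alpha>)\<close>. Equality of
  finite tails identifies the two measures on \<open>{t<..}\<close>; the part at 0 and below is
  invisible to \<open>G\<close>.\<close>

lemma nn_integral_path_loss: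
  fixes P \<alpha> :: real
  assumes P: "0 < P" and \<alpha>: "2 < \<alpha>" and G [measurable]: "G \<in> borel_measurable borel" and G0: "\<And>s. s \<le> 0 \<Longrightarrow> G s = 0"
  shows "(\<integral>\<^sup>+(x::real^2). \<integral>\<^sup>+h. G (P * h * norm x powr (- \<alpha>)) \<partial>E1 \<partial>lborel)
       = ennreal (pi * P powr (2 / \<alpha>) * Gamma (1 + 2 / \<alpha>)) * (\<integral>\<^sup>+s. G s \<partial>rho (2 / \<alpha>))"
proof -
  interpret E1: prob_space E1 by (rule prob_space_E1)
  define d where "d = 2 / \<alpha>"
  have d: "0 < d" using \<alpha> by (simp add: d_def)
  define c where "c = pi * P powr d * Gamma (1 + d)"
  have c: "0 \<le> c" using d by (auto simp: c_def intro!: mult_nonneg_nonneg less_imp_le[OF Gamma_real_pos])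
  define L where "L = (lborel :: (real^2) measure) \<Otimes>\<^sub>M E1"
  define V where "V p = P * snd p * norm (fst p) powr (- \<alpha>)" for p :: "(real^2) \<times> real"
  have [measurable]: "V \<in> borel_measurable L" unfolding V_def L_def by measurable
  have L_int: "(\<integral>\<^sup>+p. F (V p) \<partial>L) = (\<integral>\<^sup>+(x::real^2). \<integral>\<^sup>+h. F (P * h * norm x powr (- \<alpha>)) \<partial>E1 \<partial>lborel)"
    if [measurable]: "F \<in> borel_measurable borel" for F :: "real \<Rightarrow> ennreal"
    unfolding L_def by (subst E1.nn_integral_fst[symmetric]) (auto simp: V_def)
  have tail: "emeasure (distr L borel V) {u<..} = ennreal (c * u powr (- d))" if "0 < u" for u
  proof -
    have "emeasure (distr L borel V) {u<..} = (\<integral>\<^sup>+p. indicator {u<..} (V p) \<partial>L)"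
      by (subst nn_integral_indicator[symmetric], simp, subst nn_integral_distr) auto
    then show ?thesis
      using emeasure_path_loss_Ioi[OF P \<alpha> that] by (simp add: L_int c_def d_def)
  qed
  have trunc: "density (distr L borel V) (indicator {t<..}) = density (rho d) (\<lambda>s. ennreal c * indicator {t<..} s)"
    if t: "0 < t" for t
  proof (rule measure_eqI_lessThan)
    have 1: "emeasure (density (distr L borel V) (indicator {t<..})) {x<..} = ennreal (c * (max x t) powr (- d))" for x
    proof -
      have "emeasure (density (distr L borel V) (indicator {t<..})) {x<..} = (\<integral>\<^sup>+s. indicator {max x t<..} s \<partial>distr L borel V)"
        by (subst emeasure_density, simp, simp, intro nn_integral_cong) (auto simp: indicator_def)
      also have "\<dots> = emeasure (distr L borel V) {max x t<..}" by (rule nn_integral_indicator) simp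
      finally show ?thesis using t by (simp add: tail)
    qed
    have 2: "emeasure (density (rho d) (\<lambda>s. ennreal c * indicator {t<..} s)) {x<..} = ennreal (c * (max x t) powr (- d))" for x
    proof -
      have "emeasure (density (rho d) (\<lambda>s. ennreal c * indicator {t<..} s)) {x<..} = (\<integral>\<^sup>+s. ennreal c * indicator {max x t<..} s \<partial>rho d)"
        by (subst emeasure_density, simp, simp, intro nn_integral_cong) (auto simp: indicator_def)
      then show ?thesis using t c d by (simp add: nn_integral_cmult emeasure_rho_Ioi ennreal_mult')
    qed
    show "emeasure (density (distr L borel V) (indicator {t<..})) {x<..} < \<infinity>" for x by (simp add: 1)
    show "emeasure (density (distr L borel V) (indicator {t<..})) {x<..} = emeasure (density (rho d) (\<lambda>s. ennreal c * indicator {t<..} s)) {x<..}" for x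
      by (simp add: 1 2)
  qed auto
  have fixed: "(\<integral>\<^sup>+p. indicator {t<..} (V p) * G (V p) \<partial>L) = ennreal c * (\<integral>\<^sup>+s. indicator {t<..} s * G s \<partial>rho d)" if "0 < t" for t
  proof -
    have "(\<integral>\<^sup>+p. indicator {t<..} (V p) * G (V p) \<partial>L) = (\<integral>\<^sup>+s. G s \<partial>density (distr L borel V) (indicator {t<..}))"
      by (simp add: nn_integral_density nn_integral_distr)
    also have "\<dots> = ennreal c * (\<integral>\<^sup>+s. indicator {t<..} s * G s \<partial>rho d)"
      unfolding trunc[OF that] by (simp add: nn_integral_density mult.assoc nn_integral_cmult)
    finally show ?thesis .
  qed
  have "(\<lambda>j. ennreal c * (\<integral>\<^sup>+s. indicator {1 / real (Suc j)<..} s * G s \<partial>rho d)) \<longlonglongrightarrow> (\<integral>\<^sup>+p. indicator {0<..} (V p) * G (V p) \<partial>L)"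
    by (subst fixed[symmetric], simp, rule nn_integral_trunc_LIMSEQ) measurable
  moreover have "(\<lambda>j. ennreal c * (\<integral>\<^sup>+s. indicator {1 / real (Suc j)<..} s * G s \<partial>rho d)) \<longlonglongrightarrow> ennreal c * (\<integral>\<^sup>+s. indicator {0<..} s * G s \<partial>rho d)"
    by (intro ennreal_tendsto_cmult nn_integral_trunc_LIMSEQ) measurable
  moreover have "indicator {0<..} s * G s = G s" for s using G0[of s] by (simp add: indicator_def)
  ultimately have "(\<integral>\<^sup>+p. G (V p) \<partial>L) = ennreal c * (\<integral>\<^sup>+s. G s \<partial>rho d)"
    by (simp only:) (rule LIMSEQ_unique)
  then show ?thesis by (simp add: L_int c_def d_def)
qed

section \<open>Measurability with junk values\<close>

text \<open>For real families unordered and absolute summability coincide, so \<open>infsum\<close>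
  has its default value 0 unless the sum of absolute values is finite. The right side is manifestly
  measurable in a parameter.\<close>

lemma infsum_nat_eq_suminf:
  fixes s :: "nat \<Rightarrow> real"
  shows "infsum s UNIV = (if (\<Sum>n. ennreal \<bar>s n\<bar>) < \<top> then suminf s else 0)"
proof (cases "(\<Sum>n. ennreal \<bar>s n\<bar>) < \<top>")
  case True
  then have "(\<Sum>n. ennreal \<bar>s n\<bar>) \<noteq> \<top>" by (rule less_imp_neq)
  then have "summable (\<lambda>n. \<bar>s n\<bar>)" by (rule summable_suminf_not_top[of "\<lambda>n. \<bar>s n\<bar>", OF abs_ge_zero])
  then have *: "summable (\<lambda>n. norm (s n))" by simp
  have "s sums suminf s" by (rule summable_sums[OF summable_norm_cancel[OF *]])
  with * have "(s has_sum suminf s) UNIV" by (rule norm_summable_imp_has_sum)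
  then show ?thesis using True by (simp add: infsumI)
next
  case False
  have "\<not> s summable_on UNIV"
  proof
    assume "s summable_on UNIV"
    then have "(\<lambda>n. \<bar>s n\<bar>) summable_on UNIV" by (subst (asm) summable_on_iff_abs_summable_on_real) simp
    then have "summable (\<lambda>n. \<bar>s n\<bar>)"
      by (rule summable_on_imp_summable)
    then have "(\<Sum>n. ennreal \<bar>s n\<bar>) \<noteq> \<top>" by (rule ennreal_suminf_neq_top[of "\<lambda>n. \<bar>s n\<bar>", OF _ abs_ge_zero])
    then show False using False top.not_eq_extremum by blast
  qed
  then show ?thesis using False by (simp add: infsum_not_exists)
qed

lemma infsum_bij_enum:
  fixes f :: "'a \<Rightarrow> real"
  assumes "bij_betw x {n. enat n < N} A"
  shows "infsum f A = infsum (\<lambda>n. if enat n < N then f (x n) else 0) UNIV"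
proof -
  have "infsum f A = infsum (\<lambda>n. f (x n)) {n. enat n < N}"
    by (rule infsum_reindex_bij_betw[OF assms, symmetric])
  also have "\<dots> = infsum (\<lambda>n. if enat n < N then f (x n) else 0) UNIV"
    by (rule infsum_cong_neutral) auto
  finally show ?thesis .
qed

lemma measurable_infsum_nat:
  fixes s :: "nat \<Rightarrow> 'a \<Rightarrow> real"
  assumes [measurable]: "\<And>n. s n \<in> borel_measurable M"
  shows "(\<lambda>\<omega>. infsum (\<lambda>n. s n \<omega>) UNIV) \<in> borel_measurable M"
  unfolding infsum_nat_eq_suminf by measurable

text \<open>
  The integrand of the coverage probability must be measurable also on the null set where a supremum
  is taken over an unbounded set, so its junk value matters.
\<close>

lemma SUP_unbounded_real:
  fixes s :: "'a \<Rightarrow> real"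
  assumes "\<not> bdd_above (s ` A)"
  shows "(SUP n\<in>A. s n) = (LEAST z. False)"
proof -
  have "(\<forall>x\<in>s ` A. x \<le> z) = False" for z
    using assms by (auto simp: bdd_above_def)
  then show ?thesis unfolding Sup_real_def by (simp only:)
qed

text \<open>There are three cases: no index, a bounded family, and an unbounded one, where the
  supremum is a fixed default value. Boundedness is tested by natural numbers, so every condition is
  a countable combination of measurable ones.\<close>

lemma measurable_SUP_enum:
  fixes s :: "nat \<Rightarrow> 'a \<Rightarrow> real" and N :: "'a \<Rightarrow> enat"
  assumes [measurable]: "\<And>n. s n \<in> borel_measurable M" "N \<in> measurable M (count_space UNIV)"
  shows "(\<lambda>\<omega>. if N \<omega> = 0 then 0 else SUP n\<in>{n. enat n < N \<omega>}. s n \<omega>) \<in> borel_measurable M"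
proof (rule borel_measurableI_le)
  fix y :: real
  have "(if N \<omega> = 0 then 0 else SUP n\<in>{n. enat n < N \<omega>}. s n \<omega>) \<le> y \<longleftrightarrow>
     (if N \<omega> = 0 then 0 \<le> y else if \<exists>b::nat. \<forall>n. enat n < N \<omega> \<longrightarrow> s n \<omega> \<le> real b
      then \<forall>n. enat n < N \<omega> \<longrightarrow> s n \<omega> \<le> y else (LEAST z::real. False) \<le> y)" for \<omega>
  proof (cases "N \<omega> = 0")
    case False
    then have ne: "{n. enat n < N \<omega>} \<noteq> {}" by (metis (mono_tags) empty_iff mem_Collect_eq not_gr_zero zero_enat_def)
    have "bdd_above ((\<lambda>n. s n \<omega>) ` {n. enat n < N \<omega>}) \<longleftrightarrow> (\<exists>b::nat. \<forall>n. enat n < N \<omega> \<longrightarrow> s n \<omega> \<le> real b)"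
    proof
      assume "bdd_above ((\<lambda>n. s n \<omega>) ` {n. enat n < N \<omega>})"
      then obtain c where c: "\<And>n. enat n < N \<omega> \<Longrightarrow> s n \<omega> \<le> c" by (auto simp: bdd_above_def)
      obtain b :: nat where "c \<le> real b" using real_arch_simple by blast
      then show "\<exists>b::nat. \<forall>n. enat n < N \<omega> \<longrightarrow> s n \<omega> \<le> real b" using c order_trans by blast
    qed (auto simp: bdd_above_def)
    moreover have "(SUP n\<in>{n. enat n < N \<omega>}. s n \<omega>) \<le> y \<longleftrightarrow> (\<forall>n. enat n < N \<omega> \<longrightarrow> s n \<omega> \<le> y)"
      if "bdd_above ((\<lambda>n. s n \<omega>) ` {n. enat n < N \<omega>})"
      using cSUP_le_iff[OF ne that] by auto
    ultimately show ?thesis using False by (auto simp: SUP_unbounded_real)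
  qed simp
  then show "{\<omega> \<in> space M. (if N \<omega> = 0 then 0 else SUP n\<in>{n. enat n < N \<omega>}. s n \<omega>) \<le> y} \<in> sets M"
    by (simp only:) measurable
qed

lemma SUP_bij_enum:
  assumes "bij_betw x {n. enat n < N} A"
  shows "(if A = {} then 0 else SUP y\<in>A. f y) = (if N = 0 then 0 else (SUP n\<in>{n. enat n < N}. f (x n) :: real))"
proof -
  have img: "x ` {n. enat n < N} = A" using assms by (simp add: bij_betw_def)
  have "A = {} \<longleftrightarrow> N = 0"
    unfolding img[symmetric] by (auto simp: zero_enat_def[symmetric]) (metis not_gr_zero zero_enat_def)
  moreover have "(SUP y\<in>A. f y) = (SUP n\<in>{n. enat n < N}. f (x n))"
    unfolding img[symmetric] by (simp add: image_image)
  ultimately show ?thesis by simp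
qed

text \<open>The terms tend to 0, so beyond some index all lie below one chosen positive term, and
  the maximum over the remaining finite range is global.\<close>

lemma summable_nonneg_attains_max:
  fixes s :: "nat \<Rightarrow> real"
  assumes "summable s" "\<And>n. 0 \<le> s n"
  obtains m where "\<And>n. s n \<le> s m"
proof (cases "\<forall>n. s n = 0")
  case True
  then show ?thesis using that[of 0] by simp
next
  case False
  then obtain n0 where "s n0 \<noteq> 0" by blast
  then have n0: "0 < s n0" using assms(2)[of n0] by simp
  have "s \<longlonglongrightarrow> 0" using assms(1) by (rule summable_LIMSEQ_zero)
  then have "\<forall>\<^sub>F n in sequentially. s n < s n0" using n0 by (rule order_tendstoD)
  then obtain k where k: "\<And>n. k \<le> n \<Longrightarrow> s n < s n0" by (auto simp: eventually_sequentially)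
  have "Max (s ` {..max k n0}) \<in> s ` {..max k n0}" by (intro Max_in) auto
  then obtain m where m: "Max (s ` {..max k n0}) = s m" by blast
  have le: "s n \<le> s m" if "n \<le> max k n0" for n
    unfolding m[symmetric] using that by (intro Max_ge) auto
  show ?thesis
  proof (rule that[of m])
    fix n
    show "s n \<le> s m"
    proof (cases "n \<le> max k n0")
      case False
      then have "s n < s n0" by (intro k) auto
      also have "\<dots> \<le> s m" by (intro le) auto
      finally show ?thesis by simp
    qed (rule le)
  qed
qed

lemma SUP_enum_eq_max:
  fixes s :: "nat \<Rightarrow> real"
  assumes m: "\<And>n. (if enat n < N then s n else 0) \<le> (if enat m < N then s m else 0)"
    and nn: "\<And>n. enat n < N \<Longrightarrow> 0 \<le> s n"
  shows "(if N = 0 then 0 else SUP n\<in>{n. enat n < N}. s n) = (if enat m < N then s m else 0)"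
proof (cases "N = 0")
  case False
  then have n0: "enat 0 < N" by (metis not_gr_zero zero_enat_def)
  have "(SUP n\<in>{n. enat n < N}. s n) = (if enat m < N then s m else 0)"
  proof (rule cSup_eq_maximum)
    \<comment> \<open>If the maximal index \<open>m\<close> is a padding index, the maximum is 0,
      all actual terms vanish, and index 0 attains it.\<close>
    show "(if enat m < N then s m else 0) \<in> s ` {n. enat n < N}"
    proof (cases "enat m < N")
      case False
      then have "s 0 = 0" using m[of 0] nn[of 0] n0 by simp
      then show ?thesis using False n0 by (auto intro!: image_eqI[of _ _ 0])
    qed auto
    show "y \<le> (if enat m < N then s m else 0)" if "y \<in> s ` {n. enat n < N}" for y
    proof -
      from that obtain n where "y = s n" "enat n < N" by blast
      then show ?thesis using m[of n] by simp
    qed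
  qed
  then show ?thesis using False by simp
qed (simp add: zero_enat_def[symmetric])

section \<open>The network\<close>

lemma sum_pairs: "(\<Sum>j\<in>A \<times> B. f j) = (\<Sum>i\<in>A. \<Sum>c\<in>B. f (i, c))"
  by (simp add: sum.cartesian_product)

text \<open>Euler's reflection formula at \<open>2 / \<alpha>\<close>, combined with the functional
  equation of Gamma.\<close>

lemma C_const_eq:
  assumes "2 < \<alpha>"
  shows "C_const \<alpha> = pi * Gamma (1 + 2 / \<alpha>) * Gamma (1 - 2 / \<alpha>)"
proof -
  define d where "d = 2 / \<alpha>"
  have d: "0 < d" using assms by (simp add: d_def)
  have "complex_of_real (Gamma d * Gamma (1 - d)) = Gamma (of_real d) * Gamma (1 - of_real d)"
    by (simp flip: Gamma_complex_of_real)
  also have "\<dots> = complex_of_real (pi / sin (pi * d))"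
    unfolding Gamma_reflection_complex by (simp flip: sin_of_real)
  finally have "Gamma d * Gamma (1 - d) = pi / sin (pi * d)" by (simp only: of_real_eq_iff)
  moreover have "Gamma (1 + d) = d * Gamma d"
    using d Gamma_plus1[of d] by (simp add: add.commute nonpos_Ints_def)
  ultimately have "pi * Gamma (1 + d) * Gamma (1 - d) = pi * (d * (pi / sin (pi * d)))"
    by (simp only: mult.assoc)
  then show ?thesis
    by (simp add: C_const_def d_def power2_eq_square divide_inverse mult_ac)
qed

text \<open>Fixes one enumeration \<open>X\<close> with counts \<open>N\<close> and marks
  \<open>H\<close>, so that the received powers become a family of random variables indexed by
  natural numbers.\<close>

locale marked_network = k_tier_network +
  fixes \<alpha> :: real and P \<beta> :: "nat \<Rightarrow> real"
    and N :: "nat \<times> bool \<Rightarrow> 'a \<Rightarrow> enat" and X :: "nat \<times> bool \<Rightarrow> nat \<Rightarrow> 'a \<Rightarrow> real ^ 2"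
    and H :: "nat \<times> bool \<Rightarrow> nat \<Rightarrow> 'a \<Rightarrow> real"
  assumes \<alpha>: "2 < \<alpha>"
    and lam_pos: "\<And>i. i \<in> {1..K} \<Longrightarrow> 0 < lam i"
    and P_pos: "\<And>i. i \<in> {1..K} \<Longrightarrow> 0 < P i"
    and p_range: "\<And>i. i \<in> {1..K} \<Longrightarrow> 0 \<le> p i \<and> p i \<le> 1"
    and p_nonzero: "\<exists>i\<in>{1..K}. p i \<noteq> 0"
    and beta_gt_1: "\<And>i. i \<in> {1..K} \<Longrightarrow> 1 < \<beta> i"
    and enum: "\<And>i c \<omega>. i \<in> {1..K} \<Longrightarrow> \<omega> \<in> space M \<Longrightarrow>
      bij_betw (\<lambda>n. X (i, c) n \<omega>) {n. enat n < N (i, c) \<omega>} (if c then Psi i \<omega> else Delta i \<omega>)"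
    and mark: "\<And>i c \<omega> n. i \<in> {1..K} \<Longrightarrow> \<omega> \<in> space M \<Longrightarrow> enat n < N (i, c) \<omega> \<Longrightarrow>
      h i \<omega> (X (i, c) n \<omega>) = H (i, c) n \<omega>"
    and marks: "exponential_marks ({1..K} \<times> UNIV) N X H"
begin

abbreviation "J \<equiv> {1..K} \<times> (UNIV :: bool set)"

definition \<delta> :: real where "\<delta> = 2 / \<alpha>"

lemma \<delta>: "0 < \<delta>" "\<delta> < 1"
  using \<alpha> by (auto simp: \<delta>_def)

text \<open>The factor of \<open>nn_integral_path_loss\<close>: a process of density
  \<open>l\<close> in tier \<open>i\<close> has powers of intensity
  \<open>l * density_const i\<close> times \<open>rho \<delta>\<close>.\<close>

definition density_const :: "nat \<Rightarrow> real" where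
  "density_const i = pi * P i powr \<delta> * Gamma (1 + \<delta>)"

lemma density_const_pos: "i \<in> {1..K} \<Longrightarrow> 0 < density_const i"
  using P_pos[of i] \<delta> by (auto simp: density_const_def intro!: mult_pos_pos Gamma_real_pos)

definition pw :: "nat \<times> bool \<Rightarrow> nat \<Rightarrow> 'a \<Rightarrow> real" where
  "pw j n \<omega> = P (fst j) * H j n \<omega> * norm (X j n \<omega>) powr (- \<alpha>)"

text \<open>The guard \<open>i \<in> {1..K}\<close> makes the variables measurable for every index,
  as \<open>shot_noise\<close> asks, although nothing is known of \<open>N\<close>, \<open>X\<close>
  and \<open>H\<close> outside the tiers.\<close>

definition S :: "bool \<Rightarrow> nat \<Rightarrow> nat \<Rightarrow> 'a \<Rightarrow> real" where
  "S c i n \<omega> = (if i \<in> {1..K} \<and> enat n < N (i, c) \<omega> then pw (i, c) n \<omega> else 0)"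

lemma one_measurable: "(\<lambda>_. 1) \<in> borel_measurable (borel \<Otimes>\<^sub>M borel)"
  by simp

lemma N_measurable: "j \<in> J \<Longrightarrow> N j \<in> measurable M (count_space UNIV)"
  and X_measurable: "j \<in> J \<Longrightarrow> X j n \<in> borel_measurable M"
  and H_measurable: "j \<in> J \<Longrightarrow> H j n \<in> borel_measurable M"
  using marked_finite_product(2-4)[OF _ marks one_measurable] by auto

lemma pw_measurable: "j \<in> J \<Longrightarrow> pw j n \<in> borel_measurable M"
proof -
  assume j: "j \<in> J"
  note [measurable] = X_measurable[OF j] H_measurable[OF j]
  show ?thesis unfolding pw_def by measurable
qed

lemma S_measurable: "S c i n \<in> borel_measurable M"
proof (cases "i \<in> {1..K}")
  case True
  then have j: "(i, c) \<in> J" by simp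
  note [measurable] = N_measurable[OF j] pw_measurable[OF j]
  show ?thesis unfolding S_def using True by simp
next
  case False
  then have "S c i n = (\<lambda>_. 0)" unfolding S_def by (simp only: simp_thms if_False)
  then show ?thesis by simp
qed

definition dens :: "nat \<times> bool \<Rightarrow> real" where
  "dens j = (if snd j then p (fst j) else 1 - p (fst j)) * lam (fst j)"

lemma dens_nonneg: "j \<in> J \<Longrightarrow> 0 \<le> dens j"
  using p_range[of "fst j"] lam_pos[of "fst j"] by (cases j) (auto simp: dens_def)

text \<open>\<open>marked_Laplace\<close> is applied to the 2K processes, and each integral over the
  plane is moved to \<open>rho \<delta>\<close> by \<open>nn_integral_path_loss\<close>. Vanishing
  at nonpositive arguments is used twice: it removes absent stations from the sums, and the
  path-loss integral asks for it.\<close>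

lemma network_Laplace_functional:
  fixes f g :: "nat \<Rightarrow> real \<Rightarrow> ennreal"
  assumes [measurable]: "\<And>i. f i \<in> borel_measurable borel" "\<And>i. g i \<in> borel_measurable borel"
    and f0: "\<And>i s. s \<le> 0 \<Longrightarrow> f i s = 0" and g0: "\<And>i s. s \<le> 0 \<Longrightarrow> g i s = 0"
  shows "(\<integral>\<omega>. nexp ((\<Sum>i=1..K. \<Sum>n. f i (S True i n \<omega>)) + (\<Sum>i=1..K. \<Sum>n. g i (S False i n \<omega>))) \<partial>M)
    = nexp ((\<Sum>i=1..K. ennreal (p i * lam i * density_const i) * (\<integral>\<^sup>+s. ennreal (1 - nexp (f i s)) \<partial>rho \<delta>)) +
            (\<Sum>i=1..K. ennreal ((1 - p i) * lam i * density_const i) * (\<integral>\<^sup>+s. ennreal (1 - nexp (g i s)) \<partial>rho \<delta>)))"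
proof -
  define \<Theta> where "\<Theta> = (\<lambda>(i, active). if active then Psi i else Delta i)"
  define F where "F j z = (if snd j then f (fst j) else g (fst j)) (P (fst j) * snd z * norm (fst z) powr (- \<alpha>))"
    for j :: "nat \<times> bool" and z :: "(real ^ 2) \<times> real"
  have [measurable]: "F j \<in> borel_measurable (borel \<Otimes>\<^sub>M borel)" for j
    unfolding F_def by (cases "snd j") auto
  have ppp: "homogeneous_ppp M (dens j) (\<Theta> j)" if "j \<in> J" for j
    using that Psi_ppp Delta_ppp by (cases j) (auto simp: dens_def \<Theta>_def)
  have en: "bij_betw (\<lambda>n. X j n \<omega>) {n. enat n < N j \<omega>} (\<Theta> j \<omega>)" if "j \<in> J" "\<omega> \<in> space M" for j \<omega>
    using enum[of "fst j" \<omega> "snd j"] that by (cases j) (auto simp: \<Theta>_def)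
  have main: "(\<integral>\<^sup>+\<omega>. ennreal (nexp (\<Sum>j\<in>J. \<Sum>n. if enat n < N j \<omega> then F j (X j n \<omega>, H j n \<omega>) else 0)) \<partial>M)
       = ennreal (nexp (\<Sum>j\<in>J. ennreal (dens j) * (\<integral>\<^sup>+x. \<integral>\<^sup>+h. ennreal (1 - nexp (F j (x, h))) \<partial>E1 \<partial>lborel)))"
    by (rule marked_Laplace[OF _ _ ppp dens_nonneg en marks])
       (use Psi_Delta_indep in \<open>auto simp: \<Theta>_def\<close>)
  have lhs: "(\<Sum>j\<in>J. \<Sum>n. if enat n < N j \<omega> then F j (X j n \<omega>, H j n \<omega>) else 0)
      = (\<Sum>i=1..K. \<Sum>n. f i (S True i n \<omega>)) + (\<Sum>i=1..K. \<Sum>n. g i (S False i n \<omega>))" for \<omega>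
  proof -
    have "(\<Sum>j\<in>J. \<Sum>n. if enat n < N j \<omega> then F j (X j n \<omega>, H j n \<omega>) else 0)
        = (\<Sum>i=1..K. \<Sum>c\<in>UNIV. \<Sum>n. if enat n < N (i, c) \<omega> then F (i, c) (X (i, c) n \<omega>, H (i, c) n \<omega>) else 0)"
      by (rule sum_pairs)
    also have "\<dots> = (\<Sum>i=1..K. (\<Sum>n. f i (S True i n \<omega>)) + (\<Sum>n. g i (S False i n \<omega>)))"
    proof (rule sum.cong[OF refl])
      fix i assume i: "i \<in> {1..K}"
      have "(if enat n < N (i, True) \<omega> then F (i, True) (X (i, True) n \<omega>, H (i, True) n \<omega>) else 0) = f i (S True i n \<omega>)" for n
        using i by (simp add: F_def S_def pw_def f0)
      moreover have "(if enat n < N (i, False) \<omega> then F (i, False) (X (i, False) n \<omega>, H (i, False) n \<omega>) else 0) = g i (S False i n \<omega>)" for n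
        using i by (simp add: F_def S_def pw_def g0)
      ultimately show "(\<Sum>c\<in>UNIV. \<Sum>n. if enat n < N (i, c) \<omega> then F (i, c) (X (i, c) n \<omega>, H (i, c) n \<omega>) else 0)
          = (\<Sum>n. f i (S True i n \<omega>)) + (\<Sum>n. g i (S False i n \<omega>))"
        by (simp add: UNIV_bool add.commute)
    qed
    finally show ?thesis by (simp only: sum.distrib)
  qed
  have rhs: "(\<Sum>j\<in>J. ennreal (dens j) * (\<integral>\<^sup>+x. \<integral>\<^sup>+h. ennreal (1 - nexp (F j (x, h))) \<partial>E1 \<partial>lborel))
      = (\<Sum>i=1..K. ennreal (p i * lam i * density_const i) * (\<integral>\<^sup>+s. ennreal (1 - nexp (f i s)) \<partial>rho \<delta>)) +
            (\<Sum>i=1..K. ennreal ((1 - p i) * lam i * density_const i) * (\<integral>\<^sup>+s. ennreal (1 - nexp (g i s)) \<partial>rho \<delta>))"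
  proof -
    have path: "ennreal (dens (i, c)) * (\<integral>\<^sup>+(x::real^2). \<integral>\<^sup>+h. ennreal (1 - nexp (q (P i * h * norm x powr (- \<alpha>)))) \<partial>E1 \<partial>lborel)
       = ennreal (dens (i, c) * density_const i) * (\<integral>\<^sup>+s. ennreal (1 - nexp (q s)) \<partial>rho \<delta>)"
      if i: "i \<in> {1..K}" and [measurable]: "q \<in> borel_measurable borel" and "\<And>s. s \<le> 0 \<Longrightarrow> q s = 0" for i c and q :: "real \<Rightarrow> ennreal"
    proof -
      have "(\<integral>\<^sup>+(x::real^2). \<integral>\<^sup>+h. ennreal (1 - nexp (q (P i * h * norm x powr (- \<alpha>)))) \<partial>E1 \<partial>lborel)
        = ennreal (density_const i) * (\<integral>\<^sup>+s. ennreal (1 - nexp (q s)) \<partial>rho \<delta>)"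
        unfolding density_const_def \<delta>_def
        by (rule nn_integral_path_loss[OF P_pos[OF i] \<alpha>, of "\<lambda>s. ennreal (1 - nexp (q s))"]) (auto simp: that)
      then show ?thesis using dens_nonneg[of "(i, c)"] i by (simp add: ennreal_mult' mult.assoc)
    qed
    have "(\<Sum>j\<in>J. ennreal (dens j) * (\<integral>\<^sup>+x. \<integral>\<^sup>+h. ennreal (1 - nexp (F j (x, h))) \<partial>E1 \<partial>lborel))
       = (\<Sum>i=1..K. \<Sum>c\<in>UNIV. ennreal (dens (i, c)) * (\<integral>\<^sup>+x. \<integral>\<^sup>+h. ennreal (1 - nexp (F (i, c) (x, h))) \<partial>E1 \<partial>lborel))"
      by (rule sum_pairs)
    also have "\<dots> = (\<Sum>i=1..K. ennreal (p i * lam i * density_const i) * (\<integral>\<^sup>+s. ennreal (1 - nexp (f i s)) \<partial>rho \<delta>) +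
       ennreal ((1 - p i) * lam i * density_const i) * (\<integral>\<^sup>+s. ennreal (1 - nexp (g i s)) \<partial>rho \<delta>))"
    proof (rule sum.cong[OF refl])
      fix i assume i: "i \<in> {1..K}"
      show "(\<Sum>c\<in>UNIV. ennreal (dens (i, c)) * (\<integral>\<^sup>+x. \<integral>\<^sup>+h. ennreal (1 - nexp (F (i, c) (x, h))) \<partial>E1 \<partial>lborel))
        = ennreal (p i * lam i * density_const i) * (\<integral>\<^sup>+s. ennreal (1 - nexp (f i s)) \<partial>rho \<delta>) +
       ennreal ((1 - p i) * lam i * density_const i) * (\<integral>\<^sup>+s. ennreal (1 - nexp (g i s)) \<partial>rho \<delta>)"
        using path[OF i, of "f i" True] path[OF i, of "g i" False]
        by (simp add: UNIV_bool F_def f0 g0 dens_def add.commute)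
    qed
    finally show ?thesis by (simp only: sum.distrib)
  qed
  have "(\<lambda>\<omega>. nexp ((\<Sum>i=1..K. \<Sum>n. f i (S True i n \<omega>)) + (\<Sum>i=1..K. \<Sum>n. g i (S False i n \<omega>)))) \<in> borel_measurable M"
    using S_measurable by measurable
  then show ?thesis
    using main unfolding lhs rhs by (simp add: integral_eq_nn_integral)
qed

sublocale shot_noise M K \<delta> "\<lambda>i. p i * lam i * density_const i" "\<lambda>i. (1 - p i) * lam i * density_const i" \<beta> "S True" "S False"
proof
  show "0 \<le> p i * lam i * density_const i" if "i \<in> {1..K}" for i
    using p_range[OF that] lam_pos[OF that] density_const_pos[OF that] by simp
  show "0 \<le> (1 - p i) * lam i * density_const i" if "i \<in> {1..K}" for i
    using p_range[OF that] lam_pos[OF that] density_const_pos[OF that] by simp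
  obtain i where i: "i \<in> {1..K}" "p i \<noteq> 0" using p_nonzero by blast
  then have "0 < p i * lam i * density_const i"
    using p_range[OF i(1)] lam_pos[OF i(1)] density_const_pos[OF i(1)] by simp
  then show "\<exists>i\<in>{1..K}. 0 < p i * lam i * density_const i" using i by blast
qed (use \<delta> beta_gt_1 S_measurable network_Laplace_functional in auto)


section \<open>The outage event in terms of the enumerated powers\<close>

definition max_rx :: "bool \<Rightarrow> nat \<Rightarrow> 'a \<Rightarrow> real" where
  "max_rx c i \<omega> = max_power \<alpha> (P i) (h i \<omega>) (if c then Psi i \<omega> else Delta i \<omega>)"

lemma rx_power_X:
  assumes "i \<in> {1..K}" "\<omega> \<in> space M" "enat n < N (i, c) \<omega>"
  shows "rx_power \<alpha> (P i) (h i \<omega>) (X (i, c) n \<omega>) = pw (i, c) n \<omega>"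
  using mark[OF assms] by (simp add: rx_power_def pw_def)

lemma max_rx_eq:
  assumes i: "i \<in> {1..K}" and \<omega>: "\<omega> \<in> space M"
  shows "max_rx c i \<omega> = (if N (i, c) \<omega> = 0 then 0 else SUP n\<in>{n. enat n < N (i, c) \<omega>}. pw (i, c) n \<omega>)"
proof -
  have "max_rx c i \<omega> = (if N (i, c) \<omega> = 0 then 0
      else SUP n\<in>{n. enat n < N (i, c) \<omega>}. rx_power \<alpha> (P i) (h i \<omega>) (X (i, c) n \<omega>))"
    unfolding max_rx_def max_power_def by (rule SUP_bij_enum[OF enum[OF i \<omega>]])
  also have "(SUP n\<in>{n. enat n < N (i, c) \<omega>}. rx_power \<alpha> (P i) (h i \<omega>) (X (i, c) n \<omega>))
      = (SUP n\<in>{n. enat n < N (i, c) \<omega>}. pw (i, c) n \<omega>)"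
    using rx_power_X[OF i \<omega>] by (intro SUP_cong) auto
  finally show ?thesis .
qed

lemma max_rx_measurable: "i \<in> {1..K} \<Longrightarrow> max_rx c i \<in> borel_measurable M"
proof -
  assume i: "i \<in> {1..K}"
  have "(\<lambda>\<omega>. if N (i, c) \<omega> = 0 then 0 else SUP n\<in>{n. enat n < N (i, c) \<omega>}. pw (i, c) n \<omega>) \<in> borel_measurable M"
    using i by (intro measurable_SUP_enum pw_measurable N_measurable) auto
  then show ?thesis
    by (rule measurable_cong[THEN iffD1, rotated]) (simp add: max_rx_eq[OF i])
qed

definition total_rx :: "'a \<Rightarrow> real" where
  "total_rx \<omega> = total_power K \<alpha> P (\<lambda>i. h i \<omega>) (\<lambda>i. Psi i \<omega>)"

lemma total_rx_eq:
  assumes \<omega>: "\<omega> \<in> space M"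
  shows "total_rx \<omega> = (\<Sum>i=1..K. infsum (\<lambda>n. S True i n \<omega>) UNIV)"
  unfolding total_rx_def total_power_def
proof (rule sum.cong[OF refl])
  fix i assume i: "i \<in> {1..K}"
  have "infsum (rx_power \<alpha> (P i) (h i \<omega>)) (Psi i \<omega>)
      = infsum (\<lambda>n. if enat n < N (i, True) \<omega> then rx_power \<alpha> (P i) (h i \<omega>) (X (i, True) n \<omega>) else 0) UNIV"
    using infsum_bij_enum[OF enum[OF i \<omega>, of True]] by simp
  also have "\<dots> = infsum (\<lambda>n. S True i n \<omega>) UNIV"
    using rx_power_X[OF i \<omega>] i by (intro infsum_cong) (simp add: S_def)
  finally show "infsum (rx_power \<alpha> (P i) (h i \<omega>)) (Psi i \<omega>) = infsum (\<lambda>n. S True i n \<omega>) UNIV" .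
qed

lemma total_rx_measurable: "total_rx \<in> borel_measurable M"
proof -
  have "(\<lambda>\<omega>. \<Sum>i=1..K. infsum (\<lambda>n. S True i n \<omega>) UNIV) \<in> borel_measurable M"
    by (intro borel_measurable_sum measurable_infsum_nat S_measurable)
  then show ?thesis
    by (rule measurable_cong[THEN iffD1, rotated]) (simp add: total_rx_eq)
qed

definition max_rx_all :: "'a \<Rightarrow> real" where
  "max_rx_all \<omega> = Max ((\<lambda>i. max_rx True i \<omega>) ` {1..K})"

lemma max_rx_all_measurable: "max_rx_all \<in> borel_measurable M"
  unfolding max_rx_all_def using max_rx_measurable by (intro borel_measurable_Max) auto

definition outage :: "'a \<Rightarrow> real" where
  "outage \<omega> = (\<Prod>i\<in>{1..K}. of_bool (max_rx True i \<omega> / (total_rx \<omega> - max_rx_all \<omega>) < \<beta> i) * of_bool (max_rx False i \<omega> / total_rx \<omega> < \<beta> i))"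

lemma coverage_prob_eq: "coverage_prob M K \<alpha> P \<beta> Psi Delta h = 1 - (\<integral>\<omega>. outage \<omega> \<partial>M)"
  by (simp add: coverage_prob_def outage_def max_rx_def total_rx_def max_rx_all_def max_power_all_def Let_def)

lemma outage_measurable [measurable]: "outage \<in> borel_measurable M"
  unfolding outage_def
proof (rule borel_measurable_prod)
  fix i assume i: "i \<in> {1..K}"
  note [measurable] = max_rx_measurable[OF i] max_rx_all_measurable total_rx_measurable
  show "(\<lambda>\<omega>. of_bool (max_rx True i \<omega> / (total_rx \<omega> - max_rx_all \<omega>) < \<beta> i) * of_bool (max_rx False i \<omega> / total_rx \<omega> < \<beta> i) :: real) \<in> borel_measurable M"
    by measurable
qed

lemma AE_H_pos: "AE \<omega> in M. \<forall>j\<in>J. \<forall>n. 0 \<le> H j n \<omega>"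
proof -
  have "AE \<omega> in M. 0 \<le> H j n \<omega>" if j: "j \<in> J" for j n
  proof -
    have "AE x in distr M lborel (H j n). 0 \<le> x"
    proof -
      have "AE x in E1. 0 \<le> x" by (subst AE_density) (auto simp: exponential_density_def)
      moreover have "distr M lborel (H j n) = E1"
      proof -
        have "distributed M lborel (H j n) (exponential_density 1)"
          using marks j unfolding exponential_marks_def by blast
        then show ?thesis by (simp add: distributed_def)
      qed
      ultimately show ?thesis by (simp only:)
    qed
    then show ?thesis
      using H_measurable[OF j, of n] by (subst (asm) AE_distr_iff) auto
  qed
  then show ?thesis by (subst AE_ball_countable) (auto simp: AE_all_countable)
qed

text \<open>Collects almost sure properties so that the outage event can be analysed outcome by
  outcome.\<close>

definition good :: "'a \<Rightarrow> bool" where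
  "good \<omega> \<longleftrightarrow> \<omega> \<in> space M \<and> Itot \<omega> = ennreal (R \<omega>) \<and> 0 < R \<omega> \<and> Ymax \<omega> = ennreal (Y \<omega>) \<and>
     (\<forall>i\<in>{1..K}. \<forall>n. 0 < S True i n \<omega> \<longrightarrow> S True i n \<omega> < R \<omega>) \<and> (\<forall>j\<in>J. \<forall>n. 0 \<le> H j n \<omega>)"

lemma AE_good: "AE \<omega> in M. good \<omega>"
  using AE_finite AE_less_R AE_H_pos AE_space by eventually_elim (simp add: good_def)

lemma good_S_nonneg: "good \<omega> \<Longrightarrow> 0 \<le> S c i n \<omega>"
  using P_pos[of i] by (auto simp: good_def S_def pw_def)

lemma good_pw_nonneg: "good \<omega> \<Longrightarrow> i \<in> {1..K} \<Longrightarrow> 0 \<le> pw (i, c) n \<omega>"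
  using P_pos[of i] by (auto simp: good_def pw_def)

lemma good_summable:
  assumes g: "good \<omega>" and i: "i \<in> {1..K}"
  shows "summable (\<lambda>n. S True i n \<omega>)"
proof -
  have "(\<Sum>n. ennreal (S True i n \<omega>)) \<le> Itot \<omega>"
    unfolding Itot_def using i by (intro member_le_sum) auto
  also have "\<dots> < \<top>" using g by (simp add: good_def)
  finally have "(\<Sum>n. ennreal (S True i n \<omega>)) \<noteq> \<top>" by simp
  then show ?thesis
    using summable_suminf_not_top[of "\<lambda>n. S True i n \<omega>", OF good_S_nonneg[OF g]] by blast
qed

lemma good_tp:
  assumes g: "good \<omega>"
  shows "total_rx \<omega> = R \<omega>"
proof -
  have e: "(\<Sum>n. ennreal (S True i n \<omega>)) = ennreal (\<Sum>n. S True i n \<omega>)" if "i \<in> {1..K}" for i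
    by (rule suminf_ennreal2) (use good_S_nonneg[OF g] good_summable[OF g that] in auto)
  have nn: "0 \<le> (\<Sum>n. S True i n \<omega>)" if "i \<in> {1..K}" for i
    by (rule suminf_nonneg) (use good_S_nonneg[OF g] good_summable[OF g that] in auto)
  have "total_rx \<omega> = (\<Sum>i=1..K. \<Sum>n. S True i n \<omega>)"
  proof -
    have "infsum (\<lambda>n. S True i n \<omega>) UNIV = (\<Sum>n. S True i n \<omega>)" if "i \<in> {1..K}" for i
      using good_S_nonneg[OF g] e[OF that] by (simp add: infsum_nat_eq_suminf)
    then show ?thesis using g by (simp add: total_rx_eq good_def)
  qed
  moreover have "Itot \<omega> = ennreal (\<Sum>i=1..K. \<Sum>n. S True i n \<omega>)"
    unfolding Itot_def using e nn by (subst sum_ennreal[symmetric]) auto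
  moreover have "0 \<le> (\<Sum>i=1..K. \<Sum>n. S True i n \<omega>)" using nn by (intro sum_nonneg) auto
  ultimately show ?thesis by (simp add: R_def)
qed

lemma max_rx_attained:
  assumes g: "good \<omega>" and i: "i \<in> {1..K}" and m: "\<And>n. S c i n \<omega> \<le> S c i m \<omega>"
  shows "max_rx c i \<omega> = S c i m \<omega>"
  using SUP_enum_eq_max[of "N (i, c) \<omega>" "\<lambda>n. pw (i, c) n \<omega>" m] m i g good_pw_nonneg[OF g i]
  by (simp add: max_rx_eq[OF i] good_def S_def)

text \<open>The left side subtracts the overall maximum, the right side the station's own power. A
  station violating either condition has power above \<open>R \<omega>\<close> minus the subtracted
  power, since its threshold exceeds 1. Two distinct stations together have at most
  \<open>R \<omega>\<close>, so the violating station must be the maximal one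
  \<open>(i0, n0)\<close>, and for that station both conditions coincide. The maxima are attained
  because the active powers are summable.\<close>

lemma good_uncov:
  assumes g: "good \<omega>"
  shows "(\<forall>i\<in>{1..K}. max_rx True i \<omega> / (total_rx \<omega> - max_rx_all \<omega>) < \<beta> i) \<longleftrightarrow>
    (\<forall>i\<in>{1..K}. \<forall>n. \<not> (0 < S True i n \<omega> \<and> \<beta> i * (R \<omega> - S True i n \<omega>) \<le> S True i n \<omega>))"
proof -
  have "\<exists>m. \<forall>n. S True i n \<omega> \<le> S True i m \<omega>" if i: "i \<in> {1..K}" for i
    by (rule summable_nonneg_attains_max[OF good_summable[OF g i] good_S_nonneg[OF g]]) blast
  then obtain m where m: "\<And>i n. i \<in> {1..K} \<Longrightarrow> S True i n \<omega> \<le> S True i (m i) \<omega>" by metis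
  have max_rx: "max_rx True i \<omega> = S True i (m i) \<omega>" if "i \<in> {1..K}" for i
    by (rule max_rx_attained[OF g that]) (rule m[OF that])
  have K: "{1..K} \<noteq> {}" using p_nonzero by blast
  have "max_rx_all \<omega> \<in> (\<lambda>i. max_rx True i \<omega>) ` {1..K}" unfolding max_rx_all_def using K by (intro Max_in) auto
  then obtain i0 where i0: "i0 \<in> {1..K}" "max_rx_all \<omega> = max_rx True i0 \<omega>" by blast
  define n0 where "n0 = m i0"
  have max_rx_all: "max_rx_all \<omega> = S True i0 n0 \<omega>" using i0 max_rx by (simp add: n0_def)
  have le: "S True i n \<omega> \<le> S True i0 n0 \<omega>" if "i \<in> {1..K}" for i n
  proof -
    have "max_rx True i \<omega> \<le> max_rx_all \<omega>" unfolding max_rx_all_def using that by (intro Max_ge) auto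
    then show ?thesis using m[OF that, of n] max_rx[OF that] max_rx_all by simp
  qed
  have pair: "S True i n \<omega> + S True i' n' \<omega> \<le> R \<omega>" if "i \<in> {1..K}" "i' \<in> {1..K}" "(i, n) \<noteq> (i', n')" for i i' n n'
    using pair_le_Itot[OF that, of \<omega>] g good_S_nonneg[OF g]
    by (simp add: good_def ennreal_le_iff flip: ennreal_plus)
  have S0: "0 < S True i0 n0 \<omega>"
  proof (rule ccontr)
    assume "\<not> 0 < S True i0 n0 \<omega>"
    then have "S True i n \<omega> = 0" if "i \<in> {1..K}" for i n
      using le[OF that, of n] good_S_nonneg[OF g, of True i n] by simp
    then have "Itot \<omega> = 0" by (simp add: Itot_def)
    then have "R \<omega> = 0" by (simp add: R_def)
    then show False using g unfolding good_def by linarith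
  qed
  have S0R: "S True i0 n0 \<omega> < R \<omega>" using S0 g i0 by (simp add: good_def)
  have lt_iff: "max_rx True i \<omega> / (total_rx \<omega> - max_rx_all \<omega>) < \<beta> i \<longleftrightarrow> S True i (m i) \<omega> < \<beta> i * (R \<omega> - S True i0 n0 \<omega>)"
    if "i \<in> {1..K}" for i
    using S0R by (simp add: max_rx[OF that] good_tp[OF g] max_rx_all pos_divide_less_eq)
  have big: "R \<omega> - x < \<beta> i * (R \<omega> - x)" if "i \<in> {1..K}" "x < R \<omega>" for i x
    using beta_gt_1[OF that(1)] that(2) by simp
  show ?thesis
  proof (intro iffI ballI allI notI)
    fix i n assume L: "\<forall>i\<in>{1..K}. max_rx True i \<omega> / (total_rx \<omega> - max_rx_all \<omega>) < \<beta> i" and i: "i \<in> {1..K}"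
      and c: "0 < S True i n \<omega> \<and> \<beta> i * (R \<omega> - S True i n \<omega>) \<le> S True i n \<omega>"
    then have "S True i n \<omega> < R \<omega>" using g by (simp add: good_def)
    with big[OF i this] c have half: "R \<omega> - S True i n \<omega> < S True i n \<omega>" by linarith
    have "(i, n) = (i0, n0)"
      using pair[OF i i0(1), of n n0] half le[OF i, of n] by fastforce
    then have "S True i0 n0 \<omega> < \<beta> i0 * (R \<omega> - S True i0 n0 \<omega>)"
      using L i lt_iff[OF i] by (simp add: n0_def)
    then show False using c \<open>(i, n) = (i0, n0)\<close> by simp
  next
    fix i assume U: "\<forall>i\<in>{1..K}. \<forall>n. \<not> (0 < S True i n \<omega> \<and> \<beta> i * (R \<omega> - S True i n \<omega>) \<le> S True i n \<omega>)"
      and i: "i \<in> {1..K}"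
    show "max_rx True i \<omega> / (total_rx \<omega> - max_rx_all \<omega>) < \<beta> i"
    proof (rule ccontr)
      assume "\<not> max_rx True i \<omega> / (total_rx \<omega> - max_rx_all \<omega>) < \<beta> i"
      then have ge: "\<beta> i * (R \<omega> - S True i0 n0 \<omega>) \<le> S True i (m i) \<omega>" using lt_iff[OF i] by simp
      with big[OF i S0R] have "R \<omega> - S True i0 n0 \<omega> < S True i (m i) \<omega>" by linarith
      then have "(i, m i) = (i0, n0)" using pair[OF i i0(1), of "m i" n0] by fastforce
      then show False using U i0(1) S0 ge by auto
    qed
  qed
qed

text \<open>For idle powers \<open>good\<close> provides a finite supremum but no summability, so
  two bounds replace an attained maximum: every power is at most
  \<open>max_rx False i \<omega>\<close>, which is at most \<open>\<beta> i * Y \<omega>\<close>.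
  The strict inequality survives the supremum over tiers because there are finitely many of
  them.\<close>

lemma good_idle:
  assumes g: "good \<omega>"
  shows "(\<forall>i\<in>{1..K}. max_rx False i \<omega> / total_rx \<omega> < \<beta> i) \<longleftrightarrow> Y \<omega> < R \<omega>"
proof -
  have R: "0 < R \<omega>" and Yeq: "Ymax \<omega> = ennreal (Y \<omega>)" and \<omega>: "\<omega> \<in> space M" using g by (auto simp: good_def)
  have lt_iff: "max_rx False i \<omega> / total_rx \<omega> < \<beta> i \<longleftrightarrow> max_rx False i \<omega> / \<beta> i < R \<omega>" if "i \<in> {1..K}" for i
    using R beta_gt_1[OF that] by (simp add: good_tp[OF g] field_simps)
  have V_le: "S False i n \<omega> \<le> \<beta> i * Y \<omega>" if i: "i \<in> {1..K}" for i n
  proof -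
    have "ennreal (S False i n \<omega> / \<beta> i) \<le> Ymax \<omega>"
      unfolding Ymax_def using i by (intro SUP_upper2[of i] SUP_upper) auto
    then have "S False i n \<omega> / \<beta> i \<le> Y \<omega>" unfolding Yeq by (simp add: ennreal_le_iff)
    then show ?thesis using \<beta>[OF i] by (simp add: field_simps)
  qed
  have pw_le: "pw (i, False) n \<omega> \<le> \<beta> i * Y \<omega>" if "i \<in> {1..K}" "enat n < N (i, False) \<omega>" for i n
    using V_le[OF that(1), of n] that by (simp add: S_def)
  have le_Y: "max_rx False i \<omega> \<le> \<beta> i * Y \<omega>" if i: "i \<in> {1..K}" for i
  proof (cases "N (i, False) \<omega> = 0")
    case True
    then show ?thesis using \<beta>[OF i] by (simp add: max_rx_eq[OF i \<omega>])
  next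
    case False
    then have "{n. enat n < N (i, False) \<omega>} \<noteq> {}"
      by (metis (mono_tags) empty_iff mem_Collect_eq not_gr_zero zero_enat_def)
    then have "(SUP n\<in>{n. enat n < N (i, False) \<omega>}. pw (i, False) n \<omega>) \<le> \<beta> i * Y \<omega>"
      using pw_le[OF i] by (intro cSUP_least) auto
    then show ?thesis using False by (simp add: max_rx_eq[OF i \<omega>])
  qed
  have le_mp: "S False i n \<omega> \<le> max_rx False i \<omega>" if i: "i \<in> {1..K}" for i n
  proof (cases "N (i, False) \<omega> = 0")
    case True
    then show ?thesis using i by (simp add: max_rx_eq[OF i \<omega>] S_def zero_enat_def[symmetric])
  next
    case False
    have bdd: "bdd_above ((\<lambda>n. pw (i, False) n \<omega>) ` {n. enat n < N (i, False) \<omega>})"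
      using pw_le[OF i] by (auto simp: bdd_above_def)
    have up: "pw (i, False) n \<omega> \<le> max_rx False i \<omega>" if "enat n < N (i, False) \<omega>" for n
      using cSUP_upper[OF _ bdd, of n] that False by (simp add: max_rx_eq[OF i \<omega>])
    show ?thesis
    proof (cases "enat n < N (i, False) \<omega>")
      case True
      then show ?thesis using up i by (simp add: S_def)
    next
      case out: False
      have "enat 0 < N (i, False) \<omega>" using False by (metis not_gr_zero zero_enat_def)
      then have "0 \<le> max_rx False i \<omega>" using up[of 0] good_pw_nonneg[OF g i, of False 0] by simp
      then show ?thesis using out by (simp add: S_def)
    qed
  qed
  show ?thesis
  proof
    assume L: "\<forall>i\<in>{1..K}. max_rx False i \<omega> / total_rx \<omega> < \<beta> i"
    define r where "r = Max ((\<lambda>i. max_rx False i \<omega> / \<beta> i) ` {1..K})"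
    have K: "{1..K} \<noteq> {}" using p_nonzero by blast
    then have "r \<in> (\<lambda>i. max_rx False i \<omega> / \<beta> i) ` {1..K}" unfolding r_def by (intro Max_in) auto
    then have r: "r < R \<omega>" using L lt_iff by auto
    have "Ymax \<omega> \<le> ennreal r"
      unfolding Ymax_def
    proof (intro SUP_least ennreal_leI)
      fix i n assume i: "i \<in> {1..K}"
      have "S False i n \<omega> / \<beta> i \<le> max_rx False i \<omega> / \<beta> i"
        using le_mp[OF i] \<beta>[OF i] by (intro divide_right_mono) auto
      also have "\<dots> \<le> r" unfolding r_def using i by (intro Max_ge) auto
      finally show "S False i n \<omega> / \<beta> i \<le> r" .
    qed
    also have "\<dots> < ennreal (R \<omega>)" using r R by (intro ennreal_lessI)
    finally show "Y \<omega> < R \<omega>" unfolding Yeq by (simp add: ennreal_less_iff)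
  next
    assume YR: "Y \<omega> < R \<omega>"
    have "max_rx False i \<omega> < \<beta> i * R \<omega>" if "i \<in> {1..K}" for i
      by (rule le_less_trans[OF le_Y[OF that] mult_strict_left_mono[OF YR \<beta>[OF that]]])
    then show "\<forall>i\<in>{1..K}. max_rx False i \<omega> / total_rx \<omega> < \<beta> i"
      using lt_iff \<beta> by (auto simp: pos_divide_less_eq mult.commute)
  qed
qed

lemma good_outage:
  assumes g: "good \<omega>"
  shows "outage \<omega> = indicator {..<R \<omega>} (Y \<omega>) * uncov \<omega>"
proof -
  have "outage \<omega> = of_bool (\<forall>i\<in>{1..K}. max_rx True i \<omega> / (total_rx \<omega> - max_rx_all \<omega>) < \<beta> i) * of_bool (\<forall>i\<in>{1..K}. max_rx False i \<omega> / total_rx \<omega> < \<beta> i)"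
    unfolding outage_def prod.distrib
    by (intro arg_cong2[where f="(*)"]) (auto simp: of_bool_def prod_zero_iff)
  then show ?thesis
    unfolding good_uncov[OF g] good_idle[OF g] by (simp add: uncov_def indicator_def)
qed

lemma coverage_prob_uncov: "coverage_prob M K \<alpha> P \<beta> Psi Delta h = 1 - (\<integral>\<omega>. indicator {..<R \<omega>} (Y \<omega>) * uncov \<omega> \<partial>M)"
proof -
  have [measurable]: "(\<lambda>\<omega>. indicator {..<R \<omega>} (Y \<omega>) :: real) \<in> borel_measurable M"
    unfolding indicator_def lessThan_iff by measurable
  have "(\<integral>\<omega>. outage \<omega> \<partial>M) = (\<integral>\<omega>. indicator {..<R \<omega>} (Y \<omega>) * uncov \<omega> \<partial>M)"
    by (rule integral_cong_AE) (use AE_good good_outage in \<open>auto elim!: eventually_mono\<close>)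
  then show ?thesis by (simp add: coverage_prob_eq)
qed


section \<open>Identification of the constants and the final bounds\<close>

lemma eta_eq: "eta = eta_const K \<alpha> lam P p"
  unfolding eta_def unfolding eta_const_def C_const_eq[OF \<alpha>] density_const_def \<delta>_def
  by (simp add: sum_distrib_left mult_ac)

lemma idle_const_eq: "idle_const = A_const K \<alpha> lam P p \<beta>"
  unfolding idle_const_def unfolding A_const_def density_const_def \<delta>_def
  by (simp add: sum_distrib_left mult_ac)

text \<open>The factorial of the moments cancels that of the Taylor coefficient, and the covering
  part carries one more power of \<open>eta\<close>, whence the quotient of \<open>B_coeff\<close>
  by \<open>eta_const\<close>. Positivity of \<open>n\<close> selects the hypergeometric branch of
  \<open>hyp_factor\<close>.\<close>

lemma g_term_eq:
  assumes "0 < n"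
  shows "(- idle_const) ^ n / fact n * uncov_moment n = g_term K \<alpha> lam P p \<beta> n"
proof -
  define G1 where "G1 = Gamma (1 + real n * \<delta>)"
  define G2 where "G2 = Gamma (1 + real (Suc n) * \<delta>)"
  have G2: "G2 \<noteq> 0"
    unfolding G2_def using \<delta> by (intro less_imp_neq[symmetric] Gamma_real_pos add_pos_nonneg) auto
  have G1: "G1 \<noteq> 0"
    unfolding G1_def using \<delta> by (intro less_imp_neq[symmetric] Gamma_real_pos add_pos_nonneg) auto
  define B where "B = B_coeff K \<alpha> lam P p \<beta> n"
  have "pi * Gamma (1 + \<delta>) * B = (\<Sum>i=1..K. p i * lam i * density_const i * \<beta> i powr (- \<delta>) * hyp_factor n (\<beta> i))"
    unfolding B_def B_coeff_def sum_distrib_left hyp_factor_def unfolding density_const_def \<delta>_def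
    using assms by (intro sum.cong refl) (simp add: mult_ac add.commute)
  then have "(\<Sum>i=1..K. cov_moment n i) = pi * Gamma (1 + \<delta>) * B * fact n / (G2 * eta ^ Suc n)"
    unfolding cov_moment_def unfolding G2_def by (simp only: sum_divide_distrib sum_distrib_right)
  then have "uncov_moment n = fact n / (G1 * eta ^ n) - pi * Gamma (1 + \<delta>) * B * fact n / (G2 * eta ^ Suc n)"
    by (simp only: uncov_moment_def G1_def)
  moreover have "(- x) ^ n / f * (f / (G1 * e ^ n) - c * B * f / (G2 * e ^ Suc n)) = (- (x / e)) ^ n * (1 / G1 - B / e * (c / G2))"
    if "e \<noteq> 0" "f \<noteq> 0" for x e f c :: real
  proof -
    have "(- (x / e)) ^ n = (- x) ^ n / e ^ n" by (metis minus_divide_left power_divide)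
    moreover have "y / f * (f / (G1 * z) - c * B * f / (G2 * (e * z))) = y / z * (1 / G1 - B / e * (c / G2))" if "z \<noteq> 0" for y z
      using that \<open>e \<noteq> 0\<close> \<open>f \<noteq> 0\<close> G1 G2 by (simp add: field_simps)
    ultimately show ?thesis using that(1) by simp
  qed
  ultimately have "(- idle_const) ^ n / fact n * uncov_moment n = (- (idle_const / eta)) ^ n * (1 / G1 - B / eta * (pi * Gamma (1 + \<delta>) / G2))"
    using eta_pos by (simp only: less_imp_neq[symmetric] fact_nonzero not_False_eq_True)
  also have "\<dots> = g_term K \<alpha> lam P p \<beta> n"
    unfolding eta_eq idle_const_eq unfolding g_term_def B_def G1_def G2_def \<delta>_def
    by (simp add: mult_ac add.commute)
  finally show ?thesis .
qed

text \<open>At \<open>n = 0\<close> the factor \<open>Gamma (1 + \<delta>)\<close> of the densities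
  cancels the one in the moment of order 1, leaving \<open>pi / C_const \<alpha>\<close> times the
  quotient of the weighted sums.\<close>

lemma uncov_moment_0:
  "uncov_moment 0 = 1 - pi / C_const \<alpha> *
     ((\<Sum>i=1..K. p i * lam i * P i powr (2 / \<alpha>) * \<beta> i powr (- 2 / \<alpha>)) /
      (\<Sum>i=1..K. p i * lam i * P i powr (2 / \<alpha>)))"
proof -
  have G: "Gamma (1 + \<delta>) \<noteq> 0"
    using \<delta> by (intro less_imp_neq[symmetric] Gamma_real_pos) auto
  have "(\<Sum>i=1..K. cov_moment 0 i)
      = (\<Sum>i=1..K. p i * lam i * P i powr \<delta> * \<beta> i powr (- \<delta>)) * (pi * Gamma (1 + \<delta>)) / (Gamma (1 + \<delta>) * eta)"
    unfolding cov_moment_def unfolding hyp_factor_def unfolding density_const_def sum_divide_distrib sum_distrib_right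
    by (intro sum.cong refl) (simp add: mult_ac)
  also have "\<dots> = pi * (\<Sum>i=1..K. p i * lam i * P i powr \<delta> * \<beta> i powr (- \<delta>)) / eta"
    using G by simp
  finally show ?thesis
    unfolding uncov_moment_def eta_eq unfolding eta_const_def \<delta>_def by simp
qed

theorem coverage_bounds:
  assumes "0 < m"
  defines "D \<equiv> coverage_prob M K \<alpha> P \<beta> Psi Delta h - pi / C_const \<alpha> *
     ((\<Sum>i=1..K. p i * lam i * P i powr (2 / \<alpha>) * \<beta> i powr (- 2 / \<alpha>)) /
      (\<Sum>i=1..K. p i * lam i * P i powr (2 / \<alpha>)))"
  shows "- (\<Sum>n=1..2*m. g_term K \<alpha> lam P p \<beta> n) \<le> D"
    and "D \<le> - (\<Sum>n=1..2*m-1. g_term K \<alpha> lam P p \<beta> n)"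
proof -
  have sum_eq: "(\<Sum>n<Suc k. (- idle_const) ^ n / fact n * uncov_moment n) = uncov_moment 0 + (\<Sum>n=1..k. g_term K \<alpha> lam P p \<beta> n)" for k
  proof -
    have "(\<Sum>n<Suc k. (- idle_const) ^ n / fact n * uncov_moment n)
        = (- idle_const) ^ 0 / fact 0 * uncov_moment 0 + (\<Sum>n=1..k. (- idle_const) ^ n / fact n * uncov_moment n)"
      unfolding lessThan_Suc_atMost atMost_atLeast0 by (subst sum.atLeast_Suc_atMost) auto
    also have "(\<Sum>n=1..k. (- idle_const) ^ n / fact n * uncov_moment n) = (\<Sum>n=1..k. g_term K \<alpha> lam P p \<beta> n)"
      by (intro sum.cong refl g_term_eq) auto
    finally show ?thesis by simp
  qed
  \<comment> \<open>The main term is absorbed by the Taylor term of order 0, and the outage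
    probability enters with a minus sign, which exchanges upper and lower bounds.\<close>
  have D: "D = uncov_moment 0 - (\<integral>\<omega>. indicator {..<R \<omega>} (Y \<omega>) * uncov \<omega> \<partial>M)"
    unfolding D_def coverage_prob_uncov uncov_moment_0 by simp
  show "- (\<Sum>n=1..2*m. g_term K \<alpha> lam P p \<beta> n) \<le> D"
    \<comment> \<open>The orders 0 to \<open>2 * m\<close> are an odd number of terms: an upper
      bound for outage, hence a lower one for coverage.\<close>
    using Bonferroni(2)[of "Suc (2 * m)"] unfolding D sum_eq by simp
  \<comment> \<open>Subtraction is truncated here, so this is where \<open>m\<close> has to be
    positive.\<close>
  have "Suc (2 * m - 1) = 2 * m" using assms(1) by simp
  then show "D \<le> - (\<Sum>n=1..2*m-1. g_term K \<alpha> lam P p \<beta> n)"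
    using Bonferroni(1)[of "Suc (2 * m - 1)"] unfolding D sum_eq by simp
qed

end

theorem lemma4:
  fixes M :: "'w measure"
    and K m :: nat
    and \<alpha> :: real
    and lam P p \<beta> :: "nat \<Rightarrow> real"
    and Phi Psi Delta :: "nat \<Rightarrow> 'w \<Rightarrow> (real ^ 2) set"
    and h :: "nat \<Rightarrow> 'w \<Rightarrow> real ^ 2 \<Rightarrow> real"
  assumes "K \<ge> 1"
    and "\<alpha> > 2"
    and "\<And>i. i \<in> {1..K} \<Longrightarrow> lam i > 0"
    and "\<And>i. i \<in> {1..K} \<Longrightarrow> P i > 0"
    and "\<And>i. i \<in> {1..K} \<Longrightarrow> p i \<in> {0..1}"
    and "\<exists>i\<in>{1..K}. p i \<noteq> 0"
    and "\<And>i. i \<in> {1..K} \<Longrightarrow> \<beta> i > 1"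
    and "k_tier_network M K lam p Phi Psi Delta h"
    and "m > 0"
  shows "let D = coverage_prob M K \<alpha> P \<beta> Psi Delta h
               - pi / C_const \<alpha> *
                 ((\<Sum>i=1..K. p i * lam i * P i powr (2 / \<alpha>) * \<beta> i powr (- 2 / \<alpha>)) /
                  (\<Sum>i=1..K. p i * lam i * P i powr (2 / \<alpha>)))
         in - (\<Sum>n=1..2*m. g_term K \<alpha> lam P p \<beta> n) \<le> D \<and>
            D \<le> - (\<Sum>n=1..2*m-1. g_term K \<alpha> lam P p \<beta> n)"
proof -
  interpret net: k_tier_network M K lam p Phi Psi Delta h by fact
  \<comment> \<open>The enumeration and the marks are only asserted to exist; the bounds do not
    mention them, so any witnesses will do.\<close>
  obtain N X H where
    1: "\<forall>j\<in>{1..K} \<times> UNIV. \<forall>\<omega>\<in>space M.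
           bij_betw (\<lambda>n. X j n \<omega>) {n. enat n < N j \<omega>} ((\<lambda>(i, active). if active then Psi i else Delta i) j \<omega>) \<and>
           (\<forall>n. enat n < N j \<omega> \<longrightarrow> (\<lambda>(i, active). h i) j \<omega> (X j n \<omega>) = H j n \<omega>)"
    and 2: "net.exponential_marks ({1..K} \<times> UNIV) N X H"
    using net.fading unfolding iid_exponential_marks_def net.exponential_marks_def by blast
  interpret marked_network M K lam p Phi Psi Delta h \<alpha> P \<beta> N X H
  proof
    fix i :: nat and c :: bool and \<omega> assume i: "i \<in> {1..K}" and \<omega>: "\<omega> \<in> space M"
    then have "(i, c) \<in> {1..K} \<times> UNIV" by simp
    from bspec[OF bspec[OF 1 this] \<omega>]
    show "bij_betw (\<lambda>n. X (i, c) n \<omega>) {n. enat n < N (i, c) \<omega>} (if c then Psi i \<omega> else Delta i \<omega>)"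
      and "\<And>n. enat n < N (i, c) \<omega> \<Longrightarrow> h i \<omega> (X (i, c) n \<omega>) = H (i, c) n \<omega>"
      by (auto split: if_splits)
  qed (use assms 2 in auto)
  show ?thesis
    unfolding Let_def using coverage_bounds[OF assms(9)] by blast
qed

end
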